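(* Let $\phi_k=M^*-M_*+2k-1$ and $M_k=M_*-k+1$, and define $c_0=0$, $c_i=c_{i-1}+\phi_i\ln\!\left(\frac{M_i}{M_i-1}\right)$ for $i=1,\dots,M_*-1$, and $c_{M_*}=\infty$. The distortion exponent achieved by the progressive multi-layer list decoding (LS-LD) scheme with infinitely many layers is $\Delta^*_{ls}(b,\nu)=\nu$ if $b\le\nu/M_*$, and if $c_{k-1}+\frac{\nu}{M_k}<b\le c_k+\frac{\nu}{M_k-1}$ for some $k\in\{1,\dots,M_*\}$, it is $$\Delta^*_{ls}(b,\nu)=\nu+\sum_{i=1}^{k-1}\phi_i+M_k\phi_k\left(1-e^{-\frac{b(1-\kappa^* )-c_{k-1}}{\phi_k}}\right),\qquad \kappa^*=\frac{\phi_k}{b}\,\mathcal W\!\left(\frac{e^{\frac{b-c_{k-1}}{\phi_k}}\,\nu}{M_k\phi_k}\right),$$ where $\mathcal W$ is the principal branch of the Lambert $W$ function (the solution $w$ of $z=we^w$).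
   Context: All logarithms are base 2, $\ln$ is natural. Let $M_t,M_r\ge1$ be integers, $M^*=\max\{M_t,M_r\}$, $M_*=\min\{M_t,M_r\}$. A block $S^m$ of i.i.d. $\mathcal{CN}(0,1)$ source samples is sent over one block of $n$ uses of the MIMO channel $\mathbf Y_i=\sqrt{\rho/M_t}\,\mathbf H\mathbf x_i+\mathbf N_i$, SNR $\rho>0$, $\mathbf H\in\mathbb C^{M_r\times M_t}$ with i.i.d. $\mathcal{CN}(0,1)$ entries constant over the block, $\mathbf N_i\sim\mathcal{CN}(0,\mathbf I)$ i.i.d., with power constraint $\sum_i\mathrm{Tr}\,\mathbb E[\mathbf X_i^H\mathbf X_i]\le nM_t$. The receiver observes also $T^m=\sqrt{\rho_s}\Gamma_cS^m+Z^m$, $\Gamma_c\sim\mathcal{CN}(0,1)$ constant over the block, unit-variance Gaussian noise $Z^m$; $\Gamma=|\Gamma_c|^2$ has density $e^{-\gamma}$. All random quantities are independent; the receiver knows $\mathbf H,\gamma$, the transmitter only their distributions. $b=n/m$; $\rho_s\doteq\rho^\nu$, $\nu\ge0$. The distortion exponent of $\mathbb E[D]$ is $-\lim_{\rho\to\infty}\log\mathbb E[D]/\log\rho$. Let $D_d(R,\gamma)=(\rho_s\gamma+2^R)^{-1}$. LS-LD scheme with $L$ layers and rates $R_l=r_l\log\rho$, $r_l\ge0$, $l=1,\dots,L$: the source is encoded into $L$ Gaussian successive-refinement (Wyner–Ziv) layers, layer $l$ carrying $bR_l/L$ bits per source sample, and layer $l$ is sent with the LD scheme (Gaussian channel codebook,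 list decoding jointly with $T^m$ and previously decoded layers) over its own $n/L$ channel uses; layers are decoded in order. With $\bar R_l=\sum_{i=1}^lR_i$, layer $l$ is in outage if $\log\frac{2^{\frac bL\bar R_l}+\gamma\rho_s}{2^{\frac bL\bar R_{l-1}}+\gamma\rho_s}\ge\frac bL\log\det(\mathbf I+\frac{\rho}{M_*}\mathbf H\mathbf H^H)$. If $N$ is the largest $l$ such that none of layers $1,\dots,l$ is in outage, the distortion is $D_d(\frac bL\bar R_N,\gamma)$; the expected distortion is its expectation over $\mathbf H,\Gamma$. Let $\Delta^L_{ls}(b,\nu)$ be the supremum over $(r_1,\dots,r_L)$ of the resulting distortion exponent; the exponent with infinitely many layers is $\Delta^*_{ls}=\lim_{L\to\infty}\Delta^L_{ls}$. *)

theory Defs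
  imports "HOL-Analysis.Analysis"
begin

text \<open>Channel matrices H are elements of complex^'t^'r: 'r rows (M_r = CARD('r)),
  't columns (M_t = CARD('t)).  Entries i.i.d. CN(0,1): density
  exp(-|z|^2)/pi per entry w.r.t. Lebesgue measure on C = R^2.\<close>

definition gauss_matrix_measure :: "('t::finite \<times> 'r::finite) itself \<Rightarrow> (complex^'t^'r) measure" where
  "gauss_matrix_measure _ =
     density lborel (\<lambda>H. ennreal (exp (- (norm H)\<^sup>2) / pi ^ (CARD('t) * CARD('r))))"

definition cnj_transpose :: "complex^'t^'r \<Rightarrow> complex^'r^'t" where
  "cnj_transpose H = (\<chi> i j. cnj (H $ j $ i))"

definition mimo_logdet :: "real \<Rightarrow> complex^'t::finite^'r::finite \<Rightarrow> real" where
  "mimo_logdet \<rho> H =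
     log 2 (Re (det (mat 1 + (\<rho> / real (min CARD('t) CARD('r))) *\<^sub>R (H ** cnj_transpose H))))"

definition Rbar :: "(nat \<Rightarrow> real) \<Rightarrow> real \<Rightarrow> nat \<Rightarrow> real" where
  "Rbar r \<rho> l = (\<Sum>i\<in>{1..l}. r i * log 2 \<rho>)"

definition layer_outage ::
  "real \<Rightarrow> nat \<Rightarrow> real \<Rightarrow> real \<Rightarrow> (nat \<Rightarrow> real) \<Rightarrow> complex^'t::finite^'r::finite \<Rightarrow> real \<Rightarrow> nat \<Rightarrow> bool" where
  "layer_outage b L \<rho> \<rho>s r H \<gamma> l \<longleftrightarrow>
     log 2 ((2 powr (b / real L * Rbar r \<rho> l) + \<gamma> * \<rho>s)
            / (2 powr (b / real L * Rbar r \<rho> (l - 1)) + \<gamma> * \<rho>s))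
       \<ge> b / real L * mimo_logdet \<rho> H"

definition decoded_layers ::
  "real \<Rightarrow> nat \<Rightarrow> real \<Rightarrow> real \<Rightarrow> (nat \<Rightarrow> real) \<Rightarrow> complex^'t::finite^'r::finite \<Rightarrow> real \<Rightarrow> nat" where
  "decoded_layers b L \<rho> \<rho>s r H \<gamma> =
     (GREATEST l. l \<le> L \<and> (\<forall>j\<in>{1..l}. \<not> layer_outage b L \<rho> \<rho>s r H \<gamma> j))"

definition ls_distortion ::
  "real \<Rightarrow> nat \<Rightarrow> real \<Rightarrow> real \<Rightarrow> (nat \<Rightarrow> real) \<Rightarrow> complex^'t::finite^'r::finite \<Rightarrow> real \<Rightarrow> real" where
  "ls_distortion b L \<rho> \<rho>s r H \<gamma> =
     1 / (\<rho>s * \<gamma> + 2 powr (b / real L * Rbar r \<rho> (decoded_layers b L \<rho> \<rho>s r H \<gamma>)))"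

text \<open>Expected distortion over H and Gamma (density e^-gamma on [0,inf)), at SNR rho,
  side-information SNR rho_s(rho).\<close>
definition ls_expected_distortion ::
  "('t::finite \<times> 'r::finite) itself \<Rightarrow> real \<Rightarrow> (real \<Rightarrow> real) \<Rightarrow> nat \<Rightarrow> (nat \<Rightarrow> real) \<Rightarrow> real \<Rightarrow> real" where
  "ls_expected_distortion T b \<rho>s L r \<rho> =
     enn2real (\<integral>\<^sup>+ H. (\<integral>\<^sup>+ \<gamma>. indicator {0..} \<gamma> *
        ennreal (exp (- \<gamma>) * ls_distortion b L \<rho> (\<rho>s \<rho>) r (H :: complex^'t^'r) \<gamma>) \<partial>lborel)
      \<partial>gauss_matrix_measure T)"

definition ls_has_exponent ::
  "('t::finite \<times> 'r::finite) itself \<Rightarrow> real \<Rightarrow> (real \<Rightarrow> real) \<Rightarrow> nat \<Rightarrow> (nat \<Rightarrow> real) \<Rightarrow> real \<Rightarrow> bool" where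
  "ls_has_exponent T b \<rho>s L r \<Delta> \<longleftrightarrow>
     ((\<lambda>\<rho>. - log 2 (ls_expected_distortion T b \<rho>s L r \<rho>) / log 2 \<rho>) \<longlongrightarrow> \<Delta>) at_top"

definition Delta_ls ::
  "('t::finite \<times> 'r::finite) itself \<Rightarrow> real \<Rightarrow> (real \<Rightarrow> real) \<Rightarrow> nat \<Rightarrow> ereal" where
  "Delta_ls T b \<rho>s L =
     Sup {ereal \<Delta> | \<Delta> r. (\<forall>l\<in>{1..L}. 0 \<le> r l) \<and> ls_has_exponent T b \<rho>s L r \<Delta>}"

text \<open>Principal branch of the Lambert W function (real, on [-1/e, inf)).\<close>
definition lambertW :: "real \<Rightarrow> real" where
  "lambertW z = (THE w. -1 \<le> w \<and> w * exp w = z)"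

definition phi :: "nat \<Rightarrow> nat \<Rightarrow> nat \<Rightarrow> real" where
  "phi Ms Mb k = real Mb - real Ms + 2 * real k - 1"

definition Mk :: "nat \<Rightarrow> nat \<Rightarrow> real" where
  "Mk Ms k = real Ms - real k + 1"

text \<open>c_i for i = 0..M_*-1 (c_{M_*} = infinity is handled in ls_region).\<close>
fun cc :: "nat \<Rightarrow> nat \<Rightarrow> nat \<Rightarrow> real" where
  "cc Ms Mb 0 = 0"
| "cc Ms Mb (Suc i) = cc Ms Mb i + phi Ms Mb (Suc i) * ln (Mk Ms (Suc i) / (Mk Ms (Suc i) - 1))"

definition ls_region :: "nat \<Rightarrow> nat \<Rightarrow> real \<Rightarrow> real \<Rightarrow> nat \<Rightarrow> bool" where
  "ls_region Ms Mb b \<nu> k \<longleftrightarrow>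
     cc Ms Mb (k - 1) + \<nu> / Mk Ms k < b \<and>
     (k < Ms \<longrightarrow> b \<le> cc Ms Mb k + \<nu> / (Mk Ms k - 1))"

definition ls_kappa :: "nat \<Rightarrow> nat \<Rightarrow> real \<Rightarrow> real \<Rightarrow> nat \<Rightarrow> real" where
  "ls_kappa Ms Mb b \<nu> k =
     phi Ms Mb k / b *
       lambertW (exp ((b - cc Ms Mb (k - 1)) / phi Ms Mb k) * \<nu> / (Mk Ms k * phi Ms Mb k))"

definition ls_exponent_formula :: "nat \<Rightarrow> nat \<Rightarrow> real \<Rightarrow> real \<Rightarrow> nat \<Rightarrow> real" where
  "ls_exponent_formula Ms Mb b \<nu> k =
     \<nu> + (\<Sum>i\<in>{1..k-1}. phi Ms Mb i)
       + Mk Ms k * phi Ms Mb k *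
         (1 - exp (- (b * (1 - ls_kappa Ms Mb b \<nu> k) - cc Ms Mb (k - 1)) / phi Ms Mb k))"

end

theory Submission
  imports Defs "HOL-Probability.Distributions"
begin

text \<open>
  The determinant enters through the Gaussian integral \<open>Phi\<close> of \<open>exp (- |k|^2 - \<rho> |k H|^2)\<close> over k, which equals
  \<open>\<pi>^r / det (I + \<rho> H H*)\<close>. Eliminating the
  entry g of largest modulus of H replaces H by its Schur complement, whose entries are translates of the remaining
  ones, at the price of a factor \<open>min(1, 1/(\<rho> |g|^2))\<close>. Iterating this in integral form bounds the moments of
  \<open>1 / det\<close>, hence by Markov's inequality the outage probability from above; iterating it on a set of matrices
  with prescribed pivot sizes bounds it from below. Both bounds have the exponent \<open>d(s)\<close>, the piecewise linear
  interpolation of \<open>(M_t - j)(M_r - j)\<close>.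

  With \<open>x_l\<close> the exponent of the rate of the first l layers, the distortion exponent is the minimum of
  \<open>max \<nu> x_L\<close> and of all \<open>max \<nu> x_(l-1) + d(r_l)\<close>. Achieving \<open>\<nu> + \<delta>\<close> thus means moving x from 0 to
  \<open>\<nu> + \<delta>\<close> in time b with speed at most \<open>d^{-1}(\<nu> + \<delta> - max \<nu> x)\<close>. As the speed increases with x, steps of
  finite length are never faster than the continuous motion, and they approach it as L grows. The continuous motion
  needs time \<open>\<nu> / d^{-1}(\<delta>)\<close> plus the integral of \<open>1 / d^{-1}\<close> over \<open>[0, \<delta>]\<close>; equating this with b gives
  the Lambert W formula.
\<close>

section \<open>Integrals over complex product spaces\<close>

text \<open>Schur complements act directly on the entries, whose law is a product measure, and the
  translations they produce are harmless for Lebesgue measure. A Gaussian is not invariant under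
  them, so the recursion for the moments runs over polydiscs with Lebesgue measure, and the Gaussian
  weight enters at the outermost level only. Integer moments suffice because the slopes of d are
  integers: Markov's inequality for the moment whose order is the slope of one affine piece of d
  yields exactly the affine function extending that piece, and d, being convex, is the maximum of
  these functions. The exponents are obtained up to an arbitrarily small loss, which the limit
  defining a distortion exponent does not see. For an arbitrary rate vector only an upper bound on
  its exponent is proved; the exponent is computed exactly just for the vectors that witness
  achievability.\<close>

lemma nn_integral_complex_affine:
  fixes F :: "complex \<Rightarrow> ennreal" and c :: real
  assumes [measurable]: "F \<in> borel_measurable borel" and c: "c \<noteq> 0"
  shows "(\<integral>\<^sup>+z. F z \<partial>lborel) = ennreal (c\<^sup>2) * (\<integral>\<^sup>+z. F (t + c *\<^sub>R z) \<partial>lborel)"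
proof -
  have "(\<integral>\<^sup>+z. F z \<partial>lborel) = (\<integral>\<^sup>+z. F z \<partial>density (distr lborel borel (\<lambda>x. t + c *\<^sub>R x)) (\<lambda>_. \<bar>c\<bar>^DIM(complex)))"
    using lborel_affine[OF c, of t] by simp
  also have "\<dots> = ennreal (c\<^sup>2) * (\<integral>\<^sup>+z. F (t + c *\<^sub>R z) \<partial>lborel)"
    by (simp add: nn_integral_density nn_integral_distr nn_integral_cmult)
  finally show ?thesis .
qed

lemma nn_integral_gauss_real: "(\<integral>\<^sup>+(x::real). ennreal (exp (- x\<^sup>2)) \<partial>lborel) = ennreal (sqrt pi)"
proof -
  have "has_bochner_integral lborel (\<lambda>x::real. exp (- x\<^sup>2)) (sqrt pi)"
    using has_bochner_integral_even_function[OF gaussian_moment_0] by simp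
  then show ?thesis
    by (simp add: has_bochner_integral_iff nn_integral_eq_integral)
qed

lemma nn_integral_gauss_complex0:
  "(\<integral>\<^sup>+(z::complex). ennreal (exp (- (norm z)\<^sup>2)) \<partial>lborel) = ennreal pi"
proof -
  have "(norm z)\<^sup>2 = (\<Sum>b\<in>Basis. (z \<bullet> b)\<^sup>2)" for z :: complex
    by (simp add: Basis_complex_def cmod_power2)
  then have "(\<integral>\<^sup>+(z::complex). ennreal (exp (- (norm z)\<^sup>2)) \<partial>lborel)
     = (\<integral>\<^sup>+(z::complex). (\<Prod>b\<in>Basis. ennreal (exp (- (z \<bullet> b)\<^sup>2))) \<partial>lborel)"
    by (simp add: prod_ennreal exp_sum sum_negf[symmetric])
  also have "\<dots> = (\<Prod>b\<in>(Basis::complex set). ennreal (sqrt pi))"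
    by (subst nn_integral_lborel_prod) (simp_all add: nn_integral_gauss_real)
  also have "\<dots> = ennreal pi"
    by (simp add: Basis_complex_def ennreal_mult[symmetric])
  finally show ?thesis .
qed

lemma nn_integral_gauss_complex:
  assumes "0 < \<beta>"
  shows "(\<integral>\<^sup>+(z::complex). ennreal (exp (- \<beta> * (norm (z + w))\<^sup>2)) \<partial>lborel) = ennreal (pi / \<beta>)"
proof -
  define c where "c = 1 / sqrt \<beta>"
  have c: "c \<noteq> 0" "c\<^sup>2 = 1 / \<beta>" using assms by (auto simp: c_def power_divide)
  have "(\<integral>\<^sup>+(z::complex). ennreal (exp (- \<beta> * (norm (z + w))\<^sup>2)) \<partial>lborel)
    = ennreal (c\<^sup>2) * (\<integral>\<^sup>+z. ennreal (exp (- \<beta> * (norm (((- w) + c *\<^sub>R z) + w))\<^sup>2)) \<partial>lborel)"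
    by (rule nn_integral_complex_affine[OF _ c(1)]) measurable
  also have "(\<lambda>z. - \<beta> * (norm (((- w) + c *\<^sub>R z) + w))\<^sup>2) = (\<lambda>z. - (norm z)\<^sup>2)"
    using assms by (auto simp: power_mult_distrib c)
  finally show ?thesis
    using assms by (simp add: nn_integral_gauss_complex0 c ennreal_mult[symmetric])
qed

lemma nn_integral_abs_powr:
  assumes "-1 < p"
  shows "(\<integral>\<^sup>+(x::real). ennreal (indicator {-1..1} x * \<bar>x\<bar> powr p) \<partial>lborel) < \<infinity>"
proof -
  have h: "((\<lambda>x. x powr p) has_integral (1 powr (p+1) / (p+1))) {0..1}"
    using has_integral_powr_from_0[OF assms, of 1] by simp
  have 1: "(\<integral>\<^sup>+(x::real). ennreal (x powr p * indicator {0..1} x) \<partial>lborel) = ennreal (1 / (p+1))"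
    using nn_integral_has_integral_lebesgue[OF _ h] by (simp add: mult.commute nn_integral_completion)
  have m: "(\<lambda>x::real. ennreal (indicator {0..1} x * \<bar>x\<bar> powr p)) \<in> borel_measurable borel" by measurable
  have 2: "(\<integral>\<^sup>+(x::real). ennreal (indicator {0..1} x * \<bar>x\<bar> powr p) \<partial>lborel) = ennreal (1 / (p+1))"
    unfolding 1[symmetric] by (intro nn_integral_cong) (auto simp: indicator_def)
  have 3: "(\<integral>\<^sup>+(x::real). ennreal (indicator {0..1} (-x) * \<bar>-x\<bar> powr p) \<partial>lborel) = ennreal (1 / (p+1))"
    unfolding 2[symmetric] by (subst (2) lborel_distr_uminus[symmetric], subst nn_integral_distr) auto
  have "(\<integral>\<^sup>+(x::real). ennreal (indicator {-1..1} x * \<bar>x\<bar> powr p) \<partial>lborel)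
     \<le> (\<integral>\<^sup>+(x::real). ennreal (indicator {0..1} x * \<bar>x\<bar> powr p) + ennreal (indicator {0..1} (-x) * \<bar>-x\<bar> powr p) \<partial>lborel)"
    by (intro nn_integral_mono) (auto simp: indicator_def)
  also have "\<dots> = ennreal (1 / (p+1)) + ennreal (1 / (p+1))"
    using 2 3 by (subst nn_integral_add) auto
  also have "\<dots> < \<infinity>" by simp
  finally show ?thesis .
qed

text \<open>Polar coordinates are avoided: \<open>|Re z| |Im z|\<close> is at most
  \<open>|z|^2\<close>, so for negative p the integrand is at most a product of a function of
  \<open>Re z\<close> and one of \<open>Im z\<close>, and each factor is integrable when p >
  -1.\<close>

lemma nn_integral_norm_powr_unit_disc:
  assumes p: "-1 < p"
  shows "(\<integral>\<^sup>+(z::complex). ennreal (indicator {z. norm z \<le> 1} z * ((norm z)\<^sup>2) powr p) \<partial>lborel) < \<infinity>"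
proof (cases "p \<ge> 0")
  case True
  have "(\<integral>\<^sup>+(z::complex). ennreal (indicator {z. norm z \<le> 1} z * ((norm z)\<^sup>2) powr p) \<partial>lborel)
    \<le> (\<integral>\<^sup>+(z::complex). indicator {z. norm z \<le> 1} z \<partial>lborel)"
    using True by (intro nn_integral_mono) (auto simp: indicator_def power_le_one intro!: powr_le1)
  also have "\<dots> < \<infinity>" using emeasure_lborel_cball_finite[of "0::complex" 1] by (simp add: cball_def)
  finally show ?thesis .
next
  case False
  let ?f = "\<lambda>x::real. ennreal (indicator {-1..1} x * \<bar>x\<bar> powr p)"
  let ?c = "\<lambda>z::complex. ennreal (indicator {z. norm z \<le> 1} z * ((norm z)\<^sup>2) powr p)"
  \<comment> \<open>On the axes \<open>0 powr p\<close> is 0 and the product bound would fail; they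
    form a null set.\<close>
  have A1: "AE z::complex in lborel. Re z \<noteq> 0 \<and> Im z \<noteq> 0"
  proof -
    have "{x::complex. x \<bullet> 1 = 0} \<in> null_sets lebesgue" "{x::complex. x \<bullet> \<i> = 0} \<in> null_sets lebesgue"
      using negligible_standard_hyperplane[of "1::complex" 0] negligible_standard_hyperplane[of "\<i>::complex" 0]
      by (auto simp: negligible_iff_null_sets Basis_complex_def)
    then have "{x::complex. x \<bullet> 1 = 0} \<union> {x::complex. x \<bullet> \<i> = 0} \<in> null_sets lborel"
      by (intro null_sets.Un) (auto simp: null_sets_completion_iff)
    then show ?thesis
      by (rule AE_I') auto
  qed
  have "AE z in lborel. ?c z \<le> (\<Prod>b\<in>Basis. ?f (z \<bullet> b))"
    using A1
  proof eventually_elim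
    case (elim z)
    have nr: "\<bar>Re z\<bar> \<le> norm z" "\<bar>Im z\<bar> \<le> norm z" by (auto simp: abs_Re_le_cmod abs_Im_le_cmod)
    show ?case
    proof (cases "norm z \<le> 1")
      case True
      have "\<bar>Re z\<bar> * \<bar>Im z\<bar> \<le> (norm z)\<^sup>2"
        using nr by (metis mult_mono power2_eq_square abs_ge_zero order_trans)
      then have "(norm z)\<^sup>2 powr p \<le> (\<bar>Re z\<bar> * \<bar>Im z\<bar>) powr p"
        using elim False by (intro powr_mono2') auto
      also have "\<dots> = \<bar>Re z\<bar> powr p * \<bar>Im z\<bar> powr p" by (simp add: powr_mult)
      finally have "(norm z)\<^sup>2 powr p \<le> \<bar>Re z\<bar> powr p * \<bar>Im z\<bar> powr p" .
      moreover have "\<bar>Re z\<bar> \<le> 1" "\<bar>Im z\<bar> \<le> 1" using nr True by auto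
      ultimately show ?thesis
        by (auto simp: Basis_complex_def ennreal_mult[symmetric] indicator_def abs_le_iff)
    qed auto
  qed
  then have "(\<integral>\<^sup>+z. ?c z \<partial>lborel) \<le> (\<integral>\<^sup>+(z::complex). (\<Prod>b\<in>Basis. ?f (z \<bullet> b)) \<partial>lborel)"
    by (rule nn_integral_mono_AE)
  also have "\<dots> = (\<Prod>b\<in>(Basis::complex set). \<integral>\<^sup>+x. ?f x \<partial>lborel)"
    by (subst nn_integral_lborel_prod) simp_all
  also have "\<dots> < \<infinity>"
    using nn_integral_abs_powr[OF p] by (simp add: Basis_complex_def ennreal_mult_less_top)
  finally show ?thesis .
qed

text \<open>Inside the unit disc the preceding bound applies; outside it, half of the Gaussian decay
  absorbs any power.\<close>

lemma nn_integral_norm_powr_gauss: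
  assumes p: "-1 < p"
  shows "(\<integral>\<^sup>+(z::complex). ennreal (exp (- (norm z)\<^sup>2) * ((norm z)\<^sup>2) powr p) \<partial>lborel) < \<infinity>"
proof -
  \<comment> \<open>Raising \<open>x/(2p) \<le> exp (x/(2p))\<close> to the power p gives
    \<open>x^p \<le> (2p)^p exp (x/2)\<close>. For p \<le> 0 this C is \<open>0 powr 0\<close>,
    which is 0, hence the maximum with 1 in K.\<close>
  define C where "C = (2 * max p 0) powr (max p 0)"
  define K where "K = max 1 C"
  have K: "1 \<le> K" "C \<le> K" by (auto simp: K_def)
  have C: "x powr p \<le> K * exp (x / 2)" if "x \<ge> 1" for x
  proof -
    have "x powr p \<le> x powr (max p 0)" using that by (intro powr_mono) auto
    also have "\<dots> \<le> K * exp (x / 2)"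
    proof (cases "p \<le> 0")
      case True
      have "1 * 1 \<le> K * exp (x / 2)" using that K by (intro mult_mono) auto
      then show ?thesis using True that by (simp add: max_def)
    next
      case False
      have "x / (2*p) \<le> exp (x / (2*p))" using exp_ge_add_one_self[of "x/(2*p)"] by linarith
      then have "(x / (2*p)) powr p \<le> exp (x / (2*p)) powr p"
        using False that by (intro powr_mono2) auto
      also have "\<dots> = exp (x / 2)" using False by (simp add: powr_def)
      finally have "x powr p \<le> C * exp (x / 2)"
        using False that by (simp add: powr_divide C_def max_def field_simps)
      also have "\<dots> \<le> K * exp (x/2)" using K by (intro mult_right_mono) auto
      finally show ?thesis using False by (simp add: max_def)
    qed
    finally show ?thesis .
  qed
  have "(\<integral>\<^sup>+(z::complex). ennreal (exp (- (norm z)\<^sup>2) * ((norm z)\<^sup>2) powr p) \<partial>lborel)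
    \<le> (\<integral>\<^sup>+(z::complex). ennreal (indicator {z. norm z \<le> 1} z * ((norm z)\<^sup>2) powr p)
         + ennreal (K) * ennreal (exp (- (1/2) * (norm (z + 0))\<^sup>2)) \<partial>lborel)"
  proof (intro nn_integral_mono)
    fix z :: complex
    show "ennreal (exp (- (norm z)\<^sup>2) * ((norm z)\<^sup>2) powr p) \<le> ennreal (indicator {z. norm z \<le> 1} z * ((norm z)\<^sup>2) powr p)
         + ennreal (K) * ennreal (exp (- (1/2) * (norm (z + 0))\<^sup>2))"
    proof (cases "norm z \<le> 1")
      case True
      then have "ennreal (exp (- (norm z)\<^sup>2) * ((norm z)\<^sup>2) powr p) \<le> ennreal (indicator {z. norm z \<le> 1} z * ((norm z)\<^sup>2) powr p)"
        by (intro ennreal_leI mult_right_mono) auto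
      then show ?thesis by (rule order_trans) simp
    next
      case False
      then have "1 \<le> (norm z)\<^sup>2" by (simp add: one_le_power)
      from C[OF this] have "exp (- (norm z)\<^sup>2) * ((norm z)\<^sup>2) powr p \<le> exp (- (norm z)\<^sup>2) * (K * exp ((norm z)\<^sup>2 / 2))"
        by (intro mult_left_mono) auto
      also have "\<dots> = K * exp (- (1/2) * (norm (z + 0))\<^sup>2)"
        by (simp add: mult.left_commute exp_add[symmetric] field_simps)
      finally have "ennreal (exp (- (norm z)\<^sup>2) * ((norm z)\<^sup>2) powr p) \<le> ennreal (K) * ennreal (exp (- (1/2) * (norm (z + 0))\<^sup>2))"
        by (simp add: ennreal_mult''[symmetric] ennreal_leI)
      then show ?thesis by (rule order_trans) simp
    qed
  qed
  also have "\<dots> = (\<integral>\<^sup>+(z::complex). ennreal (indicator {z. norm z \<le> 1} z * ((norm z)\<^sup>2) powr p) \<partial>lborel)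
      + ennreal (K) * ennreal (pi / (1/2))"
  proof (subst nn_integral_add)
    show "(\<lambda>z::complex. ennreal (indicator {z. norm z \<le> 1} z * ((norm z)\<^sup>2) powr p)) \<in> borel_measurable lborel"
      "(\<lambda>z::complex. ennreal (K) * ennreal (exp (- (1/2) * (norm (z + 0))\<^sup>2))) \<in> borel_measurable lborel"
      by measurable
    have "(\<integral>\<^sup>+(z::complex). ennreal (K) * ennreal (exp (- (1/2) * (norm (z + 0))\<^sup>2)) \<partial>lborel)
      = ennreal (K) * (\<integral>\<^sup>+(z::complex). ennreal (exp (- (1/2) * (norm (z + 0))\<^sup>2)) \<partial>lborel)"
      by (rule nn_integral_cmult) measurable
    also have "(\<integral>\<^sup>+(z::complex). ennreal (exp (- (1/2) * (norm (z + 0))\<^sup>2)) \<partial>lborel) = ennreal (pi / (1/2))"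
      by (rule nn_integral_gauss_complex) simp
    finally show "(\<integral>\<^sup>+(z::complex). ennreal (indicator {z. norm z \<le> 1} z * ((norm z)\<^sup>2) powr p) \<partial>lborel)
       + (\<integral>\<^sup>+(z::complex). ennreal (K) * ennreal (exp (- (1/2) * (norm (z + 0))\<^sup>2)) \<partial>lborel)
      = (\<integral>\<^sup>+(z::complex). ennreal (indicator {z. norm z \<le> 1} z * ((norm z)\<^sup>2) powr p) \<partial>lborel)
      + ennreal (K) * ennreal (pi / (1/2))"
      by simp
  qed
  also have "\<dots> < \<infinity>"
    using nn_integral_norm_powr_unit_disc[OF p] K by (simp add: ennreal_mult''[symmetric])
  finally show ?thesis .
qed

section \<open>Finite products of complex planes\<close>

interpretation complex_product: product_sigma_finite "\<lambda>_::'i. lborel :: complex measure"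
  by standard

lemma measurable_PiM_complex_affine:
  fixes t :: "'i \<Rightarrow> complex" and c :: real
  shows "(\<lambda>f. \<lambda>i\<in>J. t i + c *\<^sub>R f i) \<in> PiM J (\<lambda>_. lborel) \<rightarrow>\<^sub>M PiM J (\<lambda>_. lborel)"
proof (intro measurable_restrict)
  fix i assume "i \<in> J"
  then have "(\<lambda>f. f i) \<in> PiM J (\<lambda>_. lborel) \<rightarrow>\<^sub>M (lborel :: complex measure)"
    by (rule measurable_component_singleton)
  then have "(\<lambda>f. t i + c *\<^sub>R f i) \<in> borel_measurable (PiM J (\<lambda>_. lborel :: complex measure))"
    by (intro borel_measurable_add borel_measurable_const borel_measurable_scaleR) (simp only: measurable_lborel1 measurable_lborel2)
  then show "(\<lambda>f. t i + c *\<^sub>R f i) \<in> PiM J (\<lambda>_. lborel) \<rightarrow>\<^sub>M lborel"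
    by (simp only: measurable_lborel1 measurable_lborel2)
qed

text \<open>One coordinate is integrated at a time, and each contributes the Jacobian
  \<open>c^2\<close> of a scaling of the real plane.\<close>

lemma nn_integral_PiM_complex_affine:
  fixes F :: "('i \<Rightarrow> complex) \<Rightarrow> ennreal"
  assumes "finite I" and "F \<in> borel_measurable (PiM I (\<lambda>_. lborel))" and c: "c \<noteq> 0"
  shows "(\<integral>\<^sup>+f. F f \<partial>PiM I (\<lambda>_. lborel)) =
    ennreal (c\<^sup>2) ^ card I * (\<integral>\<^sup>+f. F (\<lambda>i\<in>I. t i + c *\<^sub>R f i) \<partial>PiM I (\<lambda>_. lborel))"
  using assms(1,2)
proof (induction I arbitrary: F rule: finite_induct)
  case empty
  show ?case
    by (simp only: card.empty power_0 mult_1 complex_product.nn_integral_empty[OF zero_le] restrict_def empty_iff if_False)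
next
  case (insert i I)
  note [measurable] = insert.prems
  interpret fs: sigma_finite_measure "PiM I (\<lambda>_. lborel :: complex measure)"
    by (rule complex_product.sigma_finite[OF insert.hyps(1)])
  note mT = measurable_PiM_complex_affine
  note [measurable] = mT[of t c I]
  have m1: "(\<lambda>f. F (f(i := y))) \<in> borel_measurable (PiM I (\<lambda>_. lborel))" for y
    by measurable
  have m2: "(\<lambda>y. \<integral>\<^sup>+f. F ((\<lambda>i\<in>I. t i + c *\<^sub>R f i)(i := y)) \<partial>PiM I (\<lambda>_. lborel)) \<in> borel_measurable borel"
    by measurable
  have m3: "(\<lambda>y. \<integral>\<^sup>+f. F ((\<lambda>i\<in>I. t i + c *\<^sub>R f i)(i := t i + c *\<^sub>R y)) \<partial>PiM I (\<lambda>_. lborel)) \<in> borel_measurable lborel"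
    by measurable
  have m4: "(\<lambda>f. F (\<lambda>j\<in>insert i I. t j + c *\<^sub>R f j)) \<in> borel_measurable (PiM (insert i I) (\<lambda>_. lborel))"
    by (rule measurable_compose[OF mT insert.prems])
  have "(\<integral>\<^sup>+f. F f \<partial>PiM (insert i I) (\<lambda>_. lborel)) = (\<integral>\<^sup>+y. (\<integral>\<^sup>+f. F (f(i := y)) \<partial>PiM I (\<lambda>_. lborel)) \<partial>lborel)"
    by (rule complex_product.product_nn_integral_insert_rev[OF insert.hyps insert.prems])
  also have "\<dots> = (\<integral>\<^sup>+y. ennreal (c\<^sup>2) ^ card I * (\<integral>\<^sup>+f. F ((\<lambda>i\<in>I. t i + c *\<^sub>R f i)(i := y)) \<partial>PiM I (\<lambda>_. lborel)) \<partial>lborel)"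
    by (intro nn_integral_cong insert.IH m1)
  also have "\<dots> = ennreal (c\<^sup>2) * (\<integral>\<^sup>+y. ennreal (c\<^sup>2) ^ card I * (\<integral>\<^sup>+f. F ((\<lambda>i\<in>I. t i + c *\<^sub>R f i)(i := t i + c *\<^sub>R y)) \<partial>PiM I (\<lambda>_. lborel)) \<partial>lborel)"
    by (rule nn_integral_complex_affine[OF _ c]) (intro borel_measurable_times_ennreal borel_measurable_const m2)
  also have "\<dots> = ennreal (c\<^sup>2) * (ennreal (c\<^sup>2) ^ card I * (\<integral>\<^sup>+y. (\<integral>\<^sup>+f. F ((\<lambda>i\<in>I. t i + c *\<^sub>R f i)(i := t i + c *\<^sub>R y)) \<partial>PiM I (\<lambda>_. lborel)) \<partial>lborel))"
    by (subst nn_integral_cmult[OF m3]) (rule refl)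
  also have "(\<integral>\<^sup>+y. (\<integral>\<^sup>+f. F ((\<lambda>i\<in>I. t i + c *\<^sub>R f i)(i := t i + c *\<^sub>R y)) \<partial>PiM I (\<lambda>_. lborel)) \<partial>lborel)
     = (\<integral>\<^sup>+y. (\<integral>\<^sup>+f. F (\<lambda>j\<in>insert i I. t j + c *\<^sub>R (f(i := y)) j) \<partial>PiM I (\<lambda>_. lborel)) \<partial>lborel)"
    using insert.hyps(2) by (intro nn_integral_cong arg_cong[where f = F]) (auto simp: fun_eq_iff restrict_def)
  also have "\<dots> = (\<integral>\<^sup>+f. F (\<lambda>j\<in>insert i I. t j + c *\<^sub>R f j) \<partial>PiM (insert i I) (\<lambda>_. lborel))"
    by (rule complex_product.product_nn_integral_insert_rev[OF insert.hyps m4, symmetric])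
  finally show ?case
    by (subst card_insert_disjoint[OF insert.hyps]) (simp only: power_Suc mult.assoc)
qed

section \<open>The Gaussian functional of a matrix\<close>

abbreviation Pi_lborel :: "'i set \<Rightarrow> ('i \<Rightarrow> complex) measure" where
  "Pi_lborel I \<equiv> PiM I (\<lambda>_. lborel)"

text \<open>Arbitrary index sets are carried along because elimination removes a row and a column.
  The weight \<alpha> is a parameter because the lower bound increases it at each
  elimination.\<close>

definition Phi :: "'a set \<Rightarrow> 'b set \<Rightarrow> real \<Rightarrow> real \<Rightarrow> ('a \<times> 'b \<Rightarrow> complex) \<Rightarrow> ennreal" where
  "Phi A B \<alpha> \<rho> f = (\<integral>\<^sup>+k. ennreal (exp (- \<alpha> * (\<Sum>i\<in>A. (norm (k i))\<^sup>2)
      - \<rho> * (\<Sum>j\<in>B. (norm (\<Sum>i\<in>A. k i * f (i, j)))\<^sup>2))) \<partial>Pi_lborel A)"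

definition schur :: "'a \<Rightarrow> 'b \<Rightarrow> ('a \<times> 'b \<Rightarrow> complex) \<Rightarrow> 'a \<times> 'b \<Rightarrow> complex" where
  "schur p q f = (\<lambda>(i, j). f (i, j) - f (i, q) * f (p, j) / f (p, q))"

lemma Pi_lborel_component:
  "g \<in> M \<rightarrow>\<^sub>M Pi_lborel I \<Longrightarrow> i \<in> I \<Longrightarrow> (\<lambda>x. g x i) \<in> borel_measurable M"
  using measurable_compose[OF _ measurable_component_singleton[of i I "\<lambda>_. lborel :: complex measure"], of g M]
  by (simp only: measurable_lborel1 measurable_lborel2)

lemma Phi_integrand_measurable:
  "(\<lambda>x. exp (- \<alpha> * (\<Sum>i\<in>A. (norm (snd x i))\<^sup>2)
      - \<rho> * (\<Sum>j\<in>B. (norm (\<Sum>i\<in>A. snd x i * fst x (i, j)))\<^sup>2))) \<in> borel_measurable (Pi_lborel (A \<times> B) \<Otimes>\<^sub>M Pi_lborel A)"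
proof -
  have 1 [measurable]: "(\<lambda>x. snd x i) \<in> borel_measurable (Pi_lborel (A \<times> B) \<Otimes>\<^sub>M Pi_lborel A)" if "i \<in> A" for i
    by (rule Pi_lborel_component[OF measurable_snd that])
  have 2 [measurable]: "(\<lambda>x. fst x (i, j)) \<in> borel_measurable (Pi_lborel (A \<times> B) \<Otimes>\<^sub>M Pi_lborel A)" if "i \<in> A" "j \<in> B" for i j
    by (rule Pi_lborel_component[OF measurable_fst]) (use that in auto)
  show ?thesis
    by (intro measurable_compose[OF _ borel_measurable_norm] borel_measurable_diff borel_measurable_times borel_measurable_const
        borel_measurable_sum borel_measurable_power 1 2 measurable_compose[OF _ borel_measurable_exp])
qed

lemma Phi_measurable [measurable]:
  assumes "finite A"
  shows "Phi A B \<alpha> \<rho> \<in> borel_measurable (Pi_lborel (A \<times> B))"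
proof -
  interpret fs: sigma_finite_measure "Pi_lborel A" by (rule complex_product.sigma_finite[OF assms])
  have "(\<lambda>x. \<integral>\<^sup>+k. ennreal (exp (- \<alpha> * (\<Sum>i\<in>A. (norm (snd (x, k) i))\<^sup>2)
      - \<rho> * (\<Sum>j\<in>B. (norm (\<Sum>i\<in>A. snd (x, k) i * fst (x, k) (i, j)))\<^sup>2))) \<partial>Pi_lborel A) \<in> borel_measurable (Pi_lborel (A \<times> B))"
    by (rule fs.borel_measurable_nn_integral)
      (use Phi_integrand_measurable[where \<alpha>=\<alpha> and A=A and \<rho>=\<rho> and B=B] in \<open>simp add: split_beta' measurable_compose[OF _ measurable_ennreal]\<close>)
  then show ?thesis by (simp add: Phi_def[abs_def])
qed

lemma Phi_section_measurable:
  "(\<lambda>k. ennreal (exp (- \<alpha> * (\<Sum>i\<in>A. (norm (k i))\<^sup>2)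
      - \<rho> * (\<Sum>j\<in>B. (norm (\<Sum>i\<in>A. k i * f (i, j)))\<^sup>2)))) \<in> borel_measurable (Pi_lborel A)"
proof -
  have 1: "(\<lambda>x. x i) \<in> borel_measurable (Pi_lborel A)" if "i \<in> A" for i
    by (rule Pi_lborel_component[OF measurable_ident that, simplified])
  show ?thesis
    by (intro measurable_compose[OF _ measurable_ennreal] measurable_compose[OF _ borel_measurable_norm] borel_measurable_diff borel_measurable_times borel_measurable_const
        borel_measurable_sum borel_measurable_power 1 measurable_compose[OF _ borel_measurable_exp])
qed

lemma Phi_cong:
  "(\<And>i j. i \<in> A \<Longrightarrow> j \<in> B \<Longrightarrow> f (i, j) = g (i, j)) \<Longrightarrow> Phi A B \<alpha> \<rho> f = Phi A B \<alpha> \<rho> g"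
  unfolding Phi_def by (intro nn_integral_cong) simp

text \<open>Allows the radius of a polydisc to be traded for a change of \<rho>.\<close>

lemma Phi_scale: "Phi A B \<alpha> \<rho> (\<lambda>x. c *\<^sub>R f x) = Phi A B \<alpha> (\<rho> * c\<^sup>2) f"
proof -
  have "(\<Sum>i\<in>A. k i * (c *\<^sub>R f (i, j))) = c *\<^sub>R (\<Sum>i\<in>A. k i * f (i, j))" for k j
    by (simp add: scaleR_sum_right)
  then show ?thesis
    by (simp add: Phi_def power_mult_distrib sum_distrib_left[symmetric] mult.assoc)
qed

lemma Phi_antimono:
  assumes "\<alpha> \<le> \<alpha>'" "\<rho> \<le> \<rho>'"
  shows "Phi A B \<alpha>' \<rho>' f \<le> Phi A B \<alpha> \<rho> f"
  unfolding Phi_def using assms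
  by (intro nn_integral_mono ennreal_leI)
    (auto intro!: diff_mono mult_right_mono sum_nonneg)

lemma Phi_zero:
  assumes "finite A" "0 < \<alpha>"
  shows "Phi A B \<alpha> 0 f = ennreal (pi / \<alpha>) ^ card A"
proof -
  have "Phi A B \<alpha> 0 f = (\<integral>\<^sup>+k. (\<Prod>i\<in>A. ennreal (exp (- \<alpha> * (norm (k i + 0))\<^sup>2))) \<partial>Pi_lborel A)"
    using assms(1) by (simp add: Phi_def prod_ennreal exp_sum[symmetric] sum_distrib_left sum_negf[symmetric])
  also have "\<dots> = (\<Prod>i\<in>A. \<integral>\<^sup>+(z::complex). ennreal (exp (- \<alpha> * (norm (z + 0))\<^sup>2)) \<partial>lborel)"
    by (rule complex_product.product_nn_integral_prod[OF assms(1)]) simp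
  also have "\<dots> = ennreal (pi / \<alpha>) ^ card A"
    by (simp only: nn_integral_gauss_complex[OF assms(2)] prod_constant)
  finally show ?thesis .
qed

lemma Phi_le:
  assumes "finite A" "0 < \<alpha>" "0 \<le> \<rho>"
  shows "Phi A B \<alpha> \<rho> f \<le> ennreal (pi / \<alpha>) ^ card A"
  using Phi_antimono[of \<alpha> \<alpha> 0 \<rho> A B f] Phi_zero[OF assms(1,2), of B f] assms by simp

section \<open>One elimination step for \<open>Phi\<close>\<close>

lemma norm_add_sq_le: "(norm (a + b :: 'a::real_normed_vector))\<^sup>2 \<le> 2 * (norm a)\<^sup>2 + 2 * (norm b)\<^sup>2"
proof -
  have "(norm (a + b))\<^sup>2 \<le> (norm a + norm b)\<^sup>2" by (intro power_mono norm_triangle_ineq) auto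
  also have "\<dots> \<le> 2 * (norm a)\<^sup>2 + 2 * (norm b)\<^sup>2" by (smt (verit) sum_squares_bound power2_sum)
  finally show ?thesis .
qed

context
  fixes A :: "'a set" and B :: "'b set" and p q and f :: "'a \<times> 'b \<Rightarrow> complex" and k :: "'a \<Rightarrow> complex"
  assumes fin: "finite A" "finite B" and p: "p \<in> A" and q: "q \<in> B"
    and g: "f (p, q) \<noteq> 0" and row: "\<And>j. j \<in> B \<Longrightarrow> norm (f (p, j)) \<le> norm (f (p, q))"
begin

text \<open>The sums are the entries of the row vector k f. Expressing \<open>k p\<close> through
  the entry in the pivot column leaves the Schur complement as the coefficients of the remaining
  coordinates of k.\<close>

lemma pivot_column:
  assumes "j \<in> B"
  shows "(\<Sum>i\<in>A. k i * f (i, j)) = f (p, j) / f (p, q) * (\<Sum>i\<in>A. k i * f (i, q))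
     + (\<Sum>i\<in>A - {p}. k i * schur p q f (i, j))"
proof -
  have "(\<Sum>i\<in>A - {p}. k i * schur p q f (i, j)) = (\<Sum>i\<in>A - {p}. k i * f (i, j)) - f (p, j) / f (p, q) * (\<Sum>i\<in>A - {p}. k i * f (i, q))"
    by (simp add: schur_def sum_subtractf right_diff_distrib sum_distrib_left mult_ac)
  moreover have "(\<Sum>i\<in>A. k i * f (i, l)) = k p * f (p, l) + (\<Sum>i\<in>A - {p}. k i * f (i, l))" for l
    using fin p by (simp add: sum.remove)
  ultimately show ?thesis using g by (simp add: field_simps)
qed

lemma pivot_ratio: "j \<in> B \<Longrightarrow> norm (f (p, j) / f (p, q) * w) \<le> norm w"
  using row[of j] g by (simp add: norm_mult norm_divide divide_le_eq mult.commute[of _ "norm w"] mult_left_mono)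

text \<open>Each Schur column is column j minus a multiple, with factor of modulus at most 1, of the
  pivot column, so its square is at most \<open>2 |y j|^2 + 2 |y q|^2\<close>. Half of the total on
  the right is spent on the pivot column and the other half on the Schur columns, whence the
  constants 1/2 and \<open>1 / (4 card B)\<close>.\<close>

lemma pivot_upper_pointwise:
  "(1/2) * (norm (\<Sum>i\<in>A. k i * f (i, q)))\<^sup>2
     + (1 / (4 * real (card B))) * (\<Sum>j\<in>B - {q}. (norm (\<Sum>i\<in>A - {p}. k i * schur p q f (i, j)))\<^sup>2)
   \<le> (\<Sum>j\<in>B. (norm (\<Sum>i\<in>A. k i * f (i, j)))\<^sup>2)"
proof -
  define y where "y j = (\<Sum>i\<in>A. k i * f (i, j))" for j
  define v where "v j = (\<Sum>i\<in>A - {p}. k i * schur p q f (i, j))" for j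
  have cB: "card B \<ge> 1" using fin q by (metis card_0_eq empty_iff less_one not_le)
  have "(norm (v j))\<^sup>2 \<le> 2 * (norm (y j))\<^sup>2 + 2 * (norm (y q))\<^sup>2" if "j \<in> B" for j
  proof -
    have "v j = y j + - (f (p, j) / f (p, q) * y q)" using pivot_column[OF that] by (simp add: y_def v_def)
    then have "(norm (v j))\<^sup>2 \<le> 2 * (norm (y j))\<^sup>2 + 2 * (norm (- (f (p, j) / f (p, q) * y q)))\<^sup>2"
      using norm_add_sq_le by metis
    also have "\<dots> \<le> 2 * (norm (y j))\<^sup>2 + 2 * (norm (y q))\<^sup>2"
      using power_mono[OF pivot_ratio[OF that, of "y q"] norm_ge_zero, of 2] by (simp only: norm_minus_cancel)
    finally show ?thesis .
  qed
  then have "(\<Sum>j\<in>B - {q}. (norm (v j))\<^sup>2) \<le> (\<Sum>j\<in>B - {q}. 2 * (norm (y j))\<^sup>2 + 2 * (norm (y q))\<^sup>2)"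
    by (intro sum_mono) auto
  also have "\<dots> = 2 * (\<Sum>j\<in>B - {q}. (norm (y j))\<^sup>2) + 2 * (real (card B) - 1) * (norm (y q))\<^sup>2"
    using fin q cB by (simp add: sum.distrib sum_distrib_left[symmetric] of_nat_diff)
  also have "\<dots> \<le> 2 * real (card B) * (\<Sum>j\<in>B - {q}. (norm (y j))\<^sup>2) + 2 * real (card B) * (norm (y q))\<^sup>2"
    using cB by (intro add_mono mult_right_mono sum_nonneg) auto
  also have "\<dots> = 2 * real (card B) * (\<Sum>j\<in>B. (norm (y j))\<^sup>2)"
    using fin q by (simp add: sum.remove[of B q] algebra_simps)
  finally have "(1 / (4 * real (card B))) * (\<Sum>j\<in>B - {q}. (norm (v j))\<^sup>2) \<le> (1/2) * (\<Sum>j\<in>B. (norm (y j))\<^sup>2)"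
    using cB by (simp add: field_simps)
  moreover have "(1/2) * (norm (y q))\<^sup>2 \<le> (1/2) * (\<Sum>j\<in>B. (norm (y j))\<^sup>2)"
    using member_le_sum[OF q, of "\<lambda>j. (norm (y j))\<^sup>2"] fin by simp
  ultimately show ?thesis unfolding y_def v_def by linarith
qed

text \<open>The same decomposition read in the other direction: column j is the Schur column plus a
  multiple of the pivot column.\<close>

lemma pivot_lower_pointwise:
  "(\<Sum>j\<in>B. (norm (\<Sum>i\<in>A. k i * f (i, j)))\<^sup>2)
    \<le> 2 * real (card B) * (norm (\<Sum>i\<in>A. k i * f (i, q)))\<^sup>2
     + 2 * (\<Sum>j\<in>B - {q}. (norm (\<Sum>i\<in>A - {p}. k i * schur p q f (i, j)))\<^sup>2)"
proof -
  define y where "y j = (\<Sum>i\<in>A. k i * f (i, j))" for j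
  define v where "v j = (\<Sum>i\<in>A - {p}. k i * schur p q f (i, j))" for j
  have cB: "card B \<ge> 1" using fin q by (metis card_0_eq empty_iff less_one not_le)
  have "(norm (y j))\<^sup>2 \<le> 2 * (norm (y q))\<^sup>2 + 2 * (norm (v j))\<^sup>2" if "j \<in> B" for j
  proof -
    have "y j = f (p, j) / f (p, q) * y q + v j" using pivot_column[OF that] by (simp add: y_def v_def)
    then have "(norm (y j))\<^sup>2 \<le> 2 * (norm (f (p, j) / f (p, q) * y q))\<^sup>2 + 2 * (norm (v j))\<^sup>2"
      using norm_add_sq_le by metis
    also have "\<dots> \<le> 2 * (norm (y q))\<^sup>2 + 2 * (norm (v j))\<^sup>2"
      using power_mono[OF pivot_ratio[OF that, of "y q"] norm_ge_zero, of 2] by simp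
    finally show ?thesis .
  qed
  then have "(\<Sum>j\<in>B - {q}. (norm (y j))\<^sup>2) \<le> (\<Sum>j\<in>B - {q}. 2 * (norm (y q))\<^sup>2 + 2 * (norm (v j))\<^sup>2)"
    by (intro sum_mono) auto
  also have "\<dots> = 2 * (\<Sum>j\<in>B - {q}. (norm (v j))\<^sup>2) + 2 * (real (card B) - 1) * (norm (y q))\<^sup>2"
    using fin q cB by (simp add: sum.distrib sum_distrib_left[symmetric] of_nat_diff)
  finally have "(\<Sum>j\<in>B. (norm (y j))\<^sup>2) \<le> (norm (y q))\<^sup>2 + 2 * (\<Sum>j\<in>B - {q}. (norm (v j))\<^sup>2) + 2 * (real (card B) - 1) * (norm (y q))\<^sup>2"
    using fin q by (simp add: sum.remove[of B q])
  also have "\<dots> \<le> 2 * real (card B) * (norm (y q))\<^sup>2 + 2 * (\<Sum>j\<in>B - {q}. (norm (v j))\<^sup>2)"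
    by (simp add: algebra_simps)
  finally show ?thesis unfolding y_def v_def .
qed

end

lemma Phi_split:
  assumes "finite A" "p \<in> A"
  shows "Phi A B \<alpha> \<rho> f = (\<integral>\<^sup>+k. (\<integral>\<^sup>+z. ennreal (exp (- \<alpha> * (\<Sum>i\<in>A. (norm ((k(p := z)) i))\<^sup>2)
      - \<rho> * (\<Sum>j\<in>B. (norm (\<Sum>i\<in>A. (k(p := z)) i * f (i, j)))\<^sup>2))) \<partial>lborel) \<partial>Pi_lborel (A - {p}))"
proof -
  have A: "insert p (A - {p}) = A" using assms by auto
  show ?thesis
    unfolding Phi_def
    by (subst (1) A[symmetric], subst complex_product.product_nn_integral_insert)
      (use assms Phi_section_measurable[where \<alpha>=\<alpha> and A=A and \<rho>=\<rho> and B=B and f=f] in \<open>auto simp: A\<close>)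
qed

text \<open>With the other coordinates fixed, the pivot column equals
  \<open>f (p, q) * (z + w)\<close> in the variable z for \<open>k p\<close>. The integral over z is
  at most pi and at most \<open>2 pi / x\<close> with \<open>x = \<rho> |f (p, q)|^2\<close>. The
  exponent \<theta> interpolates between the two, so that the bound is a pure power of the pivot and
  can be integrated against other powers of it.\<close>

lemma Phi_pivot_upper:
  assumes fin: "finite A" "finite B" and p: "p \<in> A" and q: "q \<in> B"
    and g: "f (p, q) \<noteq> 0" and row: "\<And>j. j \<in> B \<Longrightarrow> norm (f (p, j)) \<le> norm (f (p, q))"
    and \<rho>: "0 < \<rho>" and \<theta>: "0 \<le> \<theta>" "\<theta> \<le> 1"
  shows "Phi A B 1 \<rho> f \<le> ennreal (2 * pi * (\<rho> * (norm (f (p, q)))\<^sup>2) powr (- \<theta>))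
     * Phi (A - {p}) (B - {q}) 1 (\<rho> / (4 * real (card B))) (schur p q f)"
proof -
  define x where "x = \<rho> * (norm (f (p, q)))\<^sup>2"
  have x: "x > 0" using \<rho> g by (simp add: x_def)
  define E where "E k = exp (- 1 * (\<Sum>i\<in>A - {p}. (norm (k i))\<^sup>2)
      - (\<rho> / (4 * real (card B))) * (\<Sum>j\<in>B - {q}. (norm (\<Sum>i\<in>A - {p}. k i * schur p q f (i, j)))\<^sup>2))" for k
  have inner: "(\<integral>\<^sup>+z. ennreal (exp (- 1 * (\<Sum>i\<in>A. (norm ((k(p := z)) i))\<^sup>2)
      - \<rho> * (\<Sum>j\<in>B. (norm (\<Sum>i\<in>A. (k(p := z)) i * f (i, j)))\<^sup>2))) \<partial>lborel)
      \<le> ennreal (2 * pi * x powr (- \<theta>)) * ennreal (E k)" for k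
  proof -
    define w where "w = (\<Sum>i\<in>A - {p}. k i * f (i, q)) / f (p, q)"
    have pt: "exp (- 1 * (\<Sum>i\<in>A. (norm ((k(p := z)) i))\<^sup>2)
      - \<rho> * (\<Sum>j\<in>B. (norm (\<Sum>i\<in>A. (k(p := z)) i * f (i, j)))\<^sup>2))
      \<le> E k * exp (- (norm z)\<^sup>2 - (x / 2) * (norm (z + w))\<^sup>2)" (is "exp ?L \<le> _") for z
    proof -
      have e1: "(\<Sum>i\<in>A. (norm ((k(p := z)) i))\<^sup>2) = (norm z)\<^sup>2 + (\<Sum>i\<in>A - {p}. (norm (k i))\<^sup>2)"
        using fin p by (simp add: sum.remove[of A p])
      have e2: "(\<Sum>i\<in>A. (k(p := z)) i * f (i, q)) = f (p, q) * (z + w)"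
        using fin p g by (simp add: sum.remove[of A p] w_def distrib_left mult.commute)
      have e4: "(norm (f (p, q) * (z + w)))\<^sup>2 = (norm (z + w))\<^sup>2 * (norm (f (p, q)))\<^sup>2"
        by (simp only: norm_mult power_mult_distrib mult.commute)
      have e3: "(\<Sum>i\<in>A - {p}. (k(p := z)) i * schur p q f (i, j)) = (\<Sum>i\<in>A - {p}. k i * schur p q f (i, j))" for j
        by (intro sum.cong) auto
      have "\<rho> * ((1/2) * (norm (f (p, q) * (z + w)))\<^sup>2
     + (1 / (4 * real (card B))) * (\<Sum>j\<in>B - {q}. (norm (\<Sum>i\<in>A - {p}. k i * schur p q f (i, j)))\<^sup>2))
        \<le> \<rho> * (\<Sum>j\<in>B. (norm (\<Sum>i\<in>A. (k(p := z)) i * f (i, j)))\<^sup>2)"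
        using pivot_upper_pointwise[where f=f and k="k(p := z)", OF fin p q g row] \<rho>
        unfolding e2 e3 by (intro mult_left_mono) auto
      note this[unfolded e4]
      then have "?L \<le> - (\<Sum>i\<in>A - {p}. (norm (k i))\<^sup>2)
      - (\<rho> / (4 * real (card B))) * (\<Sum>j\<in>B - {q}. (norm (\<Sum>i\<in>A - {p}. k i * schur p q f (i, j)))\<^sup>2)
        + (- (norm z)\<^sup>2 - (x / 2) * (norm (z + w))\<^sup>2)"
        unfolding e1 x_def by (simp add: algebra_simps)
      then show ?thesis unfolding E_def exp_add[symmetric] by simp
    qed
    have "(\<integral>\<^sup>+z. ennreal (exp (- 1 * (\<Sum>i\<in>A. (norm ((k(p := z)) i))\<^sup>2)
      - \<rho> * (\<Sum>j\<in>B. (norm (\<Sum>i\<in>A. (k(p := z)) i * f (i, j)))\<^sup>2))) \<partial>lborel)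
      \<le> (\<integral>\<^sup>+z. ennreal (E k) * ennreal (exp (- (norm z)\<^sup>2 - (x / 2) * (norm (z + w))\<^sup>2)) \<partial>lborel)"
      using pt by (intro nn_integral_mono) (simp add: ennreal_mult''[symmetric] ennreal_leI)
    also have "\<dots> = ennreal (E k) * (\<integral>\<^sup>+z. ennreal (exp (- (norm z)\<^sup>2 - (x / 2) * (norm (z + w))\<^sup>2)) \<partial>lborel)"
      by (rule nn_integral_cmult) measurable
    also have "\<dots> \<le> ennreal (E k) * ennreal (2 * pi * x powr (- \<theta>))"
    proof (rule mult_left_mono)
      have a: "(\<integral>\<^sup>+z. ennreal (exp (- (norm z)\<^sup>2 - (x / 2) * (norm (z + w))\<^sup>2)) \<partial>lborel)
         \<le> (\<integral>\<^sup>+(z::complex). ennreal (exp (- 1 * (norm (z + 0))\<^sup>2)) \<partial>lborel)"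
        using x by (intro nn_integral_mono ennreal_leI) auto
      have b: "(\<integral>\<^sup>+z. ennreal (exp (- (norm z)\<^sup>2 - (x / 2) * (norm (z + w))\<^sup>2)) \<partial>lborel)
         \<le> (\<integral>\<^sup>+z. ennreal (exp (- (x / 2) * (norm (z + w))\<^sup>2)) \<partial>lborel)"
        by (intro nn_integral_mono ennreal_leI) auto
      show "(\<integral>\<^sup>+z. ennreal (exp (- (norm z)\<^sup>2 - (x / 2) * (norm (z + w))\<^sup>2)) \<partial>lborel) \<le> ennreal (2 * pi * x powr (- \<theta>))"
      \<comment> \<open>\<open>x powr (- \<theta>)\<close> dominates 1 for x \<le> 1 and
        \<open>1 / x\<close> for x > 1.\<close>
      proof (cases "x \<le> 1")
        case True
        have "1 \<le> x powr (- \<theta>)" using True x \<theta> by (simp add: powr_minus one_le_inverse powr_le1)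
        then have "pi \<le> 2 * pi * x powr (- \<theta>)" using mult_mono[of pi "2 * pi" 1 "x powr (- \<theta>)"] by simp
        then show ?thesis using a[unfolded nn_integral_gauss_complex[OF zero_less_one]] by (simp add: order_trans[OF _ ennreal_leI])
      next
        case False
        have "inverse x \<le> x powr (- \<theta>)" using False \<theta> powr_mono[of "-1" "-\<theta>" x] by (simp add: powr_minus)
        then have "pi / (x / 2) \<le> 2 * pi * x powr (- \<theta>)" using mult_left_mono[of "inverse x" "x powr (- \<theta>)" "2 * pi"] by (simp add: field_simps)
        then show ?thesis using b[unfolded nn_integral_gauss_complex[OF half_gt_zero[OF x]]] order_trans[OF _ ennreal_leI] by blast
      qed
    qed simp
    finally show ?thesis by (simp only: mult.commute)
  qed
  have "Phi A B 1 \<rho> f \<le> (\<integral>\<^sup>+k. ennreal (2 * pi * x powr (- \<theta>)) * ennreal (E k) \<partial>Pi_lborel (A - {p}))"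
    unfolding Phi_split[OF fin(1) p] by (intro nn_integral_mono inner)
  also have "\<dots> = ennreal (2 * pi * x powr (- \<theta>)) * (\<integral>\<^sup>+k. ennreal (E k) \<partial>Pi_lborel (A - {p}))"
    unfolding E_def by (intro nn_integral_cmult Phi_section_measurable)
  finally show ?thesis unfolding x_def E_def Phi_def .
qed

text \<open>For a lower bound the weight \<open>\<alpha> |z|^2\<close> must be expressed through z +
  w, at the cost of \<open>|w|^2\<close>. Maximality of the pivot in its column bounds
  \<open>|w|^2\<close> by card A times the weight of the other coordinates; this explains the new
  weight \<open>\<alpha> (1 + 2 card A)\<close>.\<close>

lemma Phi_pivot_lower:
  assumes fin: "finite A" "finite B" and p: "p \<in> A" and q: "q \<in> B"
    and g: "f (p, q) \<noteq> 0" and row: "\<And>j. j \<in> B \<Longrightarrow> norm (f (p, j)) \<le> norm (f (p, q))"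
    and col: "\<And>i. i \<in> A \<Longrightarrow> norm (f (i, q)) \<le> norm (f (p, q))"
    and \<rho>: "0 \<le> \<rho>" and \<alpha>: "0 < \<alpha>"
  shows "ennreal (pi / (2 * \<alpha> + 2 * real (card B) * \<rho> * (norm (f (p, q)))\<^sup>2))
     * Phi (A - {p}) (B - {q}) (\<alpha> * (1 + 2 * real (card A))) (2 * \<rho>) (schur p q f) \<le> Phi A B \<alpha> \<rho> f"
proof -
  define x where "x = 2 * \<alpha> + 2 * real (card B) * \<rho> * (norm (f (p, q)))\<^sup>2"
  have x: "x > 0" using \<rho> \<alpha> by (auto simp add: x_def intro!: add_pos_nonneg)
  define E where "E k = exp (- (\<alpha> * (1 + 2 * real (card A))) * (\<Sum>i\<in>A - {p}. (norm (k i))\<^sup>2)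
      - (2 * \<rho>) * (\<Sum>j\<in>B - {q}. (norm (\<Sum>i\<in>A - {p}. k i * schur p q f (i, j)))\<^sup>2))" for k
  have inner: "ennreal (pi / x) * ennreal (E k) \<le> (\<integral>\<^sup>+z. ennreal (exp (- \<alpha> * (\<Sum>i\<in>A. (norm ((k(p := z)) i))\<^sup>2)
      - \<rho> * (\<Sum>j\<in>B. (norm (\<Sum>i\<in>A. (k(p := z)) i * f (i, j)))\<^sup>2))) \<partial>lborel)" for k
  proof -
    define w where "w = (\<Sum>i\<in>A - {p}. k i * f (i, q)) / f (p, q)"
    define S where "S = (\<Sum>i\<in>A - {p}. (norm (k i))\<^sup>2)"
    have "norm w \<le> (\<Sum>i\<in>A - {p}. norm (k i * f (i, q) / f (p, q)))"
      unfolding w_def sum_divide_distrib by (rule norm_sum)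
    also have "\<dots> \<le> (\<Sum>i\<in>A - {p}. norm (k i))"
    proof (rule sum_mono)
      fix i assume "i \<in> A - {p}"
      then show "norm (k i * f (i, q) / f (p, q)) \<le> norm (k i)"
        using col[of i] g by (simp add: norm_mult norm_divide divide_le_eq mult_left_mono)
    qed
    finally have "(norm w)\<^sup>2 \<le> (\<Sum>i\<in>A - {p}. norm (k i))\<^sup>2" by (intro power_mono) auto
    also have "\<dots> \<le> S * real (card (A - {p}))"
      unfolding S_def using fin by (intro sum_squared_le_sum_of_squares)
    also have "\<dots> \<le> S * real (card A)"
      using fin by (intro mult_left_mono) (auto simp: S_def sum_nonneg card_Diff_subset intro!: card_mono)
    finally have w: "(norm w)\<^sup>2 \<le> S * real (card A)" .
    have pt: "E k * exp (- x * (norm (z + w))\<^sup>2) \<le> exp (- \<alpha> * (\<Sum>i\<in>A. (norm ((k(p := z)) i))\<^sup>2)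
      - \<rho> * (\<Sum>j\<in>B. (norm (\<Sum>i\<in>A. (k(p := z)) i * f (i, j)))\<^sup>2))" (is "_ \<le> exp ?L") for z
    proof -
      have e1: "(\<Sum>i\<in>A. (norm ((k(p := z)) i))\<^sup>2) = (norm z)\<^sup>2 + S"
        using fin p by (simp add: sum.remove[of A p] S_def)
      have e2: "(\<Sum>i\<in>A. (k(p := z)) i * f (i, q)) = f (p, q) * (z + w)"
        using fin p g by (simp add: sum.remove[of A p] w_def distrib_left mult.commute)
      have e4: "(norm (f (p, q) * (z + w)))\<^sup>2 = (norm (z + w))\<^sup>2 * (norm (f (p, q)))\<^sup>2"
        by (simp only: norm_mult power_mult_distrib mult.commute)
      have e3: "(\<Sum>i\<in>A - {p}. (k(p := z)) i * schur p q f (i, j)) = (\<Sum>i\<in>A - {p}. k i * schur p q f (i, j))" for j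
        by (intro sum.cong) auto
      define V where "V = (\<Sum>j\<in>B - {q}. (norm (\<Sum>i\<in>A - {p}. k i * schur p q f (i, j)))\<^sup>2)"
      have "\<rho> * (\<Sum>j\<in>B. (norm (\<Sum>i\<in>A. (k(p := z)) i * f (i, j)))\<^sup>2)
         \<le> \<rho> * (2 * real (card B) * ((norm (z + w))\<^sup>2 * (norm (f (p, q)))\<^sup>2) + 2 * V)"
        using pivot_lower_pointwise[where f=f and k="k(p := z)", OF fin p q g row] \<rho>
        unfolding e2 e3 e4 V_def by (intro mult_left_mono) auto
      moreover have "\<alpha> * ((norm z)\<^sup>2 + S) \<le> \<alpha> * (2 * (norm (z + w))\<^sup>2 + 2 * (S * real (card A)) + S)"
        using \<alpha> w norm_add_sq_le[of "z + w" "- w"] by (intro mult_left_mono) auto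
      ultimately have "- (\<alpha> * (1 + 2 * real (card A))) * S - (2 * \<rho>) * V - x * (norm (z + w))\<^sup>2 \<le> ?L"
        unfolding e1 x_def by (simp add: algebra_simps)
      then show ?thesis unfolding E_def exp_add[symmetric] S_def V_def by simp
    qed
    have "ennreal (pi / x) * ennreal (E k) = ennreal (E k) * (\<integral>\<^sup>+z. ennreal (exp (- x * (norm (z + w))\<^sup>2)) \<partial>lborel)"
      using nn_integral_gauss_complex[OF x, of w] by (simp add: mult.commute)
    also have "\<dots> = (\<integral>\<^sup>+z. ennreal (E k) * ennreal (exp (- x * (norm (z + w))\<^sup>2)) \<partial>lborel)"
      by (rule nn_integral_cmult[symmetric]) measurable
    also have "\<dots> \<le> (\<integral>\<^sup>+z. ennreal (exp (- \<alpha> * (\<Sum>i\<in>A. (norm ((k(p := z)) i))\<^sup>2)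
      - \<rho> * (\<Sum>j\<in>B. (norm (\<Sum>i\<in>A. (k(p := z)) i * f (i, j)))\<^sup>2))) \<partial>lborel)"
      using pt by (intro nn_integral_mono) (simp add: ennreal_mult''[symmetric] ennreal_leI)
    finally show ?thesis .
  qed
  have "ennreal (pi / x) * (\<integral>\<^sup>+k. ennreal (E k) \<partial>Pi_lborel (A - {p})) = (\<integral>\<^sup>+k. ennreal (pi / x) * ennreal (E k) \<partial>Pi_lborel (A - {p}))"
    unfolding E_def by (intro nn_integral_cmult[symmetric] Phi_section_measurable)
  also have "\<dots> \<le> Phi A B \<alpha> \<rho> f"
    unfolding Phi_split[OF fin(1) p] by (intro nn_integral_mono inner)
  finally show ?thesis unfolding x_def E_def Phi_def .
qed

section \<open>Moments over the unit polydisc\<close>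

definition polydisc :: "'i set \<Rightarrow> real \<Rightarrow> ('i \<Rightarrow> complex) set" where
  "polydisc I R = {f. \<forall>x\<in>I. norm (f x) \<le> R}"

text \<open>Written through \<open>R - norm (f x)\<close> so that measurability survives when R
  depends on f, as it does when the radius is the modulus of the pivot.\<close>

lemma polydisc_indicator_prod:
  assumes "finite I"
  shows "(indicator (polydisc I R) f :: ennreal) = (\<Prod>x\<in>I. indicator {0..} (R - norm (f x)))"
proof (cases "f \<in> polydisc I R")
  case True
  then show ?thesis by (auto simp: polydisc_def intro!: prod.neutral[symmetric])
next
  case False
  then obtain x where "x \<in> I" "indicator {0..} (R - norm (f x)) = (0::ennreal)"
    by (auto simp: polydisc_def indicator_def)
  then have "(\<Prod>x\<in>I. indicator {0..} (R - norm (f x))) = (0::ennreal)"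
    using assms by (metis prod_zero)
  then show ?thesis using False by simp
qed

lemma polydisc_indicator_measurable_gen:
  assumes "finite I" and r: "r \<in> borel_measurable (Pi_lborel I)"
  shows "(\<lambda>f. indicator (polydisc I (r f)) f :: ennreal) \<in> borel_measurable (Pi_lborel I)"
proof -
  have c: "(\<lambda>f. f y) \<in> borel_measurable (Pi_lborel I)" if "y \<in> I" for y
    by (rule Pi_lborel_component[OF measurable_ident_sets[OF refl] that])
  have ind: "(indicator {0..} :: real \<Rightarrow> ennreal) \<in> borel_measurable borel" by simp
  have "(\<lambda>f. \<Prod>x\<in>I. indicator {0..} (r f - norm (f x)) :: ennreal) \<in> borel_measurable (Pi_lborel I)"
    by (intro borel_measurable_prod_ennreal measurable_compose[OF _ ind] borel_measurable_diff r
       measurable_compose[OF c borel_measurable_norm])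
  then show ?thesis by (simp only: polydisc_indicator_prod[OF assms(1)])
qed

lemma polydisc_indicator_measurable:
  "finite I \<Longrightarrow> (\<lambda>f. indicator (polydisc I R) f :: ennreal) \<in> borel_measurable (Pi_lborel I)"
  by (rule polydisc_indicator_measurable_gen) auto

lemma emeasure_disc: "0 \<le> R \<Longrightarrow> emeasure lborel (cball (0::complex) R) = ennreal (R\<^sup>2 * measure lborel (cball (0::complex) 1))"
proof (cases "R = 0")
  case False
  assume R: "0 \<le> R"
  have "emeasure lborel (cball (0::complex) R) = (\<integral>\<^sup>+(z::complex). indicator (cball 0 R) z \<partial>lborel)"
    by simp
  also have "\<dots> = ennreal (R\<^sup>2) * (\<integral>\<^sup>+(z::complex). indicator (cball 0 R) (0 + R *\<^sub>R z) \<partial>lborel)"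
    by (rule nn_integral_complex_affine[OF borel_measurable_indicator[OF borel_closed[OF closed_cball]] False])
  also have "(\<lambda>z::complex. indicator (cball 0 R) (0 + R *\<^sub>R z)) = (indicator (cball 0 1) :: complex \<Rightarrow> ennreal)"
    using R False mult_le_cancel_left_pos[of R "norm _" 1] by (auto simp: indicator_def fun_eq_iff)
  also have "(\<integral>\<^sup>+z. (indicator (cball 0 1) :: complex \<Rightarrow> ennreal) z \<partial>lborel) = ennreal (measure lborel (cball (0::complex) 1))"
    using emeasure_lborel_cball_finite[of "0::complex" 1] by (simp add: emeasure_eq_ennreal_measure)
  finally show ?thesis by (simp add: ennreal_mult'')
qed simp

lemma emeasure_polydisc:
  assumes "finite I" "0 \<le> R"
  shows "(\<integral>\<^sup>+f. indicator (polydisc I R) f \<partial>Pi_lborel I) = ennreal ((R\<^sup>2 * measure lborel (cball (0::complex) 1)) ^ card I)"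
proof -
  have ind: "(indicator (cball 0 R) :: complex \<Rightarrow> ennreal) = (\<lambda>z. indicator {0..} (R - norm z))"
    by (auto simp: indicator_def fun_eq_iff)
  have "(\<integral>\<^sup>+f. indicator (polydisc I R) f \<partial>Pi_lborel I) = (\<integral>\<^sup>+f. (\<Prod>x\<in>I. indicator (cball (0::complex) R) (f x)) \<partial>Pi_lborel I)"
    by (simp only: polydisc_indicator_prod[OF assms(1)] ind)
  also have "\<dots> = (\<Prod>x\<in>I. \<integral>\<^sup>+z. indicator (cball (0::complex) R) z \<partial>lborel)"
    by (rule complex_product.product_nn_integral_prod[OF assms(1)]) (simp add: borel_measurable_indicator borel_closed)
  also have "\<dots> = ennreal ((R\<^sup>2 * measure lborel (cball (0::complex) 1)) ^ card I)"
    by (simp add: emeasure_disc[OF assms(2)] ennreal_power)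
  finally show ?thesis .
qed

section \<open>The recursion for moments\<close>

definition polydisc_moment :: "'a set \<Rightarrow> 'b set \<Rightarrow> nat \<Rightarrow> real \<Rightarrow> ennreal" where
  "polydisc_moment A B c \<rho> = (\<integral>\<^sup>+f. indicator (polydisc (A \<times> B) 1) f * Phi A B 1 \<rho> f ^ c \<partial>Pi_lborel (A \<times> B))"

text \<open>The radius is the modulus of entry x itself, which restricts to the matrices whose
  largest entry is x. The weight sees this entry only.\<close>

definition pivot_integrand :: "(complex \<Rightarrow> ennreal) \<Rightarrow> 'a set \<Rightarrow> 'b set \<Rightarrow> nat \<Rightarrow> real \<Rightarrow> 'a \<times> 'b \<Rightarrow> ('a \<times> 'b \<Rightarrow> complex) \<Rightarrow> ennreal" where
  "pivot_integrand w A B c \<rho> x f = w (f x) * indicator (polydisc (A \<times> B) (norm (f x))) f * Phi A B 1 \<rho> f ^ c"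

lemma pivot_integrand_measurable:
  assumes "finite A" "finite B" "x \<in> A \<times> B" and w: "w \<in> borel_measurable borel"
  shows "pivot_integrand w A B c \<rho> x \<in> borel_measurable (Pi_lborel (A \<times> B))"
proof -
  have c: "(\<lambda>f. f y) \<in> borel_measurable (Pi_lborel (A \<times> B))" if "y \<in> A \<times> B" for y
    by (rule Pi_lborel_component[OF measurable_ident_sets[OF refl] that])
  have "(\<lambda>f. indicator (polydisc (A \<times> B) (norm (f x))) f :: ennreal) \<in> borel_measurable (Pi_lborel (A \<times> B))"
    using assms by (intro polydisc_indicator_measurable_gen measurable_compose[OF c borel_measurable_norm]) auto
  then show ?thesis
    unfolding pivot_integrand_def[abs_def]
    by (intro borel_measurable_times_ennreal measurable_compose[OF c[OF assms(3)] w] borel_measurable_power_ennreal Phi_measurable assms)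
qed

lemma Phi_translate_measurable:
  assumes "finite A"
  shows "(\<lambda>y. Phi A B \<alpha> \<rho> (\<lambda>x. y x - t x)) \<in> borel_measurable (Pi_lborel (A \<times> B))"
proof -
  have "(\<lambda>y. Phi A B \<alpha> \<rho> (\<lambda>x\<in>A \<times> B. - t x + 1 *\<^sub>R y x)) \<in> borel_measurable (Pi_lborel (A \<times> B))"
    by (rule measurable_compose[OF measurable_PiM_complex_affine Phi_measurable[OF assms]])
  also have "(\<lambda>y. Phi A B \<alpha> \<rho> (\<lambda>x\<in>A \<times> B. - t x + 1 *\<^sub>R y x)) = (\<lambda>y. Phi A B \<alpha> \<rho> (\<lambda>x. y x - t x))"
    by (intro ext Phi_cong) auto
  finally show ?thesis .
qed

text \<open>A polydisc of radius r shifted by at most r stays within radius 2 r, and rescaling the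
  latter to radius 1 multiplies \<rho> by \<open>(2 r)^2\<close>. This disposes of the translation
  that a Schur complement creates.\<close>

lemma polydisc_moment_translate:
  assumes fin: "finite A" "finite B" and r: "0 < r" and t: "\<And>x. x \<in> A \<times> B \<Longrightarrow> norm (t x) \<le> r"
  shows "(\<integral>\<^sup>+y. indicator (polydisc (A \<times> B) r) y * Phi A B 1 \<rho> (\<lambda>x. y x - t x) ^ c \<partial>Pi_lborel (A \<times> B))
    \<le> ennreal (((2 * r)\<^sup>2) ^ card (A \<times> B)) * polydisc_moment A B c (\<rho> * (2 * r)\<^sup>2)"
proof -
  let ?F = "\<lambda>y. indicator (polydisc (A \<times> B) r) y * Phi A B 1 \<rho> (\<lambda>x. y x - t x) ^ c"
  have "(\<integral>\<^sup>+y. ?F y \<partial>Pi_lborel (A \<times> B)) = ennreal ((2*r)\<^sup>2) ^ card (A \<times> B)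
      * (\<integral>\<^sup>+y. ?F (\<lambda>x\<in>A \<times> B. t x + (2*r) *\<^sub>R y x) \<partial>Pi_lborel (A \<times> B))"
    using r fin by (intro nn_integral_PiM_complex_affine borel_measurable_times_ennreal polydisc_indicator_measurable
        borel_measurable_power_ennreal Phi_translate_measurable) auto
  also have "(\<integral>\<^sup>+y. ?F (\<lambda>x\<in>A \<times> B. t x + (2*r) *\<^sub>R y x) \<partial>Pi_lborel (A \<times> B)) \<le> polydisc_moment A B c (\<rho> * (2 * r)\<^sup>2)"
    unfolding polydisc_moment_def
  proof (intro nn_integral_mono mult_mono)
    fix y :: "'a \<times> 'b \<Rightarrow> complex"
    have "norm (y x) \<le> 1" if x: "x \<in> A \<times> B" and "norm (t x + (2*r) *\<^sub>R y x) \<le> r" for x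
    proof -
      have "norm ((2*r) *\<^sub>R y x) \<le> norm (t x + (2*r) *\<^sub>R y x) + norm (t x)"
        by (metis add_diff_cancel_left' norm_triangle_ineq4)
      also have "\<dots> \<le> r + r" using that t[OF x] by linarith
      finally show ?thesis using r by simp
    qed
    then show "indicator (polydisc (A \<times> B) r) (\<lambda>x\<in>A \<times> B. t x + (2*r) *\<^sub>R y x) \<le> (indicator (polydisc (A \<times> B) 1) y :: ennreal)"
      by (auto simp: polydisc_def indicator_def)
    have "Phi A B 1 \<rho> (\<lambda>x. (\<lambda>x\<in>A \<times> B. t x + (2*r) *\<^sub>R y x) x - t x) = Phi A B 1 \<rho> (\<lambda>x. (2*r) *\<^sub>R y x)"
      by (intro Phi_cong) auto
    then show "Phi A B 1 \<rho> (\<lambda>x. (\<lambda>x\<in>A \<times> B. t x + (2*r) *\<^sub>R y x) x - t x) ^ c \<le> Phi A B 1 (\<rho> * (2*r)\<^sup>2) y ^ c"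
      by (simp add: Phi_scale)
  qed auto
  finally show ?thesis by (simp add: ennreal_power mult_left_mono)
qed

lemma pivot_index_sets:
  assumes "finite A" "finite B" "p \<in> A" "q \<in> B"
  defines "X \<equiv> {p} \<times> (B - {q}) \<union> (A - {p}) \<times> {q}" and "Y \<equiv> (A - {p}) \<times> (B - {q})"
  shows "A \<times> B = insert (p, q) (X \<union> Y)" "(p, q) \<notin> X \<union> Y" "X \<inter> Y = {}" "finite X" "finite Y"
    "card X + card Y = card A * card B - 1"
proof -
  show 1: "A \<times> B = insert (p, q) (X \<union> Y)" "(p, q) \<notin> X \<union> Y" "X \<inter> Y = {}" "finite X" "finite Y"
    using assms by auto
  have "card A * card B = Suc (card X + card Y)"
    using 1 assms by (metis card_cartesian_product card_insert_disjoint card_Un_disjoint finite_UnI)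
  then show "card X + card Y = card A * card B - 1" by simp
qed

text \<open>Fubini in the order pivot, rest of its row and column, remaining block. For fixed outer
  variables the Schur complement is a translate of the remaining block by at most the modulus of the
  pivot. Volume of the middle part and Jacobian of the last part combine to \<open>|g|\<close> to
  the power \<open>2 (card A card B - 1)\<close>.\<close>

lemma pivot_integrand_integral_le:
  fixes A :: "'a set" and B :: "'b set"
  assumes fin: "finite A" "finite B" and p: "p \<in> A" and q: "q \<in> B"
    and w: "w \<in> borel_measurable borel" and \<rho>: "0 < \<rho>" and c: "1 \<le> c" and \<tau>: "0 \<le> \<tau>" "\<tau> \<le> real c"
  shows "\<exists>K. \<forall>\<rho>>0. (\<integral>\<^sup>+f. pivot_integrand w A B c \<rho> (p, q) f \<partial>Pi_lborel (A \<times> B)) \<le>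
     (\<integral>\<^sup>+g. w g * ennreal (K * ((norm g)\<^sup>2) ^ (card A * card B - 1) * (\<rho> * (norm g)\<^sup>2) powr (- \<tau>))
        * polydisc_moment (A - {p}) (B - {q}) c (\<rho> * (norm g)\<^sup>2 / real (card B)) \<partial>lborel)"
proof -
  define X where "X = {p} \<times> (B - {q}) \<union> (A - {p}) \<times> {q}"
  define Y where "Y = (A - {p}) \<times> (B - {q})"
  note I = pivot_index_sets[OF fin p q, folded X_def Y_def]
  define V where "V = measure lborel (cball (0::complex) 1)"
  define K where "K = (2 * pi) ^ c * 4 ^ card Y * V ^ card X"
  have V0: "V \<ge> 0" by (simp add: V_def)
  have cB: "card B > 0" using fin q by (auto simp: card_gt_0_iff)
  have "(\<integral>\<^sup>+f. pivot_integrand w A B c \<rho> (p, q) f \<partial>Pi_lborel (A \<times> B)) \<le>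
     (\<integral>\<^sup>+g. w g * ennreal (K * ((norm g)\<^sup>2) ^ (card A * card B - 1) * (\<rho> * (norm g)\<^sup>2) powr (- \<tau>))
        * polydisc_moment (A - {p}) (B - {q}) c (\<rho> * (norm g)\<^sup>2 / real (card B)) \<partial>lborel)" if \<rho>: "0 < \<rho>" for \<rho>
  proof -
    let ?F = "pivot_integrand w A B c \<rho> (p, q)"
    have mF: "?F \<in> borel_measurable (Pi_lborel (insert (p, q) (X \<union> Y)))"
      unfolding I(1)[symmetric] using pivot_integrand_measurable[OF fin _ w] p q by auto
    have "(\<integral>\<^sup>+f. ?F f \<partial>Pi_lborel (A \<times> B)) = (\<integral>\<^sup>+g. (\<integral>\<^sup>+f. ?F (f((p, q) := g)) \<partial>Pi_lborel (X \<union> Y)) \<partial>lborel)"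
      unfolding I(1) by (rule complex_product.product_nn_integral_insert_rev[OF _ I(2) mF]) (use I in auto)
    also have "\<dots> \<le> (\<integral>\<^sup>+g. w g * ennreal (K * ((norm g)\<^sup>2) ^ (card A * card B - 1) * (\<rho> * (norm g)\<^sup>2) powr (- \<tau>))
        * polydisc_moment (A - {p}) (B - {q}) c (\<rho> * (norm g)\<^sup>2 / real (card B)) \<partial>lborel)"
    proof (rule nn_integral_mono_AE)
      show "AE g in lborel. (\<integral>\<^sup>+f. ?F (f((p, q) := g)) \<partial>Pi_lborel (X \<union> Y)) \<le> w g * ennreal (K * ((norm g)\<^sup>2) ^ (card A * card B - 1) * (\<rho> * (norm g)\<^sup>2) powr (- \<tau>))
        * polydisc_moment (A - {p}) (B - {q}) c (\<rho> * (norm g)\<^sup>2 / real (card B))"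
        using AE_lborel_singleton[of 0]
      proof eventually_elim
        fix g :: complex assume g: "g \<noteq> 0"
        define r where "r = norm g"
        have r: "r > 0" using g by (simp add: r_def)
        \<comment> \<open>The pivot step is applied with \<theta> = \<open>\<tau> / c\<close>, so
          that its c-th power carries the exponent \<tau>.\<close>
        define P where "P = ennreal (2 * pi * (\<rho> * r\<^sup>2) powr (- (\<tau> / real c)))"
        have Pc: "P ^ c = ennreal ((2 * pi) ^ c * (\<rho> * r\<^sup>2) powr (- \<tau>))"
        proof -
          have "((\<rho> * r\<^sup>2) powr (- (\<tau> / real c))) ^ c = (\<rho> * r\<^sup>2) powr (- \<tau>)"
          proof -
            have "((\<rho> * r\<^sup>2) powr (- (\<tau> / real c))) ^ c = ((\<rho> * r\<^sup>2) powr (- (\<tau> / real c))) powr real c"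
              using \<rho> r by (intro powr_realpow[symmetric]) simp
            also have "\<dots> = (\<rho> * r\<^sup>2) powr (- \<tau>)"
              using c by (simp add: powr_powr)
            finally show ?thesis .
          qed
          then show ?thesis by (simp add: P_def ennreal_power power_mult_distrib)
        qed
        \<comment> \<open>The 4 lost in the pivot step cancels against the one in
          \<open>(2 r)^2\<close>.\<close>
        define \<rho>' where "\<rho>' = \<rho> / (4 * real (card B))"
        define M where "M = polydisc_moment (A - {p}) (B - {q}) c (\<rho> * r\<^sup>2 / real (card B))"
        have \<rho>': "\<rho>' * (2 * r)\<^sup>2 = \<rho> * r\<^sup>2 / real (card B)" by (simp add: \<rho>'_def power2_eq_square)
        have mF': "(\<lambda>f. ?F (f((p, q) := g))) \<in> borel_measurable (Pi_lborel (X \<union> Y))"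
          by (rule measurable_compose[OF measurable_fun_upd mF]) (auto intro: measurable_ident_sets)
        have "(\<integral>\<^sup>+f. ?F (f((p, q) := g)) \<partial>Pi_lborel (X \<union> Y)) = (\<integral>\<^sup>+h. (\<integral>\<^sup>+y. ?F ((merge X Y (h, y))((p, q) := g)) \<partial>Pi_lborel Y) \<partial>Pi_lborel X)"
          using I by (intro complex_product.product_nn_integral_fold mF') auto
        also have "\<dots> \<le> (\<integral>\<^sup>+h. indicator (polydisc X r) h * (w g * P ^ c * (ennreal (((2 * r)\<^sup>2) ^ card Y) * M)) \<partial>Pi_lborel X)"
        proof (rule nn_integral_mono)
          fix h :: "'a \<times> 'b \<Rightarrow> complex"
          show "(\<integral>\<^sup>+y. ?F ((merge X Y (h, y))((p, q) := g)) \<partial>Pi_lborel Y) \<le> indicator (polydisc X r) h * (w g * P ^ c * (ennreal (((2 * r)\<^sup>2) ^ card Y) * M))"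
          proof (cases "h \<in> polydisc X r")
            case False
            then obtain x where x: "x \<in> X" "norm (h x) > r" by (auto simp: polydisc_def)
            have "?F ((merge X Y (h, y))((p, q) := g)) = 0" for y
            proof -
              have "x \<noteq> (p, q)" "x \<in> A \<times> B" using x I by auto
              then have "(merge X Y (h, y))((p, q) := g) \<notin> polydisc (A \<times> B) r"
                using x I by (auto simp: polydisc_def merge_def intro!: bexI[of _ x])
              then show ?thesis by (simp add: pivot_integrand_def r_def)
            qed
            then show ?thesis by simp
          next
            case True
            \<comment> \<open>The part of the Schur complement that does not involve y. A product of
              two entries of modulus at most r, divided by a pivot of modulus r, has modulus at most
              r.\<close>
            define t where "t = (\<lambda>(i, j). h (i, q) * h (p, j) / g)"
            have t: "norm (t x) \<le> r" if "x \<in> (A - {p}) \<times> (B - {q})" for x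
            proof -
              obtain i j where x: "x = (i, j)" by (cases x)
              have "norm (h (i, q)) \<le> r" "norm (h (p, j)) \<le> r" using True that x by (auto simp: polydisc_def X_def)
              then have "norm (h (i, q)) * norm (h (p, j)) \<le> r * r" using r by (intro mult_mono) auto
              then show ?thesis using r by (simp add: x t_def norm_mult norm_divide r_def[symmetric] divide_le_eq)
            qed
            have pt: "?F ((merge X Y (h, y))((p, q) := g)) \<le>
               w g * P ^ c * (indicator (polydisc Y r) y * Phi (A - {p}) (B - {q}) 1 \<rho>' (\<lambda>x. y x - t x) ^ c)" for y
            proof -
              define f where "f = (merge X Y (h, y))((p, q) := g)"
              have fpq: "f (p, q) = g" by (simp add: f_def)
              have fp: "f (p, j) = h (p, j)" if "j \<in> B - {q}" for j using that I by (auto simp: f_def merge_def X_def)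
              have fq: "f (i, q) = h (i, q)" if "i \<in> A - {p}" for i using that I by (auto simp: f_def merge_def X_def)
              have fY: "f x = y x" if "x \<in> Y" for x using that I by (auto simp: f_def merge_def Y_def X_def)
              show ?thesis
              proof (cases "f \<in> polydisc (A \<times> B) r")
                case False
                then show ?thesis unfolding f_def[symmetric] by (simp add: pivot_integrand_def fpq r_def[symmetric])
              next
                case True
                have row: "norm (f (p, j)) \<le> norm (f (p, q))" if "j \<in> B" for j
                  using True that p by (auto simp: polydisc_def fpq r_def)
                have y: "y \<in> polydisc Y r" using True fY by (auto simp: polydisc_def Y_def) (metis Diff_iff SigmaI)
                have "Phi A B 1 \<rho> f \<le> ennreal (2 * pi * (\<rho> * (norm (f (p, q)))\<^sup>2) powr (- (\<tau> / real c)))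
                   * Phi (A - {p}) (B - {q}) 1 (\<rho> / (4 * real (card B))) (schur p q f)"
                  using c \<tau> by (intro Phi_pivot_upper fin p q row \<rho>) (auto simp: fpq g divide_le_eq)
                also have "Phi (A - {p}) (B - {q}) 1 (\<rho> / (4 * real (card B))) (schur p q f) = Phi (A - {p}) (B - {q}) 1 \<rho>' (\<lambda>x. y x - t x)"
                  unfolding \<rho>'_def by (intro Phi_cong) (auto simp: schur_def fpq fp fq fY t_def Y_def)
                finally have "Phi A B 1 \<rho> f \<le> P * Phi (A - {p}) (B - {q}) 1 \<rho>' (\<lambda>x. y x - t x)"
                  by (simp only: fpq P_def r_def)
                then have "Phi A B 1 \<rho> f ^ c \<le> P ^ c * Phi (A - {p}) (B - {q}) 1 \<rho>' (\<lambda>x. y x - t x) ^ c"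
                  unfolding power_mult_distrib[symmetric] by (rule power_mono) simp
                then have "w g * Phi A B 1 \<rho> f ^ c \<le> w g * (P ^ c * Phi (A - {p}) (B - {q}) 1 \<rho>' (\<lambda>x. y x - t x) ^ c)"
                  by (rule mult_left_mono) simp
                then show ?thesis
                  unfolding f_def[symmetric] using True y by (simp add: pivot_integrand_def fpq r_def[symmetric] mult.assoc)
              qed
            qed
            have "(\<integral>\<^sup>+y. ?F ((merge X Y (h, y))((p, q) := g)) \<partial>Pi_lborel Y) \<le>
               (\<integral>\<^sup>+y. w g * P ^ c * (indicator (polydisc Y r) y * Phi (A - {p}) (B - {q}) 1 \<rho>' (\<lambda>x. y x - t x) ^ c) \<partial>Pi_lborel Y)"
              by (intro nn_integral_mono pt)
            also have "\<dots> = w g * P ^ c * (\<integral>\<^sup>+y. (indicator (polydisc Y r) y * Phi (A - {p}) (B - {q}) 1 \<rho>' (\<lambda>x. y x - t x) ^ c) \<partial>Pi_lborel Y)"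
              using fin by (intro nn_integral_cmult borel_measurable_times_ennreal polydisc_indicator_measurable
                 borel_measurable_power_ennreal) (auto simp: Y_def intro: Phi_translate_measurable)
            also have "\<dots> \<le> w g * P ^ c * (ennreal (((2 * r)\<^sup>2) ^ card Y) * M)"
              unfolding Y_def M_def \<rho>'[symmetric] using fin t r by (intro mult_left_mono polydisc_moment_translate) auto
            finally show ?thesis using True by simp
          qed
        qed
        also have "\<dots> = (\<integral>\<^sup>+h. indicator (polydisc X r) h \<partial>Pi_lborel X) * (w g * P ^ c * (ennreal (((2 * r)\<^sup>2) ^ card Y) * M))"
          using I by (intro nn_integral_multc polydisc_indicator_measurable)
        also have "\<dots> = w g * (ennreal ((r\<^sup>2 * V) ^ card X) * ennreal ((2 * pi) ^ c * (\<rho> * r\<^sup>2) powr (- \<tau>)) * ennreal (((2 * r)\<^sup>2) ^ card Y)) * M"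
          using I r by (simp add: emeasure_polydisc V_def Pc mult_ac)
        also have "ennreal ((r\<^sup>2 * V) ^ card X) * ennreal ((2 * pi) ^ c * (\<rho> * r\<^sup>2) powr (- \<tau>)) * ennreal (((2 * r)\<^sup>2) ^ card Y)
            = ennreal (((r\<^sup>2 * V) ^ card X) * ((2 * pi) ^ c * (\<rho> * r\<^sup>2) powr (- \<tau>)) * (((2 * r)\<^sup>2) ^ card Y))"
          using V0 by (simp add: ennreal_mult'')
        also have "((r\<^sup>2 * V) ^ card X) * ((2 * pi) ^ c * (\<rho> * r\<^sup>2) powr (- \<tau>)) * (((2 * r)\<^sup>2) ^ card Y)
            = K * (r\<^sup>2) ^ (card A * card B - 1) * (\<rho> * r\<^sup>2) powr (- \<tau>)"
          unfolding I(6)[symmetric] K_def by (simp add: power_mult_distrib power_add mult_ac)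
        finally show "(\<integral>\<^sup>+f. ?F (f((p, q) := g)) \<partial>Pi_lborel (X \<union> Y)) \<le> w g * ennreal (K * ((norm g)\<^sup>2) ^ (card A * card B - 1) * (\<rho> * (norm g)\<^sup>2) powr (- \<tau>))
        * polydisc_moment (A - {p}) (B - {q}) c (\<rho> * (norm g)\<^sup>2 / real (card B))"
          by (simp only: r_def M_def)
      qed
    qed
    finally show ?thesis .
  qed
  then show ?thesis by blast
qed

text \<open>The closed form is the minimum over the ranks i of \<open>(a - i) (b - i) + i c\<close>.\<close>

fun moment_exponent :: "nat \<Rightarrow> nat \<Rightarrow> nat \<Rightarrow> real" where
  "moment_exponent 0 b c = 0"
| "moment_exponent (Suc a) 0 c = 0"
| "moment_exponent (Suc a) (Suc b) c = min (real (Suc a) * real (Suc b)) (real c + moment_exponent a b c)"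

text \<open>\<open>Phi\<close> is largest at \<rho> = 0, where it is an explicit constant. This is
  the case of exponent 0, in which the recursion ends.\<close>

lemma polydisc_moment_bounded:
  assumes fin: "finite A" "finite B"
  shows "\<exists>C\<ge>0. \<forall>\<rho>>0. polydisc_moment A B c \<rho> \<le> ennreal C"
proof -
  have "polydisc_moment A B c \<rho> \<le> ennreal ((pi ^ card A) ^ c * (1\<^sup>2 * measure lborel (cball (0::complex) 1)) ^ card (A \<times> B))" if "\<rho> > 0" for \<rho>
  proof -
    have "polydisc_moment A B c \<rho> \<le> (\<integral>\<^sup>+f. indicator (polydisc (A \<times> B) 1) f * ennreal ((pi ^ card A) ^ c) \<partial>Pi_lborel (A \<times> B))"
      unfolding polydisc_moment_def
    proof (intro nn_integral_mono mult_left_mono)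
      fix f :: "'a \<times> 'b \<Rightarrow> complex"
      have "Phi A B 1 \<rho> f \<le> ennreal (pi / 1) ^ card A" using that fin by (intro Phi_le) auto
      then have "Phi A B 1 \<rho> f ^ c \<le> (ennreal (pi / 1) ^ card A) ^ c" by (rule power_mono) simp
      then show "Phi A B 1 \<rho> f ^ c \<le> ennreal ((pi ^ card A) ^ c)" by (simp add: ennreal_power)
    qed simp
    also have "\<dots> = (\<integral>\<^sup>+f. indicator (polydisc (A \<times> B) 1) f \<partial>Pi_lborel (A \<times> B)) * ennreal ((pi ^ card A) ^ c)"
      using fin by (intro nn_integral_multc polydisc_indicator_measurable) auto
    also have "\<dots> = ennreal ((pi ^ card A) ^ c * (1\<^sup>2 * measure lborel (cball (0::complex) 1)) ^ card (A \<times> B))"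
      using fin by (subst emeasure_polydisc) (auto simp: ennreal_mult'' mult.commute)
    finally show ?thesis .
  qed
  then show ?thesis by (intro exI[of _ "(pi ^ card A) ^ c * (1\<^sup>2 * measure lborel (cball (0::complex) 1)) ^ card (A \<times> B)"]) auto
qed

text \<open>The powers are those of the pivot that one elimination leaves behind. The indicator of
  the disc serves inside the recursion, the Gaussian at its outermost level.\<close>

definition good_weight :: "(complex \<Rightarrow> ennreal) \<Rightarrow> bool" where
  "good_weight w \<longleftrightarrow> w \<in> borel_measurable borel \<and>
     (\<forall>s>-1. (\<integral>\<^sup>+g. w g * ennreal (((norm g)\<^sup>2) powr s) \<partial>lborel) < \<infinity>)"

lemma good_weight_disc: "good_weight (indicator {z. norm z \<le> 1})"
proof -
  have "{z::complex. norm z \<le> 1} \<in> sets borel" by measurable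
  moreover have "indicator {z. norm z \<le> 1} g * ennreal (((norm g)\<^sup>2) powr s) = ennreal (indicator {z. norm z \<le> 1} g * ((norm g)\<^sup>2) powr s)" for g :: complex and s
    by (simp add: indicator_def)
  ultimately show ?thesis
    unfolding good_weight_def using nn_integral_norm_powr_unit_disc by simp
qed

lemma good_weight_gauss: "good_weight (\<lambda>z. ennreal (exp (- (norm z)\<^sup>2)))"
  unfolding good_weight_def using nn_integral_norm_powr_gauss by (simp add: ennreal_mult'')

text \<open>The powers of the pivot collect to \<open>((norm g)^2) powr s\<close> with
  \<open>s = card A card B - 1 - (\<tau>\<^sub>1 + \<tau>\<^sub>2)\<close>. Integrability at 0 means
  s > -1, which is the strict bound on the sum of the exponents and the origin of the product of
  dimensions in \<open>moment_exponent\<close>.\<close>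

lemma pivot_integrand_integral_bound:
  fixes A :: "'a set" and B :: "'b set"
  assumes fin: "finite A" "finite B" and p: "p \<in> A" and q: "q \<in> B" and c: "1 \<le> c" and w: "good_weight w"
    and \<tau>: "0 \<le> \<tau>\<^sub>1" "\<tau>\<^sub>1 \<le> real c" "0 \<le> \<tau>\<^sub>2" "\<tau>\<^sub>1 + \<tau>\<^sub>2 < real (card A) * real (card B)"
    and C: "0 \<le> C" "\<And>\<rho>. 0 < \<rho> \<Longrightarrow> polydisc_moment (A - {p}) (B - {q}) c \<rho> \<le> ennreal (C * \<rho> powr (- \<tau>\<^sub>2))"
  shows "\<exists>D\<ge>0. \<forall>\<rho>>0. (\<integral>\<^sup>+f. pivot_integrand w A B c \<rho> (p, q) f \<partial>Pi_lborel (A \<times> B)) \<le> ennreal (D * \<rho> powr (- (\<tau>\<^sub>1 + \<tau>\<^sub>2)))"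
proof -
  have wm: "w \<in> borel_measurable borel" using w by (simp add: good_weight_def)
  obtain K where K: "\<And>\<rho>. 0 < \<rho> \<Longrightarrow> (\<integral>\<^sup>+f. pivot_integrand w A B c \<rho> (p, q) f \<partial>Pi_lborel (A \<times> B)) \<le>
     (\<integral>\<^sup>+g. w g * ennreal (K * ((norm g)\<^sup>2) ^ (card A * card B - 1) * (\<rho> * (norm g)\<^sup>2) powr (- \<tau>\<^sub>1))
        * polydisc_moment (A - {p}) (B - {q}) c (\<rho> * (norm g)\<^sup>2 / real (card B)) \<partial>lborel)"
    using pivot_integrand_integral_le[OF fin p q wm zero_less_one c \<tau>(1,2)] by blast
  define s where "s = real (card A * card B - 1) - (\<tau>\<^sub>1 + \<tau>\<^sub>2)"
  have cAB: "card A > 0" "card B > 0" using fin p q by (auto simp: card_gt_0_iff)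
  have "real (card A * card B - 1) = real (card A) * real (card B) - 1"
    using cAB by (simp add: of_nat_diff Suc_leI)
  then have s: "s > -1" using \<tau> by (simp add: s_def)
  define I where "I = (\<integral>\<^sup>+g. w g * ennreal (((norm g)\<^sup>2) powr s) \<partial>lborel)"
  have I: "I < \<infinity>" using w s by (simp add: good_weight_def I_def)
  define D where "D = \<bar>K\<bar> * C * real (card B) powr \<tau>\<^sub>2"
  have D0: "D \<ge> 0" using C by (simp add: D_def)
  have "(\<integral>\<^sup>+f. pivot_integrand w A B c \<rho> (p, q) f \<partial>Pi_lborel (A \<times> B)) \<le> ennreal (D * enn2real I * \<rho> powr (- (\<tau>\<^sub>1 + \<tau>\<^sub>2)))" if \<rho>: "\<rho> > 0" for \<rho>
  proof -
    have "(\<integral>\<^sup>+f. pivot_integrand w A B c \<rho> (p, q) f \<partial>Pi_lborel (A \<times> B)) \<le>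
     (\<integral>\<^sup>+g. ennreal (D * \<rho> powr (- (\<tau>\<^sub>1 + \<tau>\<^sub>2))) * (w g * ennreal (((norm g)\<^sup>2) powr s)) \<partial>lborel)"
    proof (rule order_trans[OF K[OF \<rho>] nn_integral_mono_AE])
      show "AE g in lborel. w g * ennreal (K * ((norm g)\<^sup>2) ^ (card A * card B - 1) * (\<rho> * (norm g)\<^sup>2) powr (- \<tau>\<^sub>1))
        * polydisc_moment (A - {p}) (B - {q}) c (\<rho> * (norm g)\<^sup>2 / real (card B)) \<le> ennreal (D * \<rho> powr (- (\<tau>\<^sub>1 + \<tau>\<^sub>2))) * (w g * ennreal (((norm g)\<^sup>2) powr s))"
        using AE_lborel_singleton[of 0]
      proof eventually_elim
        fix g :: complex assume "g \<noteq> 0"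
        define x where "x = (norm g)\<^sup>2"
        have x: "x > 0" using \<open>g \<noteq> 0\<close> by (simp add: x_def)
        let ?N = "card A * card B - 1"
        have "ennreal (K * x ^ ?N * (\<rho> * x) powr (- \<tau>\<^sub>1)) * polydisc_moment (A - {p}) (B - {q}) c (\<rho> * x / real (card B))
           \<le> ennreal (\<bar>K\<bar> * x ^ ?N * (\<rho> * x) powr (- \<tau>\<^sub>1)) * ennreal (C * (\<rho> * x / real (card B)) powr (- \<tau>\<^sub>2))"
          using x \<rho> cAB by (intro mult_mono C ennreal_leI mult_right_mono) auto
        also have "\<dots> = ennreal (\<bar>K\<bar> * x ^ ?N * (\<rho> * x) powr (- \<tau>\<^sub>1) * (C * (\<rho> * x / real (card B)) powr (- \<tau>\<^sub>2)))"
          using C by (intro ennreal_mult''[symmetric]) simp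
        also have "\<bar>K\<bar> * x ^ ?N * (\<rho> * x) powr (- \<tau>\<^sub>1) * (C * (\<rho> * x / real (card B)) powr (- \<tau>\<^sub>2))
           = D * \<rho> powr (- (\<tau>\<^sub>1 + \<tau>\<^sub>2)) * x powr s"
        proof -
          have "x ^ ?N = x powr real ?N" using x by (simp add: powr_realpow)
          moreover have "x powr real ?N * x powr (- \<tau>\<^sub>1) * x powr (- \<tau>\<^sub>2) = x powr s"
            by (simp add: s_def powr_add[symmetric] diff_diff_eq)
          moreover have "\<rho> powr (- \<tau>\<^sub>1) * \<rho> powr (- \<tau>\<^sub>2) = \<rho> powr (- (\<tau>\<^sub>1 + \<tau>\<^sub>2))"
            by (simp add: powr_add[symmetric])
          moreover have "(\<rho> * x / real (card B)) powr (- \<tau>\<^sub>2) = \<rho> powr (- \<tau>\<^sub>2) * x powr (- \<tau>\<^sub>2) * real (card B) powr \<tau>\<^sub>2"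
            using x \<rho> cAB by (simp add: powr_divide powr_mult powr_minus field_simps)
          moreover have "(\<rho> * x) powr (- \<tau>\<^sub>1) = \<rho> powr (- \<tau>\<^sub>1) * x powr (- \<tau>\<^sub>1)"
            using x \<rho> by (simp add: powr_mult)
          ultimately show ?thesis unfolding D_def by (simp add: mult_ac)
        qed
        finally have "ennreal (K * x ^ ?N * (\<rho> * x) powr (- \<tau>\<^sub>1)) * polydisc_moment (A - {p}) (B - {q}) c (\<rho> * x / real (card B))
           \<le> ennreal (D * \<rho> powr (- (\<tau>\<^sub>1 + \<tau>\<^sub>2))) * ennreal (x powr s)"
          by (simp add: ennreal_mult'')
        from mult_left_mono[OF this zero_le, of "w g"]
        show "w g * ennreal (K * ((norm g)\<^sup>2) ^ ?N * (\<rho> * (norm g)\<^sup>2) powr (- \<tau>\<^sub>1))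
        * polydisc_moment (A - {p}) (B - {q}) c (\<rho> * (norm g)\<^sup>2 / real (card B)) \<le> ennreal (D * \<rho> powr (- (\<tau>\<^sub>1 + \<tau>\<^sub>2))) * (w g * ennreal (((norm g)\<^sup>2) powr s))"
          unfolding x_def by (simp only: mult_ac)
      qed
    qed
    also have "\<dots> = ennreal (D * \<rho> powr (- (\<tau>\<^sub>1 + \<tau>\<^sub>2))) * I"
      unfolding I_def
    proof (rule nn_integral_cmult)
      have "(\<lambda>g::complex. ennreal (((norm g)\<^sup>2) powr s)) \<in> borel_measurable borel" by measurable
      then show "(\<lambda>g. w g * ennreal (((norm g)\<^sup>2) powr s)) \<in> borel_measurable lborel"
        using wm by simp
    qed
    also have "I = ennreal (enn2real I)" using I by simp
    also have "ennreal (D * \<rho> powr (- (\<tau>\<^sub>1 + \<tau>\<^sub>2))) * ennreal (enn2real I) = ennreal (D * enn2real I * \<rho> powr (- (\<tau>\<^sub>1 + \<tau>\<^sub>2)))"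
      by (subst ennreal_mult''[symmetric]) (auto simp: mult_ac)
    finally show ?thesis .
  qed
  then show ?thesis using D0 by (intro exI[of _ "D * enn2real I"]) auto
qed

lemma pivot_exists:
  fixes f :: "'a \<times> 'b \<Rightarrow> complex"
  assumes "finite A" "finite B" "A \<noteq> {}" "B \<noteq> {}"
  shows "\<exists>x\<in>A \<times> B. f \<in> polydisc (A \<times> B) (norm (f x))"
proof -
  have fin: "finite ((\<lambda>x. norm (f x)) ` (A \<times> B))" "(\<lambda>x. norm (f x)) ` (A \<times> B) \<noteq> {}" using assms by auto
  from Max_in[OF fin] obtain x where x: "Max ((\<lambda>x. norm (f x)) ` (A \<times> B)) = norm (f x)" "x \<in> A \<times> B"
    by (rule imageE)
  have "norm (f y) \<le> norm (f x)" if "y \<in> A \<times> B" for y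
    using Max_ge[OF fin(1), of "norm (f y)"] that x(1) by simp
  then show ?thesis using x(2) unfolding polydisc_def by blast
qed

text \<open>Some entry has the largest modulus, so summing over all candidates for the pivot bounds
  the integral. The estimate for smaller matrices is a premise because the lemma is used twice:
  inside the induction with the disc and after it with the Gaussian.\<close>

lemma weighted_integral_bound:
  fixes A :: "'a set" and B :: "'b set" and u :: "('a \<times> 'b \<Rightarrow> complex) \<Rightarrow> ennreal"
  assumes fin: "finite A" "finite B" and ne: "A \<noteq> {}" "B \<noteq> {}" and c: "1 \<le> c" and w: "good_weight w"
    and \<tau>: "0 \<le> \<tau>" "\<tau> < moment_exponent (card A) (card B) c"
    and IH: "\<And>p q \<tau>'. p \<in> A \<Longrightarrow> q \<in> B \<Longrightarrow> 0 \<le> \<tau>' \<Longrightarrow> \<tau>' = 0 \<or> \<tau>' < moment_exponent (card A - 1) (card B - 1) c \<Longrightarrow>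
        \<exists>C\<ge>0. \<forall>\<rho>>0. polydisc_moment (A - {p}) (B - {q}) c \<rho> \<le> ennreal (C * \<rho> powr (- \<tau>'))"
    and u: "\<And>f x. x \<in> A \<times> B \<Longrightarrow> f \<in> polydisc (A \<times> B) (norm (f x)) \<Longrightarrow> u f \<le> w (f x)"
  shows "\<exists>D\<ge>0. \<forall>\<rho>>0. (\<integral>\<^sup>+f. u f * Phi A B 1 \<rho> f ^ c \<partial>Pi_lborel (A \<times> B)) \<le> ennreal (D * \<rho> powr (- \<tau>))"
proof -
  \<comment> \<open>One pivot accounts for at most c of the exponent, since each of the c factors
    \<open>Phi\<close> admits \<theta> at most 1. The rest is left to the smaller matrix.\<close>
  define \<tau>\<^sub>1 \<tau>\<^sub>2 where "\<tau>\<^sub>1 = min \<tau> (real c)" and "\<tau>\<^sub>2 = max 0 (\<tau> - real c)"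
  have cAB: "card A = Suc (card A - 1)" "card B = Suc (card B - 1)" using fin ne by (auto simp: card_gt_0_iff)
  have q: "moment_exponent (card A) (card B) c = min (real (card A) * real (card B)) (real c + moment_exponent (card A - 1) (card B - 1) c)"
    using moment_exponent.simps(3)[of "card A - 1" "card B - 1" c] cAB by metis
  have \<tau>12: "\<tau>\<^sub>1 + \<tau>\<^sub>2 = \<tau>" "0 \<le> \<tau>\<^sub>1" "\<tau>\<^sub>1 \<le> real c" "0 \<le> \<tau>\<^sub>2" "\<tau>\<^sub>2 = 0 \<or> \<tau>\<^sub>2 < moment_exponent (card A - 1) (card B - 1) c"
    "\<tau> < real (card A) * real (card B)"
    using \<tau> q by (auto simp: \<tau>\<^sub>1_def \<tau>\<^sub>2_def)
  have "\<exists>D\<ge>0. \<forall>\<rho>>0. (\<integral>\<^sup>+f. pivot_integrand w A B c \<rho> x f \<partial>Pi_lborel (A \<times> B)) \<le> ennreal (D * \<rho> powr (- \<tau>))" if "x \<in> A \<times> B" for x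
  proof -
    obtain p q where x: "x = (p, q)" and pq: "p \<in> A" "q \<in> B" using \<open>x \<in> A \<times> B\<close> by auto
    obtain C where C: "C \<ge> 0" "\<And>\<rho>. \<rho> > 0 \<Longrightarrow> polydisc_moment (A - {p}) (B - {q}) c \<rho> \<le> ennreal (C * \<rho> powr (- \<tau>\<^sub>2))"
      using IH[OF pq \<tau>12(4,5)] by blast
    show ?thesis
      using pivot_integrand_integral_bound[OF fin pq c w \<tau>12(2,3,4) _ C] \<tau>12(1,6) unfolding x by simp
  qed
  then obtain D where D: "\<And>x. x \<in> A \<times> B \<Longrightarrow> D x \<ge> 0"
     "\<And>x \<rho>. x \<in> A \<times> B \<Longrightarrow> \<rho> > 0 \<Longrightarrow> (\<integral>\<^sup>+f. pivot_integrand w A B c \<rho> x f \<partial>Pi_lborel (A \<times> B)) \<le> ennreal (D x * \<rho> powr (- \<tau>))"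
    by metis
  have "(\<integral>\<^sup>+f. u f * Phi A B 1 \<rho> f ^ c \<partial>Pi_lborel (A \<times> B)) \<le> ennreal ((\<Sum>x\<in>A \<times> B. D x) * \<rho> powr (- \<tau>))" if \<rho>: "\<rho> > 0" for \<rho>
  proof -
    have "(\<integral>\<^sup>+f. u f * Phi A B 1 \<rho> f ^ c \<partial>Pi_lborel (A \<times> B)) \<le> (\<integral>\<^sup>+f. (\<Sum>x\<in>A \<times> B. pivot_integrand w A B c \<rho> x f) \<partial>Pi_lborel (A \<times> B))"
    proof (rule nn_integral_mono)
      fix f :: "'a \<times> 'b \<Rightarrow> complex"
      obtain x where x: "x \<in> A \<times> B" "f \<in> polydisc (A \<times> B) (norm (f x))" using pivot_exists[OF fin ne] by metis
      have "u f * Phi A B 1 \<rho> f ^ c \<le> pivot_integrand w A B c \<rho> x f"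
        using u[OF x] x by (simp add: pivot_integrand_def mult_right_mono)
      also have "\<dots> \<le> (\<Sum>x\<in>A \<times> B. pivot_integrand w A B c \<rho> x f)"
        using fin by (intro member_le_sum x) auto
      finally show "u f * Phi A B 1 \<rho> f ^ c \<le> (\<Sum>x\<in>A \<times> B. pivot_integrand w A B c \<rho> x f)" .
    qed
    also have "\<dots> = (\<Sum>x\<in>A \<times> B. \<integral>\<^sup>+f. pivot_integrand w A B c \<rho> x f \<partial>Pi_lborel (A \<times> B))"
      using w by (intro nn_integral_sum pivot_integrand_measurable fin) (auto simp: good_weight_def)
    also have "\<dots> \<le> (\<Sum>x\<in>A \<times> B. ennreal (D x * \<rho> powr (- \<tau>)))"
      by (intro sum_mono D \<rho>)
    also have "\<dots> = ennreal ((\<Sum>x\<in>A \<times> B. D x) * \<rho> powr (- \<tau>))"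
      using D by (subst sum_ennreal) (auto simp: sum_distrib_right)
    finally show ?thesis .
  qed
  then show ?thesis using D by (intro exI[of _ "\<Sum>x\<in>A \<times> B. D x"]) (auto intro!: sum_nonneg)
qed

lemma polydisc_moment_bound:
  fixes A :: "'a set" and B :: "'b set"
  assumes "finite A" "finite B" "1 \<le> c" "0 \<le> \<tau>" "\<tau> = 0 \<or> \<tau> < moment_exponent (card A) (card B) c"
  shows "\<exists>C\<ge>0. \<forall>\<rho>>0. polydisc_moment A B c \<rho> \<le> ennreal (C * \<rho> powr (- \<tau>))"
  using assms
proof (induction "card A" arbitrary: A B \<tau> rule: less_induct)
  case less
  note fin = less.prems(1,2)
  show ?case
  proof (cases "\<tau> = 0")
    case True
    obtain C where "C \<ge> 0" "\<And>\<rho>. \<rho> > 0 \<Longrightarrow> polydisc_moment A B c \<rho> \<le> ennreal C" using polydisc_moment_bounded[OF fin] by blast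
    then show ?thesis using True by (intro exI[of _ C]) auto
  next
    case False
    then have \<tau>: "\<tau> < moment_exponent (card A) (card B) c" using less.prems by auto
    \<comment> \<open>\<open>moment_exponent\<close> is 0 for an empty index set, so it cannot
      exceed a positive \<tau>.\<close>
    then have "A \<noteq> {}" "B \<noteq> {}" using less.prems(4) by (auto simp: gr0_conv_Suc) (cases "card A", auto)
    note ne = this
    show ?thesis
      unfolding polydisc_moment_def
    proof (rule weighted_integral_bound[OF fin ne less.prems(3) good_weight_disc less.prems(4) \<tau>])
      fix p q \<tau>' assume h: "p \<in> A" "q \<in> B" "0 \<le> \<tau>'" "\<tau>' = 0 \<or> \<tau>' < moment_exponent (card A - 1) (card B - 1) c"
      then have "card (A - {p}) = card A - 1" "card (B - {q}) = card B - 1" using fin by auto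
      moreover have "card A - 1 < card A" using fin ne by (simp add: card_gt_0_iff)
      ultimately show "\<exists>C\<ge>0. \<forall>\<rho>>0. polydisc_moment (A - {p}) (B - {q}) c \<rho> \<le> ennreal (C * \<rho> powr (- \<tau>'))"
        using h fin less.prems(3) by (intro less.hyps) auto
    next
      fix f :: "'a \<times> 'b \<Rightarrow> complex" and x assume "x \<in> A \<times> B" "f \<in> polydisc (A \<times> B) (norm (f x))"
      then show "indicator (polydisc (A \<times> B) 1) f \<le> (indicator {z. norm z \<le> 1} (f x) :: ennreal)"
        by (auto simp: polydisc_def indicator_def)
    qed
  qed
qed

text \<open>Of the Gaussian only the factor of the pivot is kept; on the domain considered the pivot
  bounds all other entries, so these range over a bounded set.\<close>

lemma gauss_Phi_moment_bound:
  fixes A :: "'a set" and B :: "'b set"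
  assumes fin: "finite A" "finite B" and ne: "A \<noteq> {}" "B \<noteq> {}" and c: "1 \<le> c" and \<tau>: "0 \<le> \<tau>" "\<tau> < moment_exponent (card A) (card B) c"
  shows "\<exists>D\<ge>0. \<forall>\<rho>>0. (\<integral>\<^sup>+f. ennreal (exp (- (\<Sum>x\<in>A \<times> B. (norm (f x))\<^sup>2))) * Phi A B 1 \<rho> f ^ c \<partial>Pi_lborel (A \<times> B)) \<le> ennreal (D * \<rho> powr (- \<tau>))"
proof (rule weighted_integral_bound[OF fin ne c good_weight_gauss \<tau>])
  fix p q \<tau>' assume h: "p \<in> A" "q \<in> B" "0 \<le> \<tau>'" "\<tau>' = 0 \<or> \<tau>' < moment_exponent (card A - 1) (card B - 1) c"
  then show "\<exists>C\<ge>0. \<forall>\<rho>>0. polydisc_moment (A - {p}) (B - {q}) c \<rho> \<le> ennreal (C * \<rho> powr (- \<tau>'))"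
    using fin c by (intro polydisc_moment_bound) auto
next
  fix f :: "'a \<times> 'b \<Rightarrow> complex" and x assume "x \<in> A \<times> B"
  then have "(norm (f x))\<^sup>2 \<le> (\<Sum>x\<in>A \<times> B. (norm (f x))\<^sup>2)"
    using fin member_le_sum[of x "A \<times> B" "\<lambda>x. (norm (f x))\<^sup>2"] by simp
  then show "ennreal (exp (- (\<Sum>x\<in>A \<times> B. (norm (f x))\<^sup>2))) \<le> ennreal (exp (- (norm (f x))\<^sup>2))"
    by (intro ennreal_leI) simp
qed

text \<open>The order c is the slope, in modulus, of d between j - 1 and j. For it
  \<open>(a - i) (b - i) + i c\<close> exceeds its value at i = j by
  \<open>(i - j) (i - j + 1)\<close>, a product of two consecutive integers. That some i attains
  \<open>moment_exponent\<close> is enough for the comparison.\<close>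

lemma moment_exponent_ge:
  fixes a b :: nat
  assumes "j \<le> min a b" "1 \<le> j" and c: "real c = real a + real b - 2 * real j + 1"
  shows "(real a - real j) * (real b - real j) + real j * real c \<le> moment_exponent a b c"
proof -
  have "\<exists>i\<le>min a b. moment_exponent a b c = (real a - real i) * (real b - real i) + real i * real c" for a b c
  proof (induction a b c rule: moment_exponent.induct)
    case (3 a b c)
    then obtain i where i: "i \<le> min a b" "moment_exponent a b c = (real a - real i) * (real b - real i) + real i * real c" by blast
    show ?case
    proof (cases "real (Suc a) * real (Suc b) \<le> real c + moment_exponent a b c")
      case True
      then show ?thesis by (intro exI[of _ 0]) auto
    next
      case False
      then show ?thesis using i by (intro exI[of _ "Suc i"]) (auto simp: algebra_simps)
    qed
  qed auto
  then obtain i where i: "i \<le> min a b" "moment_exponent a b c = (real a - real i) * (real b - real i) + real i * real c" by blast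
  have "0 \<le> (real i - real j) * (real i - real j + 1)"
  proof (cases "i \<ge> j")
    case False
    then have "real i - real j \<le> 0" "real i - real j + 1 \<le> 0" by auto
    then show ?thesis by (rule mult_nonpos_nonpos)
  qed auto
  then show ?thesis unfolding i(2) c by (simp add: algebra_simps)
qed

section \<open>Volume of matrices with small determinant\<close>

definition big_Phi_set :: "'a set \<Rightarrow> 'b set \<Rightarrow> real \<Rightarrow> real \<Rightarrow> real \<Rightarrow> ennreal \<Rightarrow> ('a \<times> 'b \<Rightarrow> complex) set" where
  "big_Phi_set A B R \<alpha> \<rho> t = {f \<in> polydisc (A \<times> B) R. t \<le> Phi A B \<alpha> \<rho> f}"

lemma big_Phi_set_measurable:
  assumes "finite A" "finite B"
  shows "(\<lambda>f. indicator (big_Phi_set A B R \<alpha> \<rho> t) f :: ennreal) \<in> borel_measurable (Pi_lborel (A \<times> B))"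
proof -
  have "(\<lambda>f. indicator (big_Phi_set A B R \<alpha> \<rho> t) f :: ennreal) = (\<lambda>f. indicator (polydisc (A \<times> B) R) f * indicator {t..} (Phi A B \<alpha> \<rho> f))"
    by (auto simp: big_Phi_set_def indicator_def fun_eq_iff)
  moreover have "(\<lambda>f. indicator (polydisc (A \<times> B) R) f * indicator {t..} (Phi A B \<alpha> \<rho> f) :: ennreal) \<in> borel_measurable (Pi_lborel (A \<times> B))"
    using assms by (intro borel_measurable_times_ennreal polydisc_indicator_measurable
      measurable_compose[OF Phi_measurable borel_measurable_indicator[OF borel_closed]]) auto
  ultimately show ?thesis by simp
qed

text \<open>When \<rho> r^2 is bounded, the quadratic form is at most a constant times the squared
  norm of k and can be absorbed into the weight, so the bound does not decay with \<rho>.\<close>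

lemma Phi_lower_small:
  assumes fin: "finite A" "finite B" and f: "f \<in> polydisc (A \<times> B) r" and r: "0 \<le> r" and \<alpha>: "0 < \<alpha>" and \<rho>: "0 \<le> \<rho>" "\<rho> * r\<^sup>2 \<le> D"
  shows "ennreal ((pi / (\<alpha> + D * real (card A) * real (card B))) ^ card A) \<le> Phi A B \<alpha> \<rho> f"
proof -
  define \<beta> where "\<beta> = \<alpha> + D * real (card A) * real (card B)"
  have D: "D \<ge> 0" using \<rho> r by (meson mult_nonneg_nonneg order_trans zero_le_power2)
  have \<beta>: "\<beta> > 0" using \<alpha> D by (simp add: \<beta>_def add_pos_nonneg)
  have "Phi A B \<beta> 0 f \<le> Phi A B \<alpha> \<rho> f"
    unfolding Phi_def
  proof (intro nn_integral_mono ennreal_leI)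
    fix k :: "'a \<Rightarrow> complex"
    define S where "S = (\<Sum>i\<in>A. (norm (k i))\<^sup>2)"
    have S0: "S \<ge> 0" by (simp add: S_def sum_nonneg)
    have "(norm (\<Sum>i\<in>A. k i * f (i, j)))\<^sup>2 \<le> r\<^sup>2 * (S * real (card A))" if "j \<in> B" for j
    proof -
      have "norm (\<Sum>i\<in>A. k i * f (i, j)) \<le> (\<Sum>i\<in>A. norm (k i * f (i, j)))" by (rule norm_sum)
      also have "\<dots> \<le> (\<Sum>i\<in>A. norm (k i) * r)"
        using f that by (intro sum_mono) (auto simp: norm_mult polydisc_def intro!: mult_left_mono)
      also have "\<dots> = r * (\<Sum>i\<in>A. norm (k i))" by (simp add: sum_distrib_left mult.commute)
      finally have "(norm (\<Sum>i\<in>A. k i * f (i, j)))\<^sup>2 \<le> (r * (\<Sum>i\<in>A. norm (k i)))\<^sup>2"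
        by (intro power_mono) auto
      also have "\<dots> = r\<^sup>2 * (\<Sum>i\<in>A. norm (k i))\<^sup>2" by (simp add: power_mult_distrib)
      also have "\<dots> \<le> r\<^sup>2 * (S * real (card A))"
        unfolding S_def using fin by (intro mult_left_mono sum_squared_le_sum_of_squares) auto
      finally show ?thesis .
    qed
    then have "(\<Sum>j\<in>B. (norm (\<Sum>i\<in>A. k i * f (i, j)))\<^sup>2) \<le> real (card B) * (r\<^sup>2 * (S * real (card A)))"
      by (rule sum_bounded_above)
    then have "\<rho> * (\<Sum>j\<in>B. (norm (\<Sum>i\<in>A. k i * f (i, j)))\<^sup>2) \<le> \<rho> * (real (card B) * (r\<^sup>2 * (S * real (card A))))"
      using \<rho> by (intro mult_left_mono)
    also have "\<dots> = (\<rho> * r\<^sup>2) * (real (card B) * (S * real (card A)))" by (simp add: mult_ac)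
    also have "\<dots> \<le> D * (real (card B) * (S * real (card A)))"
      using S0 \<rho> by (intro mult_right_mono) auto
    finally show "exp (- \<beta> * (\<Sum>i\<in>A. (norm (k i))\<^sup>2) - 0 * (\<Sum>j\<in>B. (norm (\<Sum>i\<in>A. k i * f (i, j)))\<^sup>2))
      \<le> exp (- \<alpha> * (\<Sum>i\<in>A. (norm (k i))\<^sup>2) - \<rho> * (\<Sum>j\<in>B. (norm (\<Sum>i\<in>A. k i * f (i, j)))\<^sup>2))"
      unfolding S_def[symmetric] \<beta>_def by (simp add: algebra_simps)
  qed
  moreover have "Phi A B \<beta> 0 f = ennreal ((pi / \<beta>) ^ card A)"
    using Phi_zero[OF fin(1) \<beta>, of B f] \<beta> by (simp add: ennreal_power)
  ultimately show ?thesis by (simp add: \<beta>_def)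
qed

abbreviation disc_vol :: real where "disc_vol \<equiv> measure lborel (cball (0::complex) 1)"

lemma disc_vol_pos: "0 < disc_vol"
  by (rule content_cball_pos) simp

lemma emeasure_ring:
  assumes "0 < G"
  shows "(\<integral>\<^sup>+(g::complex). indicator (cball 0 G - cball 0 (G/2)) g \<partial>lborel) = ennreal (3/4 * disc_vol * G\<^sup>2)"
proof -
  have "emeasure lborel (cball (0::complex) G - cball 0 (G/2)) = emeasure lborel (cball (0::complex) G) - emeasure lborel (cball (0::complex) (G/2))"
    using assms emeasure_lborel_cball_finite[of "0::complex" "G/2"] by (intro emeasure_Diff) (auto simp: subset_iff)
  also have "\<dots> = ennreal (G\<^sup>2 * disc_vol) - ennreal ((G/2)\<^sup>2 * disc_vol)"
    using assms by (simp add: emeasure_disc)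
  also have "\<dots> = ennreal (G\<^sup>2 * disc_vol - (G/2)\<^sup>2 * disc_vol)"
    by (rule ennreal_minus) simp
  also have "G\<^sup>2 * disc_vol - (G/2)\<^sup>2 * disc_vol = 3/4 * disc_vol * G\<^sup>2" by (simp add: power2_eq_square)
  finally show ?thesis by simp
qed

text \<open>The lower pivot step needs a pivot that dominates its own row and column only. A pivot
  in the annulus between G/2 and G, with the rest of its row and column within G/2, provides this
  and leaves the remaining block free up to R. That block is translated by at most
  \<open>G/2 \<le> R/2\<close>, so a complement of radius R/2 comes from a block of radius
  R.\<close>

lemma big_Phi_set_pivot:
  fixes A :: "'a set" and B :: "'b set"
  assumes fin: "finite A" "finite B" and p: "p \<in> A" and q: "q \<in> B"
    and G: "0 < G" "G \<le> R" and \<rho>: "0 \<le> \<rho>" and \<alpha>: "0 < \<alpha>"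
  shows "ennreal (3/4 * disc_vol * G\<^sup>2 * ((G/2)\<^sup>2 * disc_vol) ^ (card A + card B - 2))
      * (\<integral>\<^sup>+y. indicator (big_Phi_set (A - {p}) (B - {q}) (R/2) (\<alpha> * (1 + 2 * real (card A))) (2 * \<rho>) t) y \<partial>Pi_lborel ((A - {p}) \<times> (B - {q})))
    \<le> (\<integral>\<^sup>+f. indicator (big_Phi_set A B R \<alpha> \<rho> (ennreal (pi / (2 * \<alpha> + 2 * real (card B) * \<rho> * G\<^sup>2)) * t)) f \<partial>Pi_lborel (A \<times> B))"
proof -
  define X where "X = {p} \<times> (B - {q}) \<union> (A - {p}) \<times> {q}"
  define Y where "Y = (A - {p}) \<times> (B - {q})"
  note I = pivot_index_sets[OF fin p q, folded X_def Y_def]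
  have cX: "card X = card A + card B - 2"
  proof -
    have "card X = card ({p} \<times> (B - {q})) + card ((A - {p}) \<times> {q})"
      unfolding X_def using fin by (intro card_Un_disjoint) auto
    also have "\<dots> = (card B - 1) + (card A - 1)" using fin p q by simp
    also have "\<dots> = card A + card B - 2"
      using fin p q by (metis (no_types, lifting) Nat.add_diff_assoc Suc_leI add.commute card_gt_0_iff diff_diff_left empty_iff nat_1_add_1 One_nat_def)
    finally show ?thesis .
  qed
  define T where "T = ennreal (pi / (2 * \<alpha> + 2 * real (card B) * \<rho> * G\<^sup>2)) * t"
  define L' where "L' = big_Phi_set (A - {p}) (B - {q}) (R/2) (\<alpha> * (1 + 2 * real (card A))) (2 * \<rho>) t"
  define J where "J = (\<integral>\<^sup>+y. indicator L' y \<partial>Pi_lborel Y)"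
  let ?F = "\<lambda>f. indicator (big_Phi_set A B R \<alpha> \<rho> T) f :: ennreal"
  have mF: "?F \<in> borel_measurable (Pi_lborel (insert (p, q) (X \<union> Y)))"
    unfolding I(1)[symmetric] by (rule big_Phi_set_measurable[OF fin])
  have "ennreal (3/4 * disc_vol * G\<^sup>2 * ((G/2)\<^sup>2 * disc_vol) ^ card X) * J
      = ennreal (3/4 * disc_vol * G\<^sup>2) * (ennreal (((G/2)\<^sup>2 * disc_vol) ^ card X) * J)"
    by (subst ennreal_mult'', simp, simp only: mult.assoc)
  also have "\<dots> = (\<integral>\<^sup>+g. indicator (cball (0::complex) G - cball 0 (G/2)) g \<partial>lborel) * (ennreal (((G/2)\<^sup>2 * disc_vol) ^ card X) * J)"
    by (simp only: emeasure_ring[OF G(1)])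
  also have "\<dots> = (\<integral>\<^sup>+g. indicator (cball (0::complex) G - cball 0 (G/2)) g * (ennreal (((G/2)\<^sup>2 * disc_vol) ^ card X) * J) \<partial>lborel)"
    by (intro nn_integral_multc[symmetric] borel_measurable_indicator) (auto intro!: sets.Diff borel_closed)
  also have "\<dots> \<le> (\<integral>\<^sup>+g. (\<integral>\<^sup>+f. ?F (f((p, q) := g)) \<partial>Pi_lborel (X \<union> Y)) \<partial>lborel)"
  proof (rule nn_integral_mono)
    fix g :: complex
    show "indicator (cball (0::complex) G - cball 0 (G/2)) g * (ennreal (((G/2)\<^sup>2 * disc_vol) ^ card X) * J)
       \<le> (\<integral>\<^sup>+f. ?F (f((p, q) := g)) \<partial>Pi_lborel (X \<union> Y))"
    proof (cases "g \<in> cball (0::complex) G - cball 0 (G/2)")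
      case False
      then have z: "indicator (cball (0::complex) G - cball 0 (G/2)) g = (0::ennreal)" by (rule indicator_simps(2))
      show ?thesis by (simp only: z mult_zero_left zero_le)
    next
      case True
      then have g: "norm g \<le> G" "G/2 < norm g" "g \<noteq> 0" using G by auto
      have mF': "(\<lambda>f. ?F (f((p, q) := g))) \<in> borel_measurable (Pi_lborel (X \<union> Y))"
        by (rule measurable_compose[OF measurable_fun_upd mF]) (auto intro: measurable_ident_sets)
      have "indicator (cball (0::complex) G - cball 0 (G/2)) g * (ennreal (((G/2)\<^sup>2 * disc_vol) ^ card X) * J)
         = (\<integral>\<^sup>+h. indicator (polydisc X (G/2)) h \<partial>Pi_lborel X) * J"
        using True G by (subst emeasure_polydisc) (use I in auto)
      also have "\<dots> = (\<integral>\<^sup>+h. indicator (polydisc X (G/2)) h * J \<partial>Pi_lborel X)"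
        using I by (intro nn_integral_multc[symmetric] polydisc_indicator_measurable)
      also have "\<dots> \<le> (\<integral>\<^sup>+h. (\<integral>\<^sup>+y. ?F ((merge X Y (h, y))((p, q) := g)) \<partial>Pi_lborel Y) \<partial>Pi_lborel X)"
      proof (rule nn_integral_mono)
        fix h :: "'a \<times> 'b \<Rightarrow> complex"
        show "indicator (polydisc X (G/2)) h * J \<le> (\<integral>\<^sup>+y. ?F ((merge X Y (h, y))((p, q) := g)) \<partial>Pi_lborel Y)"
        proof (cases "h \<in> polydisc X (G/2)")
          case hX: True
          define t' where "t' = (\<lambda>(i, j). h (i, q) * h (p, j) / g)"
          have t': "norm (t' x) \<le> R / 2" if "x \<in> Y" for x
          proof -
            obtain i j where x: "x = (i, j)" by (cases x)
            have "norm (h (i, q)) \<le> G/2" "norm (h (p, j)) \<le> G/2" using hX that x by (auto simp: polydisc_def X_def Y_def)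
            then have "norm (h (i, q)) * norm (h (p, j)) \<le> G/2 * norm g" using G g by (intro mult_mono) auto
            then have "norm (t' x) \<le> G/2" using g by (simp add: x t'_def norm_mult norm_divide divide_le_eq)
            then show ?thesis using G by simp
          qed
          \<comment> \<open>Translation invariance in the block variables: the Schur complement
            takes the place of the entries.\<close>
          have "J = ennreal (1\<^sup>2) ^ card Y * (\<integral>\<^sup>+y. indicator L' (\<lambda>x\<in>Y. - t' x + 1 *\<^sub>R y x) \<partial>Pi_lborel Y)"
            unfolding J_def L'_def using I fin
            by (intro nn_integral_PiM_complex_affine) (auto simp: Y_def intro: big_Phi_set_measurable)
          also have "\<dots> = (\<integral>\<^sup>+y. indicator L' (\<lambda>x\<in>Y. - t' x + 1 *\<^sub>R y x) \<partial>Pi_lborel Y)" by simp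
          also have "\<dots> \<le> (\<integral>\<^sup>+y. ?F ((merge X Y (h, y))((p, q) := g)) \<partial>Pi_lborel Y)"
          proof (rule nn_integral_mono)
            fix y :: "'a \<times> 'b \<Rightarrow> complex"
            show "indicator L' (\<lambda>x\<in>Y. - t' x + 1 *\<^sub>R y x) \<le> ?F ((merge X Y (h, y))((p, q) := g))"
            proof (cases "(\<lambda>x\<in>Y. - t' x + 1 *\<^sub>R y x) \<in> L'")
              case L': True
              define f where "f = (merge X Y (h, y))((p, q) := g)"
              have fpq: "f (p, q) = g" by (simp add: f_def)
              have fX: "f x = h x" if "x \<in> X" for x using that I by (auto simp: f_def merge_def)
              have fY: "f x = y x" if "x \<in> Y" for x using that I by (auto simp: f_def merge_def)
              have nX: "norm (f x) \<le> G / 2" if "x \<in> X" for x using that hX fX by (auto simp: polydisc_def)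
              have "norm (y x) \<le> R" if "x \<in> Y" for x
              proof -
                have "norm (- t' x + y x) \<le> R / 2" using L' that by (auto simp: L'_def big_Phi_set_def polydisc_def Y_def)
                moreover have "norm (y x) \<le> norm (- t' x + y x) + norm (t' x)" by (metis add.commute add_uminus_conv_diff norm_triangle_sub)
                ultimately show ?thesis using t'[OF that] by linarith
              qed
              then have "f \<in> polydisc (A \<times> B) R"
                unfolding polydisc_def I(1) using g G fY nX by (force simp: fpq)
              moreover have "T \<le> Phi A B \<alpha> \<rho> f"
              proof -
                have row: "norm (f (p, j)) \<le> norm (f (p, q))" if "j \<in> B" for j
                  using nX[of "(p, j)"] g that by (cases "j = q") (auto simp: fpq X_def)
                have col: "norm (f (i, q)) \<le> norm (f (p, q))" if "i \<in> A" for i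
                  using nX[of "(i, q)"] g that by (cases "i = p") (auto simp: fpq X_def)
                have "t \<le> Phi (A - {p}) (B - {q}) (\<alpha> * (1 + 2 * real (card A))) (2 * \<rho>) (\<lambda>x\<in>Y. - t' x + 1 *\<^sub>R y x)"
                  using L' by (simp add: L'_def big_Phi_set_def)
                also have "Phi (A - {p}) (B - {q}) (\<alpha> * (1 + 2 * real (card A))) (2 * \<rho>) (\<lambda>x\<in>Y. - t' x + 1 *\<^sub>R y x)
                    = Phi (A - {p}) (B - {q}) (\<alpha> * (1 + 2 * real (card A))) (2 * \<rho>) (schur p q f)"
                  by (intro Phi_cong) (auto simp: schur_def fpq fX fY t'_def Y_def X_def)
                finally have t: "t \<le> \<dots>" .
                have "T \<le> ennreal (pi / (2 * \<alpha> + 2 * real (card B) * \<rho> * (norm (f (p, q)))\<^sup>2))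
                    * Phi (A - {p}) (B - {q}) (\<alpha> * (1 + 2 * real (card A))) (2 * \<rho>) (schur p q f)"
                  unfolding T_def using G g \<alpha> \<rho>
                  by (intro mult_mono t ennreal_leI divide_left_mono add_mono mult_left_mono power_mono mult_pos_pos add_pos_nonneg) (auto simp: fpq)
                also have "\<dots> \<le> Phi A B \<alpha> \<rho> f"
                  using g by (intro Phi_pivot_lower fin p q row col \<rho> \<alpha>) (auto simp: fpq)
                finally show ?thesis .
              qed
              ultimately have "f \<in> big_Phi_set A B R \<alpha> \<rho> T" by (simp add: big_Phi_set_def)
              moreover have "indicator L' z \<le> (1::ennreal)" for z by (simp add: indicator_def)
              ultimately show ?thesis unfolding f_def[symmetric] by (simp only: indicator_simps(1))
            qed simp
          qed
          finally show ?thesis using hX by simp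
        qed simp
      qed
      also have "\<dots> = (\<integral>\<^sup>+f. ?F (f((p, q) := g)) \<partial>Pi_lborel (X \<union> Y))"
        using I by (intro complex_product.product_nn_integral_fold[symmetric] mF') auto
      finally show ?thesis .
    qed
  qed
  also have "\<dots> = (\<integral>\<^sup>+f. ?F f \<partial>Pi_lborel (A \<times> B))"
    unfolding I(1) by (rule complex_product.product_nn_integral_insert_rev[OF _ I(2) mF, symmetric]) (use I in auto)
  finally show ?thesis unfolding T_def J_def L'_def cX Y_def .
qed

lemma big_Phi_set_volume_antimono:
  assumes "t \<le> t'"
  shows "(\<integral>\<^sup>+f. indicator (big_Phi_set A B R \<alpha> \<rho> t') f \<partial>Pi_lborel (A \<times> B)) \<le> (\<integral>\<^sup>+f. indicator (big_Phi_set A B R \<alpha> \<rho> t) f \<partial>Pi_lborel (A \<times> B))"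
  using assms by (intro nn_integral_mono) (auto simp: big_Phi_set_def indicator_def intro: order_trans)

text \<open>Each of p pivots of size of order 1 lowers \<open>Phi\<close> by a factor of order
  \<open>1 / \<rho>\<close> and costs a constant in volume. The next pivot, of size
  \<open>\<rho> powr (- (1 - \<theta>) / 2)\<close>, lowers it by
  \<open>\<rho> powr (- \<theta>)\<close>, and the last block, of size
  \<open>\<rho> powr (- 1/2)\<close>, lowers it by a constant. The exponent of the volume counts the
  entries forced to be small. Each step alters \<alpha>, C and R, so the induction generalises over
  them.\<close>

lemma big_Phi_set_volume_lower:
  fixes A :: "'a set" and B :: "'b set"
  assumes "finite A" "finite B" and "p < card A" "p < card B" and \<theta>: "0 \<le> \<theta>" "\<theta> < 1"
    and "0 < \<alpha>" "0 < C" "0 < R"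
  shows "\<exists>\<kappa>>0. \<forall>\<rho>\<ge>1. ennreal (\<kappa> * \<rho> powr (- ((1 - \<theta>) * (real (card A) + real (card B) - 2 * real p - 1)
        + (real (card A) - real p - 1) * (real (card B) - real p - 1))))
     \<le> (\<integral>\<^sup>+f. indicator (big_Phi_set A B R \<alpha> (C * \<rho>) (ennreal (\<kappa> * \<rho> powr (- (real p + \<theta>))))) f \<partial>Pi_lborel (A \<times> B))"
  using assms(1-4,7-9)
proof (induction p arbitrary: A B \<alpha> C R)
  case 0
  note fin = 0(1,2)
  obtain p q where pq: "p \<in> A" "q \<in> B" using 0 by (metis card.empty ex_in_conv less_irrefl)
  define a b where "a = card A" and "b = card B"
  have ab: "a \<ge> 1" "b \<ge> 1" using 0 by (auto simp: a_def b_def)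
  define \<alpha>' where "\<alpha>' = \<alpha> * (1 + 2 * real a)"
  have \<alpha>': "\<alpha>' > 0" using 0 by (simp add: \<alpha>'_def add_pos_nonneg)
  \<comment> \<open>The value of \<open>2 C \<rho> r^2\<close> for the block radius r chosen
    below.\<close>
  define D where "D = 2 * C * R\<^sup>2 / 4"
  define \<kappa>1 where "\<kappa>1 = (pi / (\<alpha>' + D * real (a - 1) * real (b - 1))) ^ (a - 1)"
  have \<kappa>1: "\<kappa>1 > 0" using \<alpha>' 0 by (auto simp: \<kappa>1_def D_def intro!: divide_pos_pos add_pos_nonneg zero_less_power)
  define \<kappa>2 where "\<kappa>2 = pi / (2 * \<alpha> + 2 * real b * C * R\<^sup>2) * \<kappa>1"
  have \<kappa>2: "\<kappa>2 > 0" using \<kappa>1 0 by (auto simp: \<kappa>2_def intro!: divide_pos_pos mult_pos_pos add_pos_nonneg)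
  define \<kappa>3 where "\<kappa>3 = 3/4 * disc_vol * R\<^sup>2 * ((R/2)\<^sup>2 * disc_vol) ^ (a + b - 2) * ((R/2)\<^sup>2 * disc_vol) ^ ((a - 1) * (b - 1))"
  have \<kappa>3: "\<kappa>3 > 0" using 0 disc_vol_pos by (auto simp: \<kappa>3_def)
  \<comment> \<open>A single constant serves as factor of the threshold and as factor of the volume;
    lowering it weakens both claims.\<close>
  define \<kappa> where "\<kappa> = min \<kappa>2 \<kappa>3"
  have \<kappa>: "\<kappa> > 0" "\<kappa> \<le> \<kappa>2" "\<kappa> \<le> \<kappa>3" using \<kappa>2 \<kappa>3 by (auto simp: \<kappa>_def)
  have "ennreal (\<kappa> * \<rho> powr (- ((1 - \<theta>) * (real a + real b - 2 * real 0 - 1) + (real a - real 0 - 1) * (real b - real 0 - 1))))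
     \<le> (\<integral>\<^sup>+f. indicator (big_Phi_set A B R \<alpha> (C * \<rho>) (ennreal (\<kappa> * \<rho> powr (- (real 0 + \<theta>))))) f \<partial>Pi_lborel (A \<times> B))" if \<rho>: "1 \<le> \<rho>" for \<rho>
  proof -
    define G where "G = R * \<rho> powr (- ((1 - \<theta>) / 2))"
    have "\<rho> powr (- ((1 - \<theta>) / 2)) \<le> 1" using \<rho> \<theta> powr_mono[of "- ((1 - \<theta>) / 2)" 0 \<rho>] by simp
    then have G: "0 < G" "G \<le> R" using \<rho> 0 by (auto simp: G_def mult_le_cancel_left1)
    have G2: "G\<^sup>2 = R\<^sup>2 * \<rho> powr (- (1 - \<theta>))"
      using \<rho> by (simp add: G_def power_mult_distrib power2_eq_square powr_add[symmetric])
    define r where "r = R/2 * \<rho> powr (- (1/2))"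
    have "\<rho> powr (- (1/2)) \<le> 1" using \<rho> powr_mono[of "- (1 / 2)" 0 \<rho>] by simp
    then have r: "0 < r" "r \<le> R/2" using \<rho> 0 by (auto simp: r_def mult_le_cancel_left1)
    have r2: "r\<^sup>2 = (R/2)\<^sup>2 * \<rho> powr (-1)"
    proof -
      have "\<rho> powr (- (1/2)) * \<rho> powr (- (1/2)) = \<rho> powr (-1)" by (simp only: powr_add[symmetric]) simp
      then have "(\<rho> powr (- (1/2)))\<^sup>2 = \<rho> powr (-1)" by (simp only: power2_eq_square)
      then show ?thesis by (simp only: r_def power_mult_distrib)
    qed
    let ?A = "A - {p}" and ?B = "B - {q}"
    have cards: "card ?A = a - 1" "card ?B = b - 1" using fin pq by (auto simp: a_def b_def)
    have sub: "polydisc (?A \<times> ?B) r \<subseteq> big_Phi_set ?A ?B (R/2) \<alpha>' (2 * (C * \<rho>)) (ennreal \<kappa>1)"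
    proof
      fix f assume f: "f \<in> polydisc (?A \<times> ?B) r"
      have "2 * (C * \<rho>) * r\<^sup>2 = 2 * C * (R/2)\<^sup>2 * (\<rho> * \<rho> powr (-1))" by (simp only: r2 mult_ac)
      also have "\<rho> * \<rho> powr (-1) = 1" using \<rho> by (simp add: powr_minus)
      also have "2 * C * (R/2)\<^sup>2 * 1 = D" by (simp add: D_def power2_eq_square)
      finally have "2 * (C * \<rho>) * r\<^sup>2 \<le> D" by (rule eq_refl)
      then have "ennreal ((pi / (\<alpha>' + D * real (card ?A) * real (card ?B))) ^ card ?A) \<le> Phi ?A ?B \<alpha>' (2 * (C * \<rho>)) f"
        using fin f r \<alpha>' 0 \<rho> by (intro Phi_lower_small) auto
      then show "f \<in> big_Phi_set ?A ?B (R/2) \<alpha>' (2 * (C * \<rho>)) (ennreal \<kappa>1)"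
        using f order_trans[OF _ r(2)] unfolding big_Phi_set_def polydisc_def \<kappa>1_def cards by blast
    qed
    have "ennreal ((r\<^sup>2 * disc_vol) ^ ((a - 1) * (b - 1))) = (\<integral>\<^sup>+y. indicator (polydisc (?A \<times> ?B) r) y \<partial>Pi_lborel (?A \<times> ?B))"
      using fin r by (subst emeasure_polydisc) (auto simp: cards)
    also have "\<dots> \<le> (\<integral>\<^sup>+y. indicator (big_Phi_set ?A ?B (R/2) \<alpha>' (2 * (C * \<rho>)) (ennreal \<kappa>1)) y \<partial>Pi_lborel (?A \<times> ?B))"
      using sub by (intro nn_integral_mono) (auto simp: indicator_def)
    finally have vol: "ennreal ((r\<^sup>2 * disc_vol) ^ ((a - 1) * (b - 1))) \<le> \<dots>" .
    have "ennreal (3/4 * disc_vol * G\<^sup>2 * ((G/2)\<^sup>2 * disc_vol) ^ (a + b - 2)) * ennreal ((r\<^sup>2 * disc_vol) ^ ((a - 1) * (b - 1)))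
      \<le> ennreal (3/4 * disc_vol * G\<^sup>2 * ((G/2)\<^sup>2 * disc_vol) ^ (a + b - 2)) * (\<integral>\<^sup>+y. indicator (big_Phi_set ?A ?B (R/2) \<alpha>' (2 * (C * \<rho>)) (ennreal \<kappa>1)) y \<partial>Pi_lborel (?A \<times> ?B))"
      by (intro mult_left_mono vol) simp
    also have "\<dots> \<le> (\<integral>\<^sup>+f. indicator (big_Phi_set A B R \<alpha> (C * \<rho>) (ennreal (pi / (2 * \<alpha> + 2 * real b * (C * \<rho>) * G\<^sup>2)) * ennreal \<kappa>1)) f \<partial>Pi_lborel (A \<times> B))"
      unfolding \<alpha>'_def a_def b_def using 0 \<rho> by (intro big_Phi_set_pivot fin pq G) auto
    also have "\<dots> \<le> (\<integral>\<^sup>+f. indicator (big_Phi_set A B R \<alpha> (C * \<rho>) (ennreal (\<kappa> * \<rho> powr (- (real 0 + \<theta>))))) f \<partial>Pi_lborel (A \<times> B))"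
    proof (rule big_Phi_set_volume_antimono)
      have r\<theta>: "\<rho> * \<rho> powr (- (1 - \<theta>)) = \<rho> powr \<theta>" using \<rho> powr_add[of \<rho> 1 "- (1 - \<theta>)"] by simp
      have "1 \<le> \<rho> powr \<theta>" using \<rho> \<theta> by (simp add: ge_one_powr_ge_zero)
      then have e2: "2 * \<alpha> * 1 \<le> 2 * \<alpha> * \<rho> powr \<theta>" using 0 by (intro mult_left_mono) auto
      have e1: "2 * real b * (C * \<rho>) * G\<^sup>2 = 2 * real b * C * R\<^sup>2 * (\<rho> * \<rho> powr (- (1 - \<theta>)))"
        by (simp only: G2 mult_ac)
      have "2 * \<alpha> + 2 * real b * (C * \<rho>) * G\<^sup>2 \<le> (2 * \<alpha> + 2 * real b * C * R\<^sup>2) * \<rho> powr \<theta>"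
        unfolding e1 r\<theta> distrib_right using e2 by linarith
      then have "pi / ((2 * \<alpha> + 2 * real b * C * R\<^sup>2) * \<rho> powr \<theta>) \<le> pi / (2 * \<alpha> + 2 * real b * (C * \<rho>) * G\<^sup>2)"
        using 0 \<rho> by (intro divide_left_mono) (auto intro!: mult_pos_pos add_pos_nonneg)
      then have "pi / ((2 * \<alpha> + 2 * real b * C * R\<^sup>2) * \<rho> powr \<theta>) * \<kappa>1 \<le> pi / (2 * \<alpha> + 2 * real b * (C * \<rho>) * G\<^sup>2) * \<kappa>1"
        using \<kappa>1 by (intro mult_right_mono) auto
      moreover have "\<kappa> * \<rho> powr (- (real 0 + \<theta>)) \<le> \<kappa>2 * \<rho> powr (- \<theta>)" using \<kappa> by (simp add: mult_right_mono)
      moreover have "\<kappa>2 * \<rho> powr (- \<theta>) = pi / ((2 * \<alpha> + 2 * real b * C * R\<^sup>2) * \<rho> powr \<theta>) * \<kappa>1"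
        by (simp add: \<kappa>2_def powr_minus divide_inverse mult_ac)
      ultimately have "\<kappa> * \<rho> powr (- (real 0 + \<theta>)) \<le> pi / (2 * \<alpha> + 2 * real b * (C * \<rho>) * G\<^sup>2) * \<kappa>1" by linarith
      then show "ennreal (\<kappa> * \<rho> powr (- (real 0 + \<theta>))) \<le> ennreal (pi / (2 * \<alpha> + 2 * real b * (C * \<rho>) * G\<^sup>2)) * ennreal \<kappa>1"
        using \<kappa>1 by (subst ennreal_mult''[symmetric]) (auto intro: ennreal_leI)
    qed
    finally have main: "ennreal (3/4 * disc_vol * G\<^sup>2 * ((G/2)\<^sup>2 * disc_vol) ^ (a + b - 2)) * ennreal ((r\<^sup>2 * disc_vol) ^ ((a - 1) * (b - 1)))
      \<le> (\<integral>\<^sup>+f. indicator (big_Phi_set A B R \<alpha> (C * \<rho>) (ennreal (\<kappa> * \<rho> powr (- (real 0 + \<theta>))))) f \<partial>Pi_lborel (A \<times> B))" .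
    define E where "E = \<rho> powr (- ((1 - \<theta>) * (real a + real b - 1) + (real a - 1) * (real b - 1)))"
    have "3/4 * disc_vol * G\<^sup>2 * ((G/2)\<^sup>2 * disc_vol) ^ (a + b - 2) * (r\<^sup>2 * disc_vol) ^ ((a - 1) * (b - 1)) = \<kappa>3 * E"
    proof -
      define x where "x = \<rho> powr (- (1 - \<theta>))"
      have "x * x ^ (a + b - 2) = x ^ (a + b - 1)" using ab by (metis (no_types, lifting) Suc_diff_Suc add_gr_0 diff_Suc_1 le_simps(3) numeral_2_eq_2 power_Suc zero_less_one_class.zero_less_one Suc_1 Suc_le_lessD add_mono one_add_one)
      also have "\<dots> = x powr real (a + b - 1)" using \<rho> by (simp add: powr_realpow x_def)
      also have "\<dots> = \<rho> powr (- ((1 - \<theta>) * (real a + real b - 1)))"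
      proof -
        have "- (1 - \<theta>) * real (a + b - 1) = - ((1 - \<theta>) * (real a + real b - 1))"
          using ab by (simp add: of_nat_diff algebra_simps)
        then show ?thesis by (simp only: x_def powr_powr)
      qed
      finally have 1: "x * x ^ (a + b - 2) = \<rho> powr (- ((1 - \<theta>) * (real a + real b - 1)))" .
      have 2: "(\<rho> powr (-1)) ^ ((a - 1) * (b - 1)) = \<rho> powr (- ((real a - 1) * (real b - 1)))"
      proof -
        have "(\<rho> powr (-1)) ^ ((a - 1) * (b - 1)) = (\<rho> powr (-1)) powr real ((a - 1) * (b - 1))"
          using \<rho> by (intro powr_realpow[symmetric]) simp
        moreover have "-1 * real ((a - 1) * (b - 1)) = - ((real a - 1) * (real b - 1))" using ab by (simp add: of_nat_diff)
        ultimately show ?thesis by (simp only: powr_powr)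
      qed
      have 3: "E = \<rho> powr (- ((1 - \<theta>) * (real a + real b - 1))) * \<rho> powr (- ((real a - 1) * (real b - 1)))"
        unfolding E_def powr_add[symmetric] by simp
      have 4: "(G/2)\<^sup>2 = (R/2)\<^sup>2 * x" by (simp add: power_divide G2 x_def)
      show ?thesis unfolding 3 1[symmetric] 2[symmetric] \<kappa>3_def 4 r2 unfolding G2 x_def[symmetric]
        by (simp only: power_mult_distrib mult_ac)
    qed
    moreover have "ennreal (3/4 * disc_vol * G\<^sup>2 * ((G/2)\<^sup>2 * disc_vol) ^ (a + b - 2)) * ennreal ((r\<^sup>2 * disc_vol) ^ ((a - 1) * (b - 1)))
       = ennreal (3/4 * disc_vol * G\<^sup>2 * ((G/2)\<^sup>2 * disc_vol) ^ (a + b - 2) * (r\<^sup>2 * disc_vol) ^ ((a - 1) * (b - 1)))"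
      by (rule ennreal_mult''[symmetric]) simp
    moreover have "ennreal (\<kappa> * E) \<le> ennreal (\<kappa>3 * E)" using \<kappa> by (intro ennreal_leI mult_right_mono) (auto simp: E_def)
    ultimately have "ennreal (\<kappa> * E) \<le> (\<integral>\<^sup>+f. indicator (big_Phi_set A B R \<alpha> (C * \<rho>) (ennreal (\<kappa> * \<rho> powr (- (real 0 + \<theta>))))) f \<partial>Pi_lborel (A \<times> B))"
      using main by (simp only:)
    then show ?thesis by (simp add: E_def)
  qed
  then show ?case using \<kappa>(1) unfolding a_def b_def by blast
next
  case (Suc n)
  note fin = Suc.prems(1,2)
  obtain p q where pq: "p \<in> A" "q \<in> B" using Suc.prems by (metis card.empty ex_in_conv not_less_zero)
  define a b where "a = card A" and "b = card B"
  let ?A = "A - {p}" and ?B = "B - {q}"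
  have cards: "card ?A = a - 1" "card ?B = b - 1" using fin pq by (auto simp: a_def b_def)
  have ab: "a \<ge> 1" "b \<ge> 1" using Suc.prems by (auto simp: a_def b_def)
  have cr: "real (a - 1) = real a - 1" "real (b - 1) = real b - 1" using ab by auto
  define \<alpha>' where "\<alpha>' = \<alpha> * (1 + 2 * real a)"
  have "\<alpha>' > 0" "2 * C > 0" "R/2 > 0" using Suc.prems by (auto simp: \<alpha>'_def add_pos_nonneg)
  then have "\<exists>\<kappa>>0. \<forall>\<rho>\<ge>1. ennreal (\<kappa> * \<rho> powr (- ((1 - \<theta>) * (real (card ?A) + real (card ?B) - 2 * real n - 1)
        + (real (card ?A) - real n - 1) * (real (card ?B) - real n - 1))))
     \<le> (\<integral>\<^sup>+f. indicator (big_Phi_set ?A ?B (R/2) \<alpha>' (2 * C * \<rho>) (ennreal (\<kappa> * \<rho> powr (- (real n + \<theta>))))) f \<partial>Pi_lborel (?A \<times> ?B))"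
    using Suc.prems(3,4) cards by (intro Suc.IH finite_Diff fin) (auto simp: a_def b_def)
  then obtain \<kappa>1 where \<kappa>1: "\<kappa>1 > 0" and IH: "\<And>\<rho>. 1 \<le> \<rho> \<Longrightarrow> ennreal (\<kappa>1 * \<rho> powr (- ((1 - \<theta>) * (real (card ?A) + real (card ?B) - 2 * real n - 1)
        + (real (card ?A) - real n - 1) * (real (card ?B) - real n - 1))))
     \<le> (\<integral>\<^sup>+f. indicator (big_Phi_set ?A ?B (R/2) \<alpha>' (2 * C * \<rho>) (ennreal (\<kappa>1 * \<rho> powr (- (real n + \<theta>))))) f \<partial>Pi_lborel (?A \<times> ?B))"
    by blast
  define \<kappa>2 where "\<kappa>2 = pi / (2 * \<alpha> + 2 * real b * C * R\<^sup>2) * \<kappa>1"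
  have \<kappa>2: "\<kappa>2 > 0" using \<kappa>1 Suc.prems by (auto simp: \<kappa>2_def intro!: divide_pos_pos mult_pos_pos add_pos_nonneg)
  define W where "W = 3/4 * disc_vol * R\<^sup>2 * ((R/2)\<^sup>2 * disc_vol) ^ (a + b - 2)"
  have W: "W > 0" using Suc.prems disc_vol_pos by (auto simp: W_def)
  define \<kappa> where "\<kappa> = min \<kappa>2 (W * \<kappa>1)"
  have \<kappa>: "\<kappa> > 0" "\<kappa> \<le> \<kappa>2" "\<kappa> \<le> W * \<kappa>1" using \<kappa>2 W \<kappa>1 by (auto simp: \<kappa>_def)
  have "ennreal (\<kappa> * \<rho> powr (- ((1 - \<theta>) * (real a + real b - 2 * real (Suc n) - 1)
        + (real a - real (Suc n) - 1) * (real b - real (Suc n) - 1))))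
     \<le> (\<integral>\<^sup>+f. indicator (big_Phi_set A B R \<alpha> (C * \<rho>) (ennreal (\<kappa> * \<rho> powr (- (real (Suc n) + \<theta>))))) f \<partial>Pi_lborel (A \<times> B))" if \<rho>: "1 \<le> \<rho>" for \<rho>
  proof -
    define E where "E = \<rho> powr (- ((1 - \<theta>) * (real a + real b - 2 * real (Suc n) - 1)
        + (real a - real (Suc n) - 1) * (real b - real (Suc n) - 1)))"
    have E: "E = \<rho> powr (- ((1 - \<theta>) * (real (card ?A) + real (card ?B) - 2 * real n - 1)
        + (real (card ?A) - real n - 1) * (real (card ?B) - real n - 1)))"
      unfolding E_def cards cr by (simp add: algebra_simps)
    have "ennreal (\<kappa> * E) \<le> ennreal (W * \<kappa>1 * E)" using \<kappa> by (intro ennreal_leI mult_right_mono) (auto simp: E_def)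
    also have "\<dots> = ennreal W * ennreal (\<kappa>1 * E)" using \<kappa>1 by (subst ennreal_mult''[symmetric]) (auto simp: E_def mult_ac)
    also have "\<dots> \<le> ennreal W * (\<integral>\<^sup>+f. indicator (big_Phi_set ?A ?B (R/2) \<alpha>' (2 * C * \<rho>) (ennreal (\<kappa>1 * \<rho> powr (- (real n + \<theta>))))) f \<partial>Pi_lborel (?A \<times> ?B))"
      unfolding E by (intro mult_left_mono IH \<rho>) simp
    also have "\<dots> = ennreal W * (\<integral>\<^sup>+f. indicator (big_Phi_set ?A ?B (R/2) \<alpha>' (2 * (C * \<rho>)) (ennreal (\<kappa>1 * \<rho> powr (- (real n + \<theta>))))) f \<partial>Pi_lborel (?A \<times> ?B))"
      by (simp only: mult.assoc)
    also have "\<dots> \<le> (\<integral>\<^sup>+f. indicator (big_Phi_set A B R \<alpha> (C * \<rho>) (ennreal (pi / (2 * \<alpha> + 2 * real b * (C * \<rho>) * R\<^sup>2)) * ennreal (\<kappa>1 * \<rho> powr (- (real n + \<theta>))))) f \<partial>Pi_lborel (A \<times> B))"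
      unfolding \<alpha>'_def a_def b_def W_def using Suc.prems \<rho> by (intro big_Phi_set_pivot fin pq) auto
    also have "\<dots> \<le> (\<integral>\<^sup>+f. indicator (big_Phi_set A B R \<alpha> (C * \<rho>) (ennreal (\<kappa> * \<rho> powr (- (real (Suc n) + \<theta>))))) f \<partial>Pi_lborel (A \<times> B))"
    proof (rule big_Phi_set_volume_antimono)
      have "2 * \<alpha> + 2 * real b * (C * \<rho>) * R\<^sup>2 \<le> (2 * \<alpha> + 2 * real b * C * R\<^sup>2) * \<rho>"
      proof -
        have "2 * \<alpha> * 1 \<le> 2 * \<alpha> * \<rho>" using \<rho> Suc.prems by (intro mult_left_mono) auto
        moreover have "2 * real b * (C * \<rho>) * R\<^sup>2 = 2 * real b * C * R\<^sup>2 * \<rho>" by (simp only: mult_ac)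
        ultimately show ?thesis unfolding distrib_right by linarith
      qed
      then have "pi / ((2 * \<alpha> + 2 * real b * C * R\<^sup>2) * \<rho>) \<le> pi / (2 * \<alpha> + 2 * real b * (C * \<rho>) * R\<^sup>2)"
        using Suc.prems \<rho> by (intro divide_left_mono) (auto intro!: mult_pos_pos add_pos_nonneg)
      then have "pi / ((2 * \<alpha> + 2 * real b * C * R\<^sup>2) * \<rho>) * (\<kappa>1 * \<rho> powr (- (real n + \<theta>))) \<le> pi / (2 * \<alpha> + 2 * real b * (C * \<rho>) * R\<^sup>2) * (\<kappa>1 * \<rho> powr (- (real n + \<theta>)))"
        using \<kappa>1 by (intro mult_right_mono) auto
      moreover have "\<kappa> * \<rho> powr (- (real (Suc n) + \<theta>)) \<le> \<kappa>2 * \<rho> powr (- (real (Suc n) + \<theta>))" using \<kappa> by (simp add: mult_right_mono)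
      moreover have "\<kappa>2 * \<rho> powr (- (real (Suc n) + \<theta>)) = pi / ((2 * \<alpha> + 2 * real b * C * R\<^sup>2) * \<rho>) * (\<kappa>1 * \<rho> powr (- (real n + \<theta>)))"
      proof -
        have "- (real (Suc n) + \<theta>) = - (real n + \<theta>) + (-1)" by simp
        then have "\<rho> powr (- (real (Suc n) + \<theta>)) = \<rho> powr (- (real n + \<theta>)) * inverse \<rho>"
          using \<rho> by (simp only: powr_add) (simp add: powr_minus)
        then show ?thesis by (simp add: \<kappa>2_def divide_inverse mult_ac)
      qed
      ultimately have "\<kappa> * \<rho> powr (- (real (Suc n) + \<theta>)) \<le> pi / (2 * \<alpha> + 2 * real b * (C * \<rho>) * R\<^sup>2) * (\<kappa>1 * \<rho> powr (- (real n + \<theta>)))" by linarith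
      then show "ennreal (\<kappa> * \<rho> powr (- (real (Suc n) + \<theta>))) \<le> ennreal (pi / (2 * \<alpha> + 2 * real b * (C * \<rho>) * R\<^sup>2)) * ennreal (\<kappa>1 * \<rho> powr (- (real n + \<theta>)))"
        using \<kappa>1 by (subst ennreal_mult''[symmetric]) (auto intro: ennreal_leI)
    qed
    finally show ?thesis unfolding E_def .
  qed
  then show ?case using \<kappa>(1) unfolding a_def b_def by blast
qed

section \<open>Gaussian integrals and determinants\<close>

text \<open>The conjugate sits on the column index, so that \<open>H H*\<close> gives the sum of the
  squared moduli of the entries of k H, as in \<open>Phi\<close>.\<close>

definition qform :: "complex^'n^'n \<Rightarrow> ('n::finite \<Rightarrow> complex) \<Rightarrow> complex" where
  "qform M k = (\<Sum>i\<in>UNIV. \<Sum>j\<in>UNIV. k i * cnj (k j) * M $ i $ j)"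

definition herm_pd :: "complex^'n^'n::finite \<Rightarrow> bool" where
  "herm_pd M \<longleftrightarrow> (\<forall>i j. M $ j $ i = cnj (M $ i $ j)) \<and> (\<forall>k. (\<exists>i. k i \<noteq> 0) \<longrightarrow> 0 < Re (qform M k))"

text \<open>Row and column x become those of the identity instead of disappearing, because the
  dimension of a matrix is part of its type.\<close>

definition eliminate :: "'n::finite \<Rightarrow> complex^'n^'n \<Rightarrow> complex^'n^'n" where
  "eliminate x M = (\<chi> i j. if i = x \<or> j = x then (if i = j then 1 else 0) else M $ i $ j - M $ i $ x * M $ x $ j / M $ x $ x)"

lemma herm_pd_diag:
  assumes "herm_pd M"
  shows "M $ x $ x = complex_of_real (Re (M $ x $ x))" "0 < Re (M $ x $ x)"
proof -
  have "M $ x $ x = cnj (M $ x $ x)" using assms unfolding herm_pd_def by blast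
  from arg_cong[OF this, of Im] have "Im (M $ x $ x) = 0" by simp
  then show "M $ x $ x = complex_of_real (Re (M $ x $ x))" by (simp add: complex_eq_iff)
  define e where "e = (\<lambda>i. if i = x then 1 else (0::complex))"
  have "(\<Sum>j\<in>UNIV. e i * cnj (e j) * M $ i $ j) = (\<Sum>j\<in>UNIV. if j = x then e i * M $ i $ x else 0)" for i
    by (intro sum.cong refl) (simp add: e_def)
  then have "qform M e = (\<Sum>i\<in>UNIV. if i = x then M $ x $ x else 0)"
    unfolding qform_def by (intro sum.cong refl) (simp add: e_def)
  then have "qform M e = M $ x $ x" by simp
  moreover have "\<exists>i. e i \<noteq> 0" by (auto simp: e_def)
  ultimately show "0 < Re (M $ x $ x)" using assms unfolding herm_pd_def by metis
qed

text \<open>Completion of the square in \<open>k x\<close>; the two cross terms are conjugate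
  because M is Hermitian.\<close>

lemma qform_elim:
  fixes M :: "complex^'n::finite^'n" and x :: 'n
  assumes "herm_pd M"
  defines "d \<equiv> Re (M $ x $ x)"
  shows "Re (qform M k) = d * (norm (k x + (\<Sum>i\<in>UNIV - {x}. k i * M $ i $ x) / of_real d))\<^sup>2
     + Re (qform (eliminate x M) (k(x := 0)))"
proof -
  define w where "w = (\<Sum>i\<in>UNIV - {x}. k i * M $ i $ x)"
  have d: "M $ x $ x = of_real d" "d > 0" using herm_pd_diag[OF assms(1), of x] by (auto simp: d_def)
  have cw: "cnj w = (\<Sum>j\<in>UNIV - {x}. cnj (k j) * M $ x $ j)"
    unfolding w_def cnj_sum complex_cnj_mult using assms(1) unfolding herm_pd_def by (intro sum.cong refl) metis
  define R where "R = (\<Sum>i\<in>UNIV - {x}. \<Sum>j\<in>UNIV - {x}. k i * cnj (k j) * M $ i $ j)"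
  have U: "(\<Sum>i\<in>UNIV. g i) = g x + (\<Sum>i\<in>UNIV - {x}. g i)" for g :: "'n \<Rightarrow> complex"
    by (rule sum.remove) auto
  have q1: "qform M k = k x * cnj (k x) * of_real d + k x * cnj w + cnj (k x) * w + R"
    unfolding qform_def U cw R_def
    by (simp add: d sum.distrib sum_distrib_left w_def mult_ac)
  have q2: "qform (eliminate x M) (k(x := 0)) = R - w * cnj w / of_real d"
  proof -
    have "qform (eliminate x M) (k(x := 0)) = (\<Sum>i\<in>UNIV - {x}. \<Sum>j\<in>UNIV - {x}. k i * cnj (k j) * (M $ i $ j - M $ i $ x * M $ x $ j / of_real d))"
      unfolding qform_def U by (simp add: eliminate_def d)
    also have "\<dots> = R - (\<Sum>i\<in>UNIV - {x}. \<Sum>j\<in>UNIV - {x}. (k i * M $ i $ x) * (cnj (k j) * M $ x $ j) / of_real d)"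
      unfolding R_def by (simp add: right_diff_distrib sum_subtractf mult_ac)
    also have "(\<Sum>i\<in>UNIV - {x}. \<Sum>j\<in>UNIV - {x}. (k i * M $ i $ x) * (cnj (k j) * M $ x $ j) / of_real d) = w * cnj w / of_real d"
      unfolding cw unfolding w_def sum_product sum_divide_distrib ..
    finally show ?thesis .
  qed
  have "of_real (d * (norm (k x + w / of_real d))\<^sup>2) = of_real d * ((k x + w / of_real d) * cnj (k x + w / of_real d))"
    by (simp only: of_real_mult complex_norm_square)
  also have "\<dots> = k x * cnj (k x) * of_real d + k x * cnj w + cnj (k x) * w + w * cnj w / of_real d"
    using d by (simp add: field_simps)
  finally have "qform M k = of_real (d * (norm (k x + w / of_real d))\<^sup>2) + qform (eliminate x M) (k(x := 0))"
    unfolding q1 q2 by simp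
  then show ?thesis unfolding w_def by simp
qed

lemma qform_elim_split:
  "qform (eliminate x M) k = of_real ((norm (k x))\<^sup>2) + qform (eliminate x M) (k(x := 0))"
proof -
  have U: "(\<Sum>i\<in>UNIV. g i) = g x + (\<Sum>i\<in>UNIV - {x}. g i)" for g :: "'a \<Rightarrow> complex"
    by (rule sum.remove) auto
  have z: "(\<Sum>j\<in>UNIV - {x}. k x * cnj (k j) * (if x = j then 1 else 0)) = 0"
    by (intro sum.neutral) auto
  show ?thesis
    unfolding qform_def U by (simp add: eliminate_def complex_norm_square z del: of_real_power)
qed

text \<open>Choosing the coordinate x so that the completed square vanishes makes the eliminated
  form, off x, a value of the form of M. If the vector so modified is zero, then k is supported at
  x, where the eliminated form is \<open>|k x|^2\<close>.\<close>

lemma herm_pd_elim: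
  fixes M :: "complex^'n::finite^'n"
  assumes "herm_pd M"
  shows "herm_pd (eliminate x M)"
  unfolding herm_pd_def
proof (intro conjI allI impI)
  fix i j
  have h: "M $ j $ i = cnj (M $ i $ j)" for i j using assms unfolding herm_pd_def by blast
  show "eliminate x M $ j $ i = cnj (eliminate x M $ i $ j)"
    by (auto simp: eliminate_def h[symmetric] mult.commute)
next
  fix k :: "'n \<Rightarrow> complex" assume k: "\<exists>i. k i \<noteq> 0"
  define d where "d = Re (M $ x $ x)"
  have d: "d > 0" using herm_pd_diag[OF assms] by (simp add: d_def)
  define k' where "k' = k(x := - (\<Sum>i\<in>UNIV - {x}. k i * M $ i $ x) / of_real d)"
  have k'0: "k'(x := 0) = k(x := 0)" by (simp add: k'_def)
  have "(\<Sum>i\<in>UNIV - {x}. k' i * M $ i $ x) = (\<Sum>i\<in>UNIV - {x}. k i * M $ i $ x)"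
    by (intro sum.cong) (auto simp: k'_def)
  then have e: "Re (qform M k') = Re (qform (eliminate x M) (k(x := 0)))"
    using qform_elim[OF assms, of k' x] unfolding d_def[symmetric] k'0 by (simp add: k'_def)
  show "0 < Re (qform (eliminate x M) k)"
  proof (cases "\<exists>i. k' i \<noteq> 0")
    case True
    then have "0 < Re (qform M k')" using assms by (simp add: herm_pd_def)
    then show ?thesis unfolding qform_elim_split[of x M k] using e by (simp add: add_nonneg_pos)
  next
    case False
    then have k0: "k i = 0" if "i \<noteq> x" for i using that by (auto simp: k'_def split: if_splits)
    then have "k x \<noteq> 0" using k by metis
    moreover have "k(x := 0) = (\<lambda>_. 0)" using k0 by auto
    ultimately show ?thesis unfolding qform_elim_split[of x M k] by (simp add: qform_def)
  qed
qed

text \<open>The transpose differs from the identity by adding to row x a combination of the other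
  rows.\<close>

lemma det_unit_column:
  fixes c :: "'n::finite \<Rightarrow> complex"
  shows "det (\<chi> i j. if j = x then (if i = x then 1 else c i) else if i = j then 1 else 0) = 1"
proof -
  define I where "I = (mat 1 :: complex^'n^'n)"
  define v where "v = (\<Sum>j\<in>UNIV - {x}. c j *s row j I)"
  have "v \<in> vec.span {row j I |j. j \<noteq> x}"
    unfolding v_def by (intro vec.span_sum vec.span_scale vec.span_base) auto
  from det_row_span[OF this] have "det (\<chi> k. if k = x then row x I + v else row k I) = det I" .
  also have "det I = 1" by (simp add: I_def)
  finally have "det (\<chi> k. if k = x then row x I + v else row k I) = 1" .
  moreover have "(\<chi> k. if k = x then row x I + v else row k I) =
     transpose (\<chi> i j. if j = x then (if i = x then 1 else c i) else if i = j then 1 else 0)"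
  proof -
    have "v $ i = (if i = x then 0 else c i)" for i
    proof -
      have "v $ i = (\<Sum>j\<in>UNIV - {x}. if j = i then c j else 0)"
        unfolding v_def sum_component by (intro sum.cong) (auto simp: row_def I_def mat_def)
      then show ?thesis by simp
    qed
    then show ?thesis by (auto simp: vec_eq_iff transpose_def row_def I_def mat_def)
  qed
  ultimately show ?thesis by (simp only: det_transpose)
qed

text \<open>A factorisation with one pivot: \<open>M = L D L2^T\<close>, where L and L2 have
  determinant 1 and D is the eliminated matrix with row x scaled by the pivot.\<close>

lemma det_elim:
  fixes M :: "complex^'n::finite^'n"
  assumes m: "M $ x $ x \<noteq> 0"
  shows "det M = M $ x $ x * det (eliminate x M)"
proof -
  define L :: "complex^'n^'n" where "L = (\<chi> i j. if j = x then (if i = x then 1 else M $ i $ x / M $ x $ x) else if i = j then 1 else 0)"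
  define L2 :: "complex^'n^'n" where "L2 = (\<chi> i j. if j = x then (if i = x then 1 else M $ x $ i / M $ x $ x) else if i = j then 1 else 0)"
  define D :: "complex^'n^'n" where "D = (\<chi> i. if i = x then M $ x $ x *s (eliminate x M $ x) else eliminate x M $ i)"
  have U: "(\<Sum>k\<in>UNIV. g k) = g x + (\<Sum>k\<in>UNIV - {x}. g k)" for g :: "'n \<Rightarrow> complex"
    by (rule sum.remove) auto
  have D: "D $ i $ j = (if i = x \<or> j = x then (if i = j then M $ x $ x else 0) else M $ i $ j - M $ i $ x * M $ x $ j / M $ x $ x)" for i j
    by (auto simp: D_def eliminate_def)
  have LD: "(L ** D) $ i $ j = (if i = x then (if j = x then M $ x $ x else 0) else if j = x then M $ i $ x else D $ i $ j)" for i j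
  proof -
    have "(L ** D) $ i $ j = L $ i $ x * D $ x $ j + (\<Sum>k\<in>UNIV - {x}. if k = i then D $ i $ j else 0)"
      unfolding matrix_matrix_mult_def vec_lambda_beta U
      by (intro arg_cong2[where f="(+)"] refl sum.cong) (auto simp: L_def)
    then show ?thesis using m by (auto simp: D L_def)
  qed
  have "(L ** D ** transpose L2) $ i $ j = M $ i $ j" for i j
  proof -
    have "(L ** D ** transpose L2) $ i $ j = (L ** D) $ i $ x * L2 $ j $ x + (\<Sum>k\<in>UNIV - {x}. if k = j then (L ** D) $ i $ j else 0)"
      unfolding matrix_matrix_mult_def[of "L ** D"] vec_lambda_beta U transpose_def
      by (intro arg_cong2[where f="(+)"] refl sum.cong) (auto simp: L2_def)
    then show ?thesis using m by (auto simp: LD D L2_def)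
  qed
  then have "M = L ** D ** transpose L2" by (simp add: vec_eq_iff)
  then have "det M = det L * det D * det L2" by (simp add: det_mul det_transpose)
  moreover have "det L = 1" "det L2 = 1" unfolding L_def L2_def by (rule det_unit_column)+
  moreover have "det D = M $ x $ x * det (eliminate x M)"
    unfolding D_def det_row_mul by (intro arg_cong[where f="\<lambda>z. _ * det z"]) (simp add: vec_eq_iff)
  ultimately show ?thesis by simp
qed

lemma qform_measurable:
  "(\<lambda>k. ennreal (exp (- Re (qform M k)))) \<in> borel_measurable (Pi_lborel (UNIV :: 'n::finite set))"
proof -
  have c: "(\<lambda>f. f y) \<in> borel_measurable (Pi_lborel (UNIV :: 'n set))" for y
    by (rule Pi_lborel_component[OF measurable_ident_sets[OF refl]]) simp
  have cc: "(\<lambda>f. cnj (f y)) \<in> borel_measurable (Pi_lborel (UNIV :: 'n set))" for y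
    by (rule measurable_compose[OF c borel_measurable_continuous_onI]) (intro continuous_intros)
  have "(\<lambda>k. qform M k) \<in> borel_measurable (Pi_lborel (UNIV :: 'n set))"
    unfolding qform_def by (intro borel_measurable_sum borel_measurable_times c cc borel_measurable_const)
  then have "(\<lambda>k. - Re (qform M k)) \<in> borel_measurable (Pi_lborel (UNIV :: 'n set))"
    by (intro borel_measurable_uminus measurable_compose[OF _ borel_measurable_Re])
  then show ?thesis
    by (intro measurable_compose[OF _ measurable_ennreal] measurable_compose[OF _ borel_measurable_exp])
qed

text \<open>S contains the indices still to be eliminated. M and its elimination have the same
  integral over the other coordinates, and the coordinate x contributes pi / d to one and pi to the
  other, just as the determinants differ by the factor d.\<close>

lemma gaussian_integral_det_aux:
  fixes M :: "complex^'n::finite^'n"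
  assumes "finite S" "herm_pd M" "\<And>i j. i \<notin> S \<Longrightarrow> M $ i $ j = (if i = j then 1 else 0)"
  shows "\<exists>d>0. det M = of_real d \<and> (\<integral>\<^sup>+k. ennreal (exp (- Re (qform M k))) \<partial>Pi_lborel UNIV) = ennreal (pi ^ CARD('n) / d)"
  using assms
proof (induction S arbitrary: M rule: finite_induct)
  case empty
  then have M: "M = mat 1" by (simp add: vec_eq_iff mat_def)
  have "qform M k = of_real (\<Sum>i\<in>UNIV. (norm (k i))\<^sup>2)" for k
  proof -
    have "(\<Sum>j\<in>UNIV. k i * cnj (k j) * M $ i $ j) = of_real ((norm (k i))\<^sup>2)" for i
    proof -
      have "(\<Sum>j\<in>UNIV. k i * cnj (k j) * M $ i $ j) = (\<Sum>j\<in>UNIV. if j = i then k i * cnj (k i) else 0)"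
        by (intro sum.cong) (auto simp: M mat_def)
      also have "\<dots> = of_real ((norm (k i))\<^sup>2)" by (simp add: complex_norm_square[symmetric] del: of_real_power)
      finally show ?thesis .
    qed
    then show ?thesis by (simp add: qform_def)
  qed
  then have "Re (qform M k) = (\<Sum>i\<in>UNIV. (norm (k i))\<^sup>2)" for k by (simp only: Re_complex_of_real)
  then have "(\<integral>\<^sup>+k. ennreal (exp (- Re (qform M k))) \<partial>Pi_lborel UNIV) = Phi (UNIV :: 'n set) ({} :: 'n set) 1 0 (\<lambda>_. 0)"
    by (simp add: Phi_def)
  also have "\<dots> = ennreal (pi ^ CARD('n))" by (subst Phi_zero) (auto simp: ennreal_power)
  finally show ?case by (intro exI[of _ 1]) (simp add: M)
next
  case (insert x S)
  define d where "d = Re (M $ x $ x)"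
  have d: "M $ x $ x = of_real d" "d > 0" using herm_pd_diag[OF insert.prems(1), of x] by (auto simp: d_def)
  let ?N = "eliminate x M"
  have "?N $ i $ j = (if i = j then 1 else 0)" if "i \<notin> S" for i j
    using that insert.prems(2)[of i] by (auto simp: eliminate_def)
  from insert.IH[OF herm_pd_elim[OF insert.prems(1)] this]
  obtain e where e: "e > 0" "det ?N = of_real e" "(\<integral>\<^sup>+k. ennreal (exp (- Re (qform ?N k))) \<partial>Pi_lborel UNIV) = ennreal (pi ^ CARD('n) / e)"
    by blast
  have ins: "insert x (UNIV - {x}) = UNIV" by auto
  define J where "J = (\<integral>\<^sup>+k. ennreal (exp (- Re (qform ?N (k(x := 0))))) \<partial>Pi_lborel (UNIV - {x}))"
  have split: "(\<integral>\<^sup>+k. ennreal (exp (- Re (qform M k))) \<partial>Pi_lborel UNIV) = (\<integral>\<^sup>+k. (\<integral>\<^sup>+z. ennreal (exp (- Re (qform M (k(x := z))))) \<partial>lborel) \<partial>Pi_lborel (UNIV - {x}))" for M :: "complex^'n^'n"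
    by (rule complex_product.product_nn_integral_insert[of "UNIV - {x}" x, unfolded ins, OF _ _ qform_measurable]) auto
  have mJ: "(\<lambda>k. ennreal (exp (- Re (qform ?N (k(x := 0)))))) \<in> borel_measurable (Pi_lborel (UNIV - {x}))"
    by (rule measurable_compose[OF measurable_fun_upd[where J = "UNIV - {x}"] qform_measurable]) (auto intro: measurable_ident_sets)
  \<comment> \<open>Applied to M with \<beta> = d and to the eliminated matrix with \<beta> =
    1.\<close>
  have gen: "(\<integral>\<^sup>+k. ennreal (exp (- Re (qform P k))) \<partial>Pi_lborel UNIV) = ennreal (pi / \<beta>) * J"
    if "\<beta> > 0" "\<And>k z. Re (qform P (k(x := z))) = \<beta> * (norm (z + w k))\<^sup>2 + Re (qform ?N (k(x := 0)))" for P :: "complex^'n^'n" and \<beta> w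
  proof -
    have "(\<integral>\<^sup>+z. ennreal (exp (- Re (qform P (k(x := z))))) \<partial>lborel) = ennreal (pi / \<beta>) * ennreal (exp (- Re (qform ?N (k(x := 0)))))" for k
    proof -
      have "(\<integral>\<^sup>+z. ennreal (exp (- Re (qform P (k(x := z))))) \<partial>lborel) = (\<integral>\<^sup>+z. ennreal (exp (- \<beta> * (norm (z + w k))\<^sup>2)) * ennreal (exp (- Re (qform ?N (k(x := 0))))) \<partial>lborel)"
        by (intro nn_integral_cong) (simp only: that(2) ennreal_mult''[OF exp_ge_zero, symmetric] exp_add[symmetric] minus_add_distrib mult_minus_left)
      also have "\<dots> = (\<integral>\<^sup>+z. ennreal (exp (- \<beta> * (norm (z + w k))\<^sup>2)) \<partial>lborel) * ennreal (exp (- Re (qform ?N (k(x := 0)))))"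
        by (rule nn_integral_multc) measurable
      finally show ?thesis by (simp only: nn_integral_gauss_complex[OF that(1)])
    qed
    then have "(\<integral>\<^sup>+k. ennreal (exp (- Re (qform P k))) \<partial>Pi_lborel UNIV) = (\<integral>\<^sup>+k. ennreal (pi / \<beta>) * ennreal (exp (- Re (qform ?N (k(x := 0))))) \<partial>Pi_lborel (UNIV - {x}))"
      unfolding split by simp
    also have "\<dots> = ennreal (pi / \<beta>) * J" unfolding J_def by (rule nn_integral_cmult[OF mJ])
    finally show ?thesis .
  qed
  have 1: "(\<integral>\<^sup>+k. ennreal (exp (- Re (qform M k))) \<partial>Pi_lborel UNIV) = ennreal (pi / d) * J"
  proof (rule gen[OF d(2)])
    fix k :: "'n \<Rightarrow> complex" and z
    have "(\<Sum>i\<in>UNIV - {x}. (k(x := z)) i * M $ i $ x) = (\<Sum>i\<in>UNIV - {x}. k i * M $ i $ x)"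
      by (intro sum.cong) auto
    then show "Re (qform M (k(x := z))) = d * (norm (z + (\<Sum>i\<in>UNIV - {x}. k i * M $ i $ x) / of_real d))\<^sup>2 + Re (qform ?N (k(x := 0)))"
      using qform_elim[OF insert.prems(1), of "k(x := z)" x] unfolding d_def by simp
  qed
  have 2: "(\<integral>\<^sup>+k. ennreal (exp (- Re (qform ?N k))) \<partial>Pi_lborel UNIV) = ennreal (pi / 1) * J"
  proof (rule gen[where w = "\<lambda>_. 0"])
    fix k :: "'n \<Rightarrow> complex" and z
    show "Re (qform ?N (k(x := z))) = 1 * (norm (z + 0))\<^sup>2 + Re (qform ?N (k(x := 0)))"
      using arg_cong[OF qform_elim_split[of x M "k(x := z)"], of Re] by simp
  qed simp
  have "ennreal (pi / d) * J = ennreal (1 / d) * (ennreal (pi / 1) * J)"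
  proof -
    have "ennreal (pi / d) = ennreal (1 / d) * ennreal (pi / 1)"
      using d by (simp add: ennreal_mult''[symmetric])
    then show ?thesis by (simp only: mult.assoc)
  qed
  also have "\<dots> = ennreal (1 / d) * ennreal (pi ^ CARD('n) / e)" using 2 e(3) by simp
  also have "\<dots> = ennreal (pi ^ CARD('n) / (d * e))" using d e by (simp add: ennreal_mult''[symmetric])
  finally have int: "(\<integral>\<^sup>+k. ennreal (exp (- Re (qform M k))) \<partial>Pi_lborel UNIV) = ennreal (pi ^ CARD('n) / (d * e))" unfolding 1 .
  have dt: "det M = of_real (d * e)" using det_elim[of M x] d e by simp
  show ?case
    by (rule exI[of _ "d * e"]) (intro conjI mult_pos_pos d(2) e(1) dt int)
qed

definition gram_det :: "real \<Rightarrow> complex^'t::finite^'r::finite \<Rightarrow> real" where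
  "gram_det \<rho> H = Re (det (mat 1 + \<rho> *\<^sub>R (H ** cnj_transpose H)))"

text \<open>The Hermitian form of \<open>I + \<rho> H H*\<close> at k is
  \<open>|k|^2 + \<rho> |k H|^2\<close>, the exponent in \<open>Phi\<close>. Positivity of the
  determinant is a by-product of the elimination.\<close>

lemma Phi_eq_inverse_gram_det:
  fixes H :: "complex^'t::finite^'r::finite"
  assumes "0 \<le> \<rho>"
  shows "0 < gram_det \<rho> H" "Phi UNIV UNIV 1 \<rho> (\<lambda>(i, j). H $ i $ j) = ennreal (pi ^ CARD('r) / gram_det \<rho> H)"
proof -
  let ?M = "mat 1 + \<rho> *\<^sub>R (H ** cnj_transpose H)"
  have M: "?M $ i $ j = (if i = j then 1 else 0) + of_real \<rho> * (\<Sum>l\<in>UNIV. H $ i $ l * cnj (H $ j $ l))" for i j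
    by (simp add: mat_def matrix_matrix_mult_def cnj_transpose_def scaleR_conv_of_real[where 'a = complex])
  have q: "qform ?M k = of_real ((\<Sum>i\<in>UNIV. (norm (k i))\<^sup>2) + \<rho> * (\<Sum>l\<in>UNIV. (norm (\<Sum>i\<in>UNIV. k i * H $ i $ l))\<^sup>2))" for k
  proof -
    have "qform ?M k = (\<Sum>i\<in>UNIV. \<Sum>j\<in>UNIV. (if j = i then k i * cnj (k i) else 0)) + (\<Sum>i\<in>UNIV. \<Sum>j\<in>UNIV. k i * cnj (k j) * (of_real \<rho> * (\<Sum>l\<in>UNIV. H $ i $ l * cnj (H $ j $ l))))"
      unfolding qform_def M distrib_left sum.distrib by (intro arg_cong2[where f="(+)"] sum.cong refl) auto
    also have "(\<Sum>i\<in>UNIV. \<Sum>j\<in>UNIV. (if j = i then k i * cnj (k i) else 0)) = of_real (\<Sum>i\<in>UNIV. (norm (k i))\<^sup>2)"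
      by (simp add: complex_norm_square[symmetric] del: of_real_power)
    also have "(\<Sum>i\<in>UNIV. \<Sum>j\<in>UNIV. k i * cnj (k j) * (of_real \<rho> * (\<Sum>l\<in>UNIV. H $ i $ l * cnj (H $ j $ l))))
       = (\<Sum>i\<in>UNIV. \<Sum>j\<in>UNIV. \<Sum>l\<in>UNIV. of_real \<rho> * ((k i * H $ i $ l) * cnj (k j * H $ j $ l)))"
      by (intro sum.cong refl) (simp add: sum_distrib_left mult_ac)
    also have "\<dots> = (\<Sum>i\<in>UNIV. \<Sum>l\<in>UNIV. \<Sum>j\<in>UNIV. of_real \<rho> * ((k i * H $ i $ l) * cnj (k j * H $ j $ l)))"
      by (intro sum.cong refl sum.swap)
    also have "\<dots> = (\<Sum>l\<in>UNIV. \<Sum>i\<in>UNIV. \<Sum>j\<in>UNIV. of_real \<rho> * ((k i * H $ i $ l) * cnj (k j * H $ j $ l)))"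
      by (rule sum.swap)
    also have "\<dots> = (\<Sum>l\<in>UNIV. of_real \<rho> * ((\<Sum>i\<in>UNIV. k i * H $ i $ l) * cnj (\<Sum>i\<in>UNIV. k i * H $ i $ l)))"
      by (intro sum.cong refl) (simp only: cnj_sum sum_product, simp only: sum_distrib_left)
    also have "\<dots> = of_real (\<rho> * (\<Sum>l\<in>UNIV. (norm (\<Sum>i\<in>UNIV. k i * H $ i $ l))\<^sup>2))"
      by (simp only: complex_norm_square[symmetric] of_real_mult[symmetric] of_real_sum[symmetric] sum_distrib_left)
    finally show ?thesis by (simp only: of_real_add)
  qed
  have hp: "herm_pd ?M"
    unfolding herm_pd_def
  proof (intro conjI allI impI)
    fix i j show "?M $ j $ i = cnj (?M $ i $ j)" unfolding M by (simp add: mult.commute)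
  next
    fix k :: "'r \<Rightarrow> complex" assume "\<exists>i. k i \<noteq> 0"
    then have "0 < (\<Sum>i\<in>UNIV. (norm (k i))\<^sup>2)" by (auto intro!: sum_pos2)
    moreover have "0 \<le> \<rho> * (\<Sum>l\<in>UNIV. (norm (\<Sum>i\<in>UNIV. k i * H $ i $ l))\<^sup>2)"
      using assms by (intro mult_nonneg_nonneg sum_nonneg) auto
    ultimately show "0 < Re (qform ?M k)" unfolding q by simp
  qed
  have "\<exists>d>0. det ?M = of_real d \<and> (\<integral>\<^sup>+k. ennreal (exp (- Re (qform ?M k))) \<partial>Pi_lborel UNIV) = ennreal (pi ^ CARD('r) / d)"
    by (rule gaussian_integral_det_aux[where S = UNIV, OF finite hp]) simp
  then obtain d where d: "d > 0" "det ?M = of_real d"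
    "(\<integral>\<^sup>+k. ennreal (exp (- Re (qform ?M k))) \<partial>Pi_lborel UNIV) = ennreal (pi ^ CARD('r) / d)"
    by blast
  have g: "gram_det \<rho> H = d" by (simp add: gram_det_def d)
  show "0 < gram_det \<rho> H" using d g by simp
  show "Phi UNIV UNIV 1 \<rho> (\<lambda>(i, j). H $ i $ j) = ennreal (pi ^ CARD('r) / gram_det \<rho> H)"
    unfolding g d(3)[symmetric] Phi_def by (intro nn_integral_cong) (simp add: q)
qed

section \<open>Outage probabilities\<close>

lemma prod_Basis_vec:
  fixes F :: "'a::euclidean_space^'n::finite \<Rightarrow> 'c::comm_monoid_mult"
  shows "(\<Prod>b\<in>Basis. F b) = (\<Prod>i\<in>UNIV. \<Prod>u\<in>Basis. F (axis i u))"
proof -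
  have B: "(Basis :: ('a^'n) set) = (\<Union>i\<in>UNIV. axis i ` Basis)" by (auto simp: Basis_vec_def)
  have "(\<Prod>b\<in>Basis. F b) = (\<Prod>i\<in>UNIV. \<Prod>b\<in>axis i ` Basis. F b)"
    unfolding B by (intro prod.UNION_disjoint) (auto simp: axis_eq_axis)
  also have "\<dots> = (\<Prod>i\<in>UNIV. \<Prod>u\<in>Basis. F (axis i u))"
    by (intro prod.cong refl) (subst prod.reindex, auto simp: inj_on_def axis_eq_axis)
  finally show ?thesis .
qed

lemma Basis_vecE:
  assumes "b \<in> (Basis :: ('a::euclidean_space^'n::finite) set)"
  obtains i u where "b = axis i u" "u \<in> Basis"
  using assms by (auto simp: Basis_vec_def)

lemma mem_box_vec:
  fixes x :: "'a::euclidean_space^'n::finite"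
  shows "x \<in> box l u \<longleftrightarrow> (\<forall>i. x $ i \<in> box (l $ i) (u $ i))"
  by (auto simp: mem_box Basis_vec_def inner_axis)

lemma ennreal_mult3:
  "0 \<le> b \<Longrightarrow> 0 \<le> c \<Longrightarrow> ennreal a * (ennreal b * ennreal c) = ennreal (a * (b * c))"
  by (simp add: ennreal_mult'')

definition to_matrix :: "('r::finite \<times> 't::finite \<Rightarrow> complex) \<Rightarrow> complex^'t^'r" where
  "to_matrix f = (\<chi> i j. f (i, j))"

lemma to_matrix_measurable: "to_matrix \<in> Pi_lborel UNIV \<rightarrow>\<^sub>M borel"
proof -
  have c: "(\<lambda>f. f y) \<in> borel_measurable (Pi_lborel (UNIV :: ('r \<times> 't) set))" for y
    by (rule Pi_lborel_component[OF measurable_ident_sets[OF refl]]) simp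
  have "(\<lambda>f. to_matrix f \<bullet> b) \<in> borel_measurable (Pi_lborel (UNIV :: ('r \<times> 't) set))" if bB: "b \<in> Basis" for b :: "complex^'t^'r"
  proof -
    obtain i j u where b: "b = axis i (axis j u)" using bB by (elim Basis_vecE) blast
    have "(\<lambda>f. f (i, j) \<bullet> u) \<in> borel_measurable (Pi_lborel (UNIV :: ('r \<times> 't) set))"
      by (intro borel_measurable_inner c borel_measurable_const)
    then show ?thesis by (simp add: b inner_axis to_matrix_def)
  qed
  then show ?thesis by (subst borel_measurable_euclidean_space) auto
qed

text \<open>Lebesgue measure is characterised by its values on boxes, and a box of matrices is a
  product of boxes over the entries.\<close>

lemma lborel_matrix:
  "(lborel :: (complex^'t::finite^'r::finite) measure) = distr (Pi_lborel UNIV) borel to_matrix"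
proof (rule lborel_eqI)
  fix l u :: "complex^'t^'r"
  assume le: "\<And>b. b \<in> Basis \<Longrightarrow> l \<bullet> b \<le> u \<bullet> b"
  have le': "l $ i $ j \<bullet> v \<le> u $ i $ j \<bullet> v" if "v \<in> Basis" for i j v
    using le[of "axis i (axis j v)"] that by (auto simp: inner_axis Basis_vec_def)
  have "emeasure (distr (Pi_lborel UNIV) borel to_matrix) (box l u) = emeasure (Pi_lborel UNIV) (to_matrix -` box l u \<inter> space (Pi_lborel UNIV))"
    by (intro emeasure_distr to_matrix_measurable) simp
  also have "to_matrix -` box l u \<inter> space (Pi_lborel UNIV) = (\<Pi>\<^sub>E x\<in>UNIV. box (l $ fst x $ snd x) (u $ fst x $ snd x))"
    by (auto simp: mem_box_vec to_matrix_def space_PiM PiE_def Pi_def)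
  also have "emeasure (Pi_lborel UNIV) \<dots> = (\<Prod>x\<in>UNIV. emeasure lborel (box (l $ fst x $ snd x) (u $ fst x $ snd x)))"
    by (rule complex_product.emeasure_PiM) auto
  also have "\<dots> = (\<Prod>x\<in>UNIV. ennreal (\<Prod>v\<in>Basis. (u $ fst x $ snd x - l $ fst x $ snd x) \<bullet> v))"
    using le' by (intro prod.cong refl) (simp add: emeasure_lborel_box_eq inner_diff_left)
  also have "\<dots> = ennreal (\<Prod>x\<in>UNIV. \<Prod>v\<in>Basis. (u $ fst x $ snd x - l $ fst x $ snd x) \<bullet> v)"
    using le' by (intro prod_ennreal prod_nonneg) (auto simp: inner_diff_left intro!: prod_nonneg)
  also have "(\<Prod>x\<in>UNIV. \<Prod>v\<in>Basis. (u $ fst x $ snd x - l $ fst x $ snd x) \<bullet> v) = (\<Prod>i\<in>UNIV. \<Prod>j\<in>UNIV. \<Prod>v\<in>Basis. (u $ i $ j - l $ i $ j) \<bullet> v)"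
    unfolding UNIV_Times_UNIV[symmetric] by (subst prod.cartesian_product) (simp add: split_beta)
  also have "\<dots> = (\<Prod>b\<in>Basis. (u - l) \<bullet> b)"
    by (simp add: prod_Basis_vec inner_axis)
  finally show "emeasure (distr (Pi_lborel UNIV) borel to_matrix) (box l u) = ennreal (\<Prod>b\<in>Basis. (u - l) \<bullet> b)" .
qed simp

lemma norm_to_matrix: "(norm (to_matrix f :: complex^'t::finite^'r::finite))\<^sup>2 = (\<Sum>x\<in>UNIV. (norm (f x))\<^sup>2)"
proof -
  have "(norm (to_matrix f :: complex^'t^'r))\<^sup>2 = (\<Sum>i\<in>UNIV. \<Sum>j\<in>UNIV. (norm (f (i, j)))\<^sup>2)"
    by (simp add: norm_vec_def L2_set_def sum_nonneg to_matrix_def)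
  also have "\<dots> = (\<Sum>x\<in>UNIV. (norm (f x))\<^sup>2)"
    unfolding UNIV_Times_UNIV[symmetric] by (subst sum.cartesian_product) (simp add: split_beta)
  finally show ?thesis .
qed

lemma sets_gauss_matrix [simp]: "sets (gauss_matrix_measure T) = sets borel"
  by (simp add: gauss_matrix_measure_def)

lemma nn_integral_gauss_matrix:
  fixes F :: "complex^'t::finite^'r::finite \<Rightarrow> ennreal"
  assumes F: "F \<in> borel_measurable borel"
  shows "(\<integral>\<^sup>+H. F H \<partial>gauss_matrix_measure TYPE('t \<times> 'r)) =
    ennreal (1 / pi ^ (CARD('t) * CARD('r))) * (\<integral>\<^sup>+f. ennreal (exp (- (\<Sum>x\<in>UNIV. (norm (f x))\<^sup>2))) * F (to_matrix f) \<partial>Pi_lborel UNIV)"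
proof -
  let ?c = "1 / pi ^ (CARD('t) * CARD('r))"
  have m: "(\<lambda>H::complex^'t^'r. ennreal (exp (- (norm H)\<^sup>2) / pi ^ (CARD('t) * CARD('r)))) \<in> borel_measurable borel"
    by measurable
  have m2: "(\<lambda>f. ennreal (exp (- (norm (to_matrix f :: complex^'t^'r))\<^sup>2)) * F (to_matrix f)) \<in> borel_measurable (Pi_lborel UNIV)"
    by (intro measurable_compose[OF to_matrix_measurable] borel_measurable_times_ennreal F) measurable
  have "(\<integral>\<^sup>+H. F H \<partial>gauss_matrix_measure TYPE('t \<times> 'r)) = (\<integral>\<^sup>+H. ennreal (exp (- (norm H)\<^sup>2) / pi ^ (CARD('t) * CARD('r))) * F H \<partial>lborel)"
    unfolding gauss_matrix_measure_def using m F by (intro nn_integral_density) auto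
  also have "\<dots> = (\<integral>\<^sup>+f. ennreal (exp (- (norm (to_matrix f :: complex^'t^'r))\<^sup>2) / pi ^ (CARD('t) * CARD('r))) * F (to_matrix f) \<partial>Pi_lborel UNIV)"
    unfolding lborel_matrix using m F by (intro nn_integral_distr to_matrix_measurable borel_measurable_times_ennreal) auto
  also have "\<dots> = (\<integral>\<^sup>+f. ennreal ?c * (ennreal (exp (- (norm (to_matrix f :: complex^'t^'r))\<^sup>2)) * F (to_matrix f)) \<partial>Pi_lborel UNIV)"
    by (intro nn_integral_cong) (simp add: mult.assoc[symmetric] ennreal_mult''[symmetric])
  also have "\<dots> = ennreal ?c * (\<integral>\<^sup>+f. (ennreal (exp (- (norm (to_matrix f :: complex^'t^'r))\<^sup>2)) * F (to_matrix f)) \<partial>Pi_lborel UNIV)"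
    by (rule nn_integral_cmult[OF m2])
  finally show ?thesis by (simp only: norm_to_matrix)
qed

lemma emeasure_gauss_matrix_space:
  "emeasure (gauss_matrix_measure TYPE('t::finite \<times> 'r::finite)) UNIV = 1"
proof -
  have "emeasure (gauss_matrix_measure TYPE('t \<times> 'r)) UNIV = (\<integral>\<^sup>+H. 1 \<partial>gauss_matrix_measure TYPE('t \<times> 'r))"
    by (simp add: gauss_matrix_measure_def)
  also have "\<dots> = ennreal (1 / pi ^ (CARD('t) * CARD('r))) * (\<integral>\<^sup>+f. ennreal (exp (- (\<Sum>x\<in>UNIV. (norm (f x))\<^sup>2))) * 1 \<partial>Pi_lborel (UNIV :: ('r \<times> 't) set))"
    by (rule nn_integral_gauss_matrix) simp
  also have "(\<integral>\<^sup>+f. ennreal (exp (- (\<Sum>x\<in>UNIV. (norm (f x))\<^sup>2))) * 1 \<partial>Pi_lborel (UNIV :: ('r \<times> 't) set)) = Phi (UNIV :: ('r \<times> 't) set) ({} :: 'r set) 1 0 (\<lambda>_. 0)"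
    by (simp add: Phi_def)
  also have "\<dots> = ennreal (pi ^ (CARD('t) * CARD('r)))"
    by (subst Phi_zero) (auto simp: ennreal_power mult.commute)
  also have "ennreal (1 / pi ^ (CARD('t) * CARD('r))) * \<dots> = 1"
    by (simp add: ennreal_mult''[symmetric])
  finally show ?thesis .
qed

lemma gram_det_measurable: "(\<lambda>H :: complex^'t::finite^'r::finite. gram_det \<rho> H) \<in> borel_measurable borel"
proof -
  have "continuous_on UNIV (\<lambda>H :: complex^'t^'r. gram_det \<rho> H)"
    unfolding gram_det_def det_def
    by (simp add: matrix_matrix_mult_def cnj_transpose_def) (intro continuous_intros)
  then show ?thesis by (rule borel_measurable_continuous_onI)
qed

lemma Phi_to_matrix:
  fixes f :: "'r::finite \<times> 't::finite \<Rightarrow> complex"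
  assumes "0 \<le> \<rho>"
  shows "Phi UNIV UNIV 1 \<rho> f = ennreal (pi ^ CARD('r) / gram_det \<rho> (to_matrix f :: complex^'t^'r))"
proof -
  have "Phi UNIV UNIV 1 \<rho> f = Phi UNIV UNIV 1 \<rho> (\<lambda>(i, j). (to_matrix f :: complex^'t^'r) $ i $ j)"
    by (intro Phi_cong) (simp add: to_matrix_def)
  then show ?thesis by (simp only: Phi_eq_inverse_gram_det(2)[OF assms])
qed

text \<open>Markov's inequality for \<open>(y / gram_det)^c\<close>, whose expectation is a moment
  of \<open>Phi\<close>. With c the slope of d between j - 1 and j, putting y =
  \<open>\<rho> powr s\<close> produces, up to the gap left by \<tau>, the affine piece of d on that
  interval.\<close>

lemma outage_probability_upper:
  assumes j: "1 \<le> j" "j \<le> min CARD('r::finite) CARD('t::finite)"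
    and c: "real c = real CARD('r) + real CARD('t) - 2 * real j + 1"
    and \<tau>: "0 \<le> \<tau>" "\<tau> < (real CARD('r) - real j) * (real CARD('t) - real j) + real j * real c"
  shows "\<exists>D\<ge>0. \<forall>\<rho>>0. \<forall>y>0. emeasure (gauss_matrix_measure TYPE('t \<times> 'r)) {H. gram_det \<rho> H \<le> y} \<le> ennreal (D * y ^ c * \<rho> powr (- \<tau>))"
proof -
  have c1: "1 \<le> c" using j c by linarith
  have "\<tau> < moment_exponent CARD('r) CARD('t) c" using moment_exponent_ge[of j "CARD('r)" "CARD('t)" c] j c \<tau> by simp
  then obtain D where D: "D \<ge> 0" "\<And>\<rho>. \<rho> > 0 \<Longrightarrow>
     (\<integral>\<^sup>+f. ennreal (exp (- (\<Sum>x\<in>UNIV \<times> UNIV. (norm (f x))\<^sup>2))) * Phi (UNIV::'r set) (UNIV::'t set) 1 \<rho> f ^ c \<partial>Pi_lborel (UNIV \<times> UNIV)) \<le> ennreal (D * \<rho> powr (- \<tau>))"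
    using gauss_Phi_moment_bound[of "UNIV::'r set" "UNIV::'t set" c \<tau>] c1 \<tau> by auto
  define K where "K = 1 / pi ^ (CARD('t) * CARD('r)) * (1 / (pi ^ CARD('r)) ^ c)"
  have K: "K \<ge> 0" by (simp add: K_def)
  have "emeasure (gauss_matrix_measure TYPE('t \<times> 'r)) {H. gram_det \<rho> H \<le> y} \<le> ennreal (K * D * y ^ c * \<rho> powr (- \<tau>))"
    if \<rho>: "\<rho> > 0" and y: "y > 0" for \<rho> y
  proof -
    have S: "{H :: complex^'t^'r. gram_det \<rho> H \<le> y} \<in> sets borel"
      using gram_det_measurable[of \<rho>] by measurable
    have mG: "(\<lambda>H :: complex^'t^'r. ennreal ((y / gram_det \<rho> H) ^ c)) \<in> borel_measurable borel"
      using gram_det_measurable[of \<rho>] by measurable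
    have mP: "(\<lambda>f. ennreal (exp (- (\<Sum>x\<in>UNIV. (norm (f x))\<^sup>2))) * Phi (UNIV::'r set) (UNIV::'t set) 1 \<rho> f ^ c) \<in> borel_measurable (Pi_lborel UNIV)"
    proof -
      have "(\<lambda>f. f x) \<in> borel_measurable (Pi_lborel (UNIV :: ('r \<times> 't) set))" for x
        by (rule Pi_lborel_component[OF measurable_ident_sets[OF refl]]) simp
      then have "(\<lambda>f. ennreal (exp (- (\<Sum>x\<in>UNIV. (norm (f x))\<^sup>2)))) \<in> borel_measurable (Pi_lborel (UNIV :: ('r \<times> 't) set))"
        by (intro measurable_compose[OF _ measurable_ennreal] measurable_compose[OF _ borel_measurable_exp] borel_measurable_uminus
          borel_measurable_sum borel_measurable_power measurable_compose[OF _ borel_measurable_norm])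
      moreover have "Phi (UNIV::'r set) (UNIV::'t set) 1 \<rho> \<in> borel_measurable (Pi_lborel UNIV)"
        using Phi_measurable[of "UNIV::'r set" "UNIV::'t set" 1 \<rho>] by simp
      ultimately show ?thesis by (intro borel_measurable_times_ennreal borel_measurable_power_ennreal)
    qed
    have "emeasure (gauss_matrix_measure TYPE('t \<times> 'r)) {H. gram_det \<rho> H \<le> y} = (\<integral>\<^sup>+H. indicator {H. gram_det \<rho> H \<le> y} H \<partial>gauss_matrix_measure TYPE('t \<times> 'r))"
      using S by (intro nn_integral_indicator[symmetric]) simp
    also have "\<dots> \<le> (\<integral>\<^sup>+H. ennreal ((y / gram_det \<rho> H) ^ c) \<partial>gauss_matrix_measure TYPE('t \<times> 'r))"
    proof (rule nn_integral_mono)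
      fix H :: "complex^'t^'r"
      have "0 < gram_det \<rho> H" using Phi_eq_inverse_gram_det(1)[of \<rho> H] \<rho> by simp
      then have "gram_det \<rho> H \<le> y \<Longrightarrow> 1 \<le> (y / gram_det \<rho> H) ^ c" by (intro one_le_power) simp
      then show "indicator {H. gram_det \<rho> H \<le> y} H \<le> ennreal ((y / gram_det \<rho> H) ^ c)"
        by (auto simp: indicator_def)
    qed
    also have "\<dots> = ennreal (1 / pi ^ (CARD('t) * CARD('r))) * (\<integral>\<^sup>+f. ennreal (exp (- (\<Sum>x\<in>UNIV. (norm (f x))\<^sup>2))) * ennreal ((y / gram_det \<rho> (to_matrix f :: complex^'t^'r)) ^ c) \<partial>Pi_lborel UNIV)"
      by (rule nn_integral_gauss_matrix[OF mG])
    also have "(\<integral>\<^sup>+f. ennreal (exp (- (\<Sum>x\<in>UNIV. (norm (f x))\<^sup>2))) * ennreal ((y / gram_det \<rho> (to_matrix f :: complex^'t^'r)) ^ c) \<partial>Pi_lborel UNIV)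
       = (\<integral>\<^sup>+f. ennreal (y ^ c / (pi ^ CARD('r)) ^ c) * (ennreal (exp (- (\<Sum>x\<in>UNIV. (norm (f x))\<^sup>2))) * Phi (UNIV::'r set) (UNIV::'t set) 1 \<rho> f ^ c) \<partial>Pi_lborel UNIV)"
    proof (rule nn_integral_cong)
      fix f :: "'r \<times> 't \<Rightarrow> complex"
      define X where "X = gram_det \<rho> (to_matrix f :: complex^'t^'r)"
      have X: "X > 0" using Phi_eq_inverse_gram_det(1)[of \<rho> "to_matrix f :: complex^'t^'r"] \<rho> by (simp add: X_def)
      have "Phi (UNIV::'r set) (UNIV::'t set) 1 \<rho> f ^ c = ennreal ((pi ^ CARD('r) / X) ^ c)"
        using Phi_to_matrix[of \<rho> f] \<rho> X by (simp add: X_def ennreal_power)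
      moreover have "(y / X) ^ c = y ^ c / (pi ^ CARD('r)) ^ c * (pi ^ CARD('r) / X) ^ c"
        by (simp add: power_divide)
      moreover have ge: "0 \<le> (pi ^ CARD('r) / X) ^ c" using X by simp
      ultimately have "ennreal ((y / X) ^ c) = ennreal (y ^ c / (pi ^ CARD('r)) ^ c) * Phi (UNIV::'r set) (UNIV::'t set) 1 \<rho> f ^ c"
        by (simp only: ennreal_mult''[OF ge])
      then show "ennreal (exp (- (\<Sum>x\<in>UNIV. (norm (f x))\<^sup>2))) * ennreal ((y / gram_det \<rho> (to_matrix f :: complex^'t^'r)) ^ c)
        = ennreal (y ^ c / (pi ^ CARD('r)) ^ c) * (ennreal (exp (- (\<Sum>x\<in>UNIV. (norm (f x))\<^sup>2))) * Phi (UNIV::'r set) (UNIV::'t set) 1 \<rho> f ^ c)"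
        unfolding X_def by (simp only: mult_ac)
    qed
    also have "\<dots> = ennreal (y ^ c / (pi ^ CARD('r)) ^ c) * (\<integral>\<^sup>+f. ennreal (exp (- (\<Sum>x\<in>UNIV. (norm (f x))\<^sup>2))) * Phi (UNIV::'r set) (UNIV::'t set) 1 \<rho> f ^ c \<partial>Pi_lborel UNIV)"
      by (rule nn_integral_cmult[OF mP])
    finally have "emeasure (gauss_matrix_measure TYPE('t \<times> 'r)) {H. gram_det \<rho> H \<le> y} \<le>
      ennreal (1 / pi ^ (CARD('t) * CARD('r))) * (ennreal (y ^ c / (pi ^ CARD('r)) ^ c) * (\<integral>\<^sup>+f. ennreal (exp (- (\<Sum>x\<in>UNIV. (norm (f x))\<^sup>2))) * Phi (UNIV::'r set) (UNIV::'t set) 1 \<rho> f ^ c \<partial>Pi_lborel UNIV))" .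
    also have "\<dots> \<le> ennreal (1 / pi ^ (CARD('t) * CARD('r))) * (ennreal (y ^ c / (pi ^ CARD('r)) ^ c) * ennreal (D * \<rho> powr (- \<tau>)))"
      using D(2)[OF \<rho>] by (intro mult_left_mono) simp_all
    also have "\<dots> = ennreal (1 / pi ^ (CARD('t) * CARD('r)) * (y ^ c / (pi ^ CARD('r)) ^ c * (D * \<rho> powr (- \<tau>))))"
      using D y by (intro ennreal_mult3) auto
    also have "1 / pi ^ (CARD('t) * CARD('r)) * (y ^ c / (pi ^ CARD('r)) ^ c * (D * \<rho> powr (- \<tau>))) = K * D * y ^ c * \<rho> powr (- \<tau>)"
      unfolding K_def by (simp only: divide_inverse mult_ac mult_1)
    finally show ?thesis .
  qed
  then show ?thesis using K D by (intro exI[of _ "K * D"]) auto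
qed

text \<open>On the unit polydisc the Gaussian density is bounded below, so the volume bound carries
  over up to constants.\<close>

lemma outage_probability_lower:
  assumes p: "p < CARD('r::finite)" "p < CARD('t::finite)" and \<theta>: "0 \<le> \<theta>" "\<theta> < 1" and C: "0 < C"
  shows "\<exists>\<kappa>>0. \<forall>\<rho>\<ge>1. ennreal (\<kappa> * \<rho> powr (- ((1 - \<theta>) * (real CARD('r) + real CARD('t) - 2 * real p - 1)
        + (real CARD('r) - real p - 1) * (real CARD('t) - real p - 1))))
     \<le> emeasure (gauss_matrix_measure TYPE('t \<times> 'r)) {H. gram_det (C * \<rho>) H \<le> \<rho> powr (real p + \<theta>) / \<kappa>}"
proof -
  define a b where "a = CARD('r)" and "b = CARD('t)"
  define e where "e = (1 - \<theta>) * (real a + real b - 2 * real p - 1) + (real a - real p - 1) * (real b - real p - 1)"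
  obtain \<kappa> where \<kappa>: "\<kappa> > 0" "\<And>\<rho>. \<rho> \<ge> 1 \<Longrightarrow> ennreal (\<kappa> * \<rho> powr (- e))
     \<le> (\<integral>\<^sup>+f. indicator (big_Phi_set (UNIV::'r set) (UNIV::'t set) 1 1 (C * \<rho>) (ennreal (\<kappa> * \<rho> powr (- (real p + \<theta>))))) f \<partial>Pi_lborel UNIV)"
    using big_Phi_set_volume_lower[of "UNIV::'r set" "UNIV::'t set" p \<theta> 1 C 1] p \<theta> C unfolding e_def a_def b_def by auto
  define W where "W = 1 / pi ^ (b * a) * exp (- real (a * b))"
  have W: "W > 0" by (simp add: W_def)
  define P where "P = pi ^ a"
  have P: "P > 0" by (simp add: P_def)
  \<comment> \<open>The first entry pays for the Gaussian density, the second for the power of pi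
    between \<open>Phi\<close> and the inverse determinant.\<close>
  define \<kappa>' where "\<kappa>' = min (W * \<kappa>) (\<kappa> / P)"
  have \<kappa>': "\<kappa>' > 0" "\<kappa>' \<le> W * \<kappa>" "\<kappa>' \<le> \<kappa> / P" using W \<kappa> P by (auto simp: \<kappa>'_def)
  have "ennreal (\<kappa>' * \<rho> powr (- e)) \<le> emeasure (gauss_matrix_measure TYPE('t \<times> 'r)) {H. gram_det (C * \<rho>) H \<le> \<rho> powr (real p + \<theta>) / \<kappa>'}"
    if \<rho>: "1 \<le> \<rho>" for \<rho>
  proof -
    define s where "s = real p + \<theta>"
    let ?S = "{H :: complex^'t^'r. gram_det (C * \<rho>) H \<le> \<rho> powr s / \<kappa>'}"
    have S: "?S \<in> sets borel" using gram_det_measurable[of "C * \<rho>"] by measurable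
    let ?L = "big_Phi_set (UNIV::'r set) (UNIV::'t set) 1 1 (C * \<rho>) (ennreal (\<kappa> * \<rho> powr (- s)))"
    have mL: "(\<lambda>f. indicator ?L f :: ennreal) \<in> borel_measurable (Pi_lborel UNIV)"
      using big_Phi_set_measurable[of "UNIV::'r set" "UNIV::'t set" 1 1 "C * \<rho>"] by simp
    have pt: "ennreal (exp (- real (a * b))) * indicator ?L f \<le> ennreal (exp (- (\<Sum>x\<in>UNIV. (norm (f x))\<^sup>2))) * indicator ?S (to_matrix f)" for f
    proof (cases "f \<in> ?L")
      case True
      then have "f \<in> polydisc UNIV 1" and ph: "ennreal (\<kappa> * \<rho> powr (- s)) \<le> Phi (UNIV::'r set) (UNIV::'t set) 1 (C * \<rho>) f" by (auto simp: big_Phi_set_def)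
      then have "(\<Sum>x\<in>UNIV. (norm (f x))\<^sup>2) \<le> real CARD('r \<times> 't) * 1"
        by (intro sum_bounded_above) (auto simp: polydisc_def power_le_one)
      then have 1: "exp (- real (a * b)) \<le> exp (- (\<Sum>x\<in>UNIV. (norm (f x))\<^sup>2))" by (simp add: a_def b_def)
      define X where "X = gram_det (C * \<rho>) (to_matrix f :: complex^'t^'r)"
      have X: "X > 0" using Phi_eq_inverse_gram_det(1)[of "C * \<rho>" "to_matrix f :: complex^'t^'r"] \<rho> C by (simp add: X_def)
      have "ennreal (\<kappa> * \<rho> powr (- s)) \<le> ennreal (P / X)" using ph Phi_to_matrix[of "C * \<rho>" f] \<rho> C by (simp add: X_def P_def a_def)
      then have "\<kappa> * \<rho> powr (- s) \<le> P / X" using X P by (subst (asm) ennreal_le_iff) auto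
      then have "\<kappa> * \<rho> powr (- s) * X \<le> P" using X by (simp add: pos_le_divide_eq)
      then have "\<kappa> * \<rho> powr (- s) * X * \<rho> powr s \<le> P * \<rho> powr s" by (intro mult_right_mono) auto
      then have "\<kappa> * (\<rho> powr s * \<rho> powr (- s)) * X \<le> P * \<rho> powr s" by (simp only: mult_ac)
      moreover have "\<rho> powr s * \<rho> powr (- s) = 1" using \<rho> by (simp add: powr_add[symmetric])
      ultimately have "\<kappa> / P * X \<le> \<rho> powr s" using P by (simp add: field_simps)
      then have "\<kappa>' * X \<le> \<rho> powr s" using \<kappa>'(3) X by (meson less_eq_real_def mult_right_mono order_trans)
      then have "to_matrix f \<in> ?S" using \<kappa>' by (simp add: X_def field_simps)
      then show ?thesis using 1 by (simp add: ennreal_leI indicator_def)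
    qed simp
    have "ennreal (\<kappa>' * \<rho> powr (- e)) \<le> ennreal (W * (\<kappa> * \<rho> powr (- e)))"
      using \<kappa>' by (intro ennreal_leI) (simp add: mult.assoc[symmetric] mult_right_mono)
    also have "\<dots> = ennreal (1 / pi ^ (b * a)) * (ennreal (exp (- real (a * b))) * ennreal (\<kappa> * \<rho> powr (- e)))"
      using \<kappa> unfolding W_def mult.assoc by (intro ennreal_mult3[symmetric]) auto
    also have "\<dots> \<le> ennreal (1 / pi ^ (b * a)) * (ennreal (exp (- real (a * b))) * (\<integral>\<^sup>+f. indicator ?L f \<partial>Pi_lborel UNIV))"
      unfolding s_def using \<kappa>(2)[OF \<rho>] by (intro mult_left_mono) simp_all
    also have "\<dots> = ennreal (1 / pi ^ (b * a)) * (\<integral>\<^sup>+f. ennreal (exp (- real (a * b))) * indicator ?L f \<partial>Pi_lborel UNIV)"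
      by (subst nn_integral_cmult[OF mL]) simp
    also have "\<dots> \<le> ennreal (1 / pi ^ (b * a)) * (\<integral>\<^sup>+f. ennreal (exp (- (\<Sum>x\<in>UNIV. (norm (f x))\<^sup>2))) * indicator ?S (to_matrix f) \<partial>Pi_lborel UNIV)"
      by (intro mult_left_mono nn_integral_mono pt) simp
    also have "\<dots> = (\<integral>\<^sup>+H. indicator ?S H \<partial>gauss_matrix_measure TYPE('t \<times> 'r))"
      unfolding a_def b_def using S by (intro nn_integral_gauss_matrix[symmetric] borel_measurable_indicator)
    also have "\<dots> = emeasure (gauss_matrix_measure TYPE('t \<times> 'r)) ?S"
      by (rule nn_integral_indicator) (simp only: sets_gauss_matrix S)
    finally show ?thesis unfolding s_def .
  qed
  then show ?thesis using \<kappa>'(1) unfolding e_def a_def b_def by blast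
qed

section \<open>Exponential orders\<close>

text \<open>The parameter e is a rate of decay: an upper bound on F bounds its exponent from
  below.\<close>

definition le_exp :: "(real \<Rightarrow> ennreal) \<Rightarrow> real \<Rightarrow> bool" where
  "le_exp F e \<longleftrightarrow> (\<forall>\<epsilon>>0. \<forall>\<^sub>F \<rho> in at_top. F \<rho> \<le> ennreal (\<rho> powr (- e + \<epsilon>)))"

definition ge_exp :: "(real \<Rightarrow> ennreal) \<Rightarrow> real \<Rightarrow> bool" where
  "ge_exp F e \<longleftrightarrow> (\<forall>\<epsilon>>0. \<forall>\<^sub>F \<rho> in at_top. ennreal (\<rho> powr (- e - \<epsilon>)) \<le> F \<rho>)"

lemma eventually_const_le_powr:
  fixes C \<epsilon> :: real
  assumes "0 < \<epsilon>"
  shows "\<forall>\<^sub>F \<rho> in at_top. C \<le> \<rho> powr \<epsilon>"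
  using eventually_ge_at_top[of "max C 1 powr (1 / \<epsilon>)"]
proof eventually_elim
  case (elim \<rho>)
  have "max C 1 = (max C 1 powr (1 / \<epsilon>)) powr \<epsilon>" using assms by (simp add: powr_powr)
  also have "\<dots> \<le> \<rho> powr \<epsilon>" using elim assms by (intro powr_mono2) auto
  finally show ?case by simp
qed

text \<open>The constant may depend on \<epsilon>, so bounds whose exponents merely approach e
  suffice.\<close>

lemma le_exp_cmult:
  assumes "\<And>\<epsilon>. 0 < \<epsilon> \<Longrightarrow> \<exists>C. \<forall>\<^sub>F \<rho> in at_top. F \<rho> \<le> ennreal (C * \<rho> powr (- e + \<epsilon>))"
  shows "le_exp F e"
  unfolding le_exp_def
proof (intro allI impI)
  fix \<epsilon> :: real assume \<epsilon>: "0 < \<epsilon>"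
  obtain C where C: "\<forall>\<^sub>F \<rho> in at_top. F \<rho> \<le> ennreal (C * \<rho> powr (- e + \<epsilon> / 2))"
    using assms[of "\<epsilon> / 2"] \<epsilon> by auto
  show "\<forall>\<^sub>F \<rho> in at_top. F \<rho> \<le> ennreal (\<rho> powr (- e + \<epsilon>))"
    using C eventually_const_le_powr[OF half_gt_zero[OF \<epsilon>], of C]
  proof eventually_elim
    case (elim \<rho>)
    have "C * \<rho> powr (- e + \<epsilon> / 2) \<le> \<rho> powr (\<epsilon>/2) * \<rho> powr (- e + \<epsilon> / 2)"
      using elim by (intro mult_right_mono) auto
    also have "\<dots> = \<rho> powr (- e + \<epsilon>)" by (simp add: powr_add[symmetric])
    finally show ?case using elim(1) by (meson ennreal_leI order_trans)
  qed
qed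

lemma ge_exp_cmult:
  assumes "\<And>\<epsilon>. 0 < \<epsilon> \<Longrightarrow> \<exists>C>0. \<forall>\<^sub>F \<rho> in at_top. ennreal (C * \<rho> powr (- e - \<epsilon>)) \<le> F \<rho>"
  shows "ge_exp F e"
  unfolding ge_exp_def
proof (intro allI impI)
  fix \<epsilon> :: real assume \<epsilon>: "0 < \<epsilon>"
  obtain C where C0: "C > 0" and C: "\<forall>\<^sub>F \<rho> in at_top. ennreal (C * \<rho> powr (- e - \<epsilon> / 2)) \<le> F \<rho>"
    using assms[of "\<epsilon> / 2"] \<epsilon> by auto
  show "\<forall>\<^sub>F \<rho> in at_top. ennreal (\<rho> powr (- e - \<epsilon>)) \<le> F \<rho>"
    using C eventually_const_le_powr[OF half_gt_zero[OF \<epsilon>], of "1/C"] eventually_gt_at_top[of 0]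
  proof eventually_elim
    case (elim \<rho>)
    have "\<rho> powr (- e - \<epsilon>) = 1 * \<rho> powr (- e - \<epsilon>)" by simp
    also have "\<dots> \<le> (C * \<rho> powr (\<epsilon>/2)) * \<rho> powr (- e - \<epsilon>)"
      using elim C0 by (intro mult_right_mono) (auto simp: field_simps)
    also have "\<dots> = C * \<rho> powr (- e - \<epsilon> / 2)"
    proof -
      have "\<epsilon> / 2 + (- e - \<epsilon>) = - e - \<epsilon> / 2" by simp
      then show ?thesis by (simp only: mult.assoc powr_add[symmetric])
    qed
    finally show ?case using elim(1) by (meson ennreal_leI order_trans)
  qed
qed

lemma le_exp_mult:
  assumes "le_exp F a" "le_exp G c"
  shows "le_exp (\<lambda>\<rho>. F \<rho> * G \<rho>) (a + c)"
  unfolding le_exp_def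
proof (intro allI impI)
  fix \<epsilon> :: real assume "0 < \<epsilon>"
  then have "\<forall>\<^sub>F \<rho> in at_top. F \<rho> \<le> ennreal (\<rho> powr (- a + \<epsilon>/2))" "\<forall>\<^sub>F \<rho> in at_top. G \<rho> \<le> ennreal (\<rho> powr (- c + \<epsilon>/2))"
    using assms by (auto simp: le_exp_def)
  then show "\<forall>\<^sub>F \<rho> in at_top. F \<rho> * G \<rho> \<le> ennreal (\<rho> powr (- (a + c) + \<epsilon>))"
  proof eventually_elim
    case (elim \<rho>)
    have "F \<rho> * G \<rho> \<le> ennreal (\<rho> powr (- a + \<epsilon>/2)) * ennreal (\<rho> powr (- c + \<epsilon>/2))"
      using elim by (intro mult_mono) auto
    also have "\<dots> = ennreal (\<rho> powr (- (a + c) + \<epsilon>))"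
      by (simp add: ennreal_mult''[symmetric] powr_add[symmetric] algebra_simps)
    finally show ?case .
  qed
qed

lemma ge_exp_mult:
  assumes "ge_exp F a" "ge_exp G c"
  shows "ge_exp (\<lambda>\<rho>. F \<rho> * G \<rho>) (a + c)"
  unfolding ge_exp_def
proof (intro allI impI)
  fix \<epsilon> :: real assume "0 < \<epsilon>"
  then have "\<forall>\<^sub>F \<rho> in at_top. ennreal (\<rho> powr (- a - \<epsilon>/2)) \<le> F \<rho>" "\<forall>\<^sub>F \<rho> in at_top. ennreal (\<rho> powr (- c - \<epsilon>/2)) \<le> G \<rho>"
    using assms by (auto simp: ge_exp_def)
  then show "\<forall>\<^sub>F \<rho> in at_top. ennreal (\<rho> powr (- (a + c) - \<epsilon>)) \<le> F \<rho> * G \<rho>"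
  proof eventually_elim
    case (elim \<rho>)
    have "ennreal (\<rho> powr (- (a + c) - \<epsilon>)) = ennreal (\<rho> powr (- a - \<epsilon>/2)) * ennreal (\<rho> powr (- c - \<epsilon>/2))"
      by (simp add: ennreal_mult''[symmetric] powr_add[symmetric])
    also have "\<dots> \<le> F \<rho> * G \<rho>"
      using elim by (intro mult_mono) auto
    finally show ?case .
  qed
qed

lemma le_exp_mono: "le_exp F e \<Longrightarrow> e' \<le> e \<Longrightarrow> le_exp F e'"
  unfolding le_exp_def
proof (intro allI impI)
  fix \<epsilon> :: real assume "\<forall>\<epsilon>>0. \<forall>\<^sub>F \<rho> in at_top. F \<rho> \<le> ennreal (\<rho> powr (- e + \<epsilon>))" "e' \<le> e" "0 < \<epsilon>"
  then have "\<forall>\<^sub>F \<rho> in at_top. F \<rho> \<le> ennreal (\<rho> powr (- e + \<epsilon>))" by blast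
  then show "\<forall>\<^sub>F \<rho> in at_top. F \<rho> \<le> ennreal (\<rho> powr (- e' + \<epsilon>))"
    using eventually_ge_at_top[of 1]
  proof eventually_elim
    case (elim \<rho>)
    have "\<rho> powr (- e + \<epsilon>) \<le> \<rho> powr (- e' + \<epsilon>)" using elim(2) \<open>e' \<le> e\<close> by (intro powr_mono) auto
    then show ?case using elim(1) by (meson ennreal_leI order_trans)
  qed
qed

lemma le_exp_add:
  assumes "le_exp F e" "le_exp G e"
  shows "le_exp (\<lambda>\<rho>. F \<rho> + G \<rho>) e"
proof (rule le_exp_cmult)
  fix \<epsilon> :: real assume "0 < \<epsilon>"
  then have "\<forall>\<^sub>F \<rho> in at_top. F \<rho> \<le> ennreal (\<rho> powr (- e + \<epsilon>))" "\<forall>\<^sub>F \<rho> in at_top. G \<rho> \<le> ennreal (\<rho> powr (- e + \<epsilon>))"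
    using assms by (auto simp: le_exp_def)
  then have "\<forall>\<^sub>F \<rho> in at_top. F \<rho> + G \<rho> \<le> ennreal (2 * \<rho> powr (- e + \<epsilon>))"
  proof eventually_elim
    case (elim \<rho>)
    have "F \<rho> + G \<rho> \<le> ennreal (\<rho> powr (- e + \<epsilon>)) + ennreal (\<rho> powr (- e + \<epsilon>))" by (intro add_mono elim)
    also have "\<dots> = ennreal (2 * \<rho> powr (- e + \<epsilon>))" by (subst ennreal_plus[symmetric]) auto
    finally show ?case .
  qed
  then show "\<exists>C. \<forall>\<^sub>F \<rho> in at_top. F \<rho> + G \<rho> \<le> ennreal (C * \<rho> powr (- e + \<epsilon>))" by blast
qed

lemma le_exp_sum:
  assumes "finite I" "\<And>i. i \<in> I \<Longrightarrow> le_exp (F i) e"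
  shows "le_exp (\<lambda>\<rho>. \<Sum>i\<in>I. F i \<rho>) e"
  using assms
proof (induction I rule: finite_induct)
  case (insert x I)
  then show ?case using le_exp_add[of "F x" e "\<lambda>\<rho>. \<Sum>i\<in>I. F i \<rho>"] by simp
qed (simp add: le_exp_def)

lemma le_exp_upper:
  assumes "\<forall>\<^sub>F \<rho> in at_top. F \<rho> \<le> G \<rho>" "le_exp G e"
  shows "le_exp F e"
  unfolding le_exp_def
proof (intro allI impI)
  fix \<epsilon> :: real assume "0 < \<epsilon>"
  then have "\<forall>\<^sub>F \<rho> in at_top. G \<rho> \<le> ennreal (\<rho> powr (- e + \<epsilon>))" using assms(2) by (auto simp: le_exp_def)
  with assms(1) show "\<forall>\<^sub>F \<rho> in at_top. F \<rho> \<le> ennreal (\<rho> powr (- e + \<epsilon>))"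
    by eventually_elim (rule order_trans)
qed

lemma ge_exp_lower:
  assumes "\<forall>\<^sub>F \<rho> in at_top. F \<rho> \<le> G \<rho>" "ge_exp F e"
  shows "ge_exp G e"
  unfolding ge_exp_def
proof (intro allI impI)
  fix \<epsilon> :: real assume "0 < \<epsilon>"
  then have "\<forall>\<^sub>F \<rho> in at_top. ennreal (\<rho> powr (- e - \<epsilon>)) \<le> F \<rho>" using assms(2) by (auto simp: ge_exp_def)
  with assms(1) show "\<forall>\<^sub>F \<rho> in at_top. ennreal (\<rho> powr (- e - \<epsilon>)) \<le> G \<rho>"
    by eventually_elim (rule order_trans)
qed

section \<open>Exponents of the outage probability\<close>

definition min_antennas :: "('t::finite \<times> 'r::finite) itself \<Rightarrow> nat" where
  "min_antennas _ = min CARD('t) CARD('r)"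

definition out_prob :: "('t::finite \<times> 'r::finite) itself \<Rightarrow> real \<Rightarrow> real \<Rightarrow> ennreal" where
  "out_prob T y \<rho> = emeasure (gauss_matrix_measure T) {H :: complex^'t^'r. gram_det (\<rho> / real (min_antennas T)) H \<le> y}"

text \<open>Here j selects an affine piece of d and not the interval containing s. All pieces give
  valid bounds, so an argument using this lemma may pick whichever line suits it.\<close>

lemma out_prob_le_exp:
  defines "T \<equiv> TYPE('t::finite \<times> 'r::finite)"
  assumes j: "1 \<le> j" "j \<le> min_antennas T" and s: "0 \<le> s"
  shows "le_exp (\<lambda>\<rho>. out_prob T (\<rho> powr s) \<rho>)
    ((real CARD('r) - real j) * (real CARD('t) - real j) + (real j - s) * (real CARD('r) + real CARD('t) - 2 * real j + 1))"
proof (rule le_exp_cmult)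
  fix \<epsilon> :: real assume \<epsilon>: "0 < \<epsilon>"
  define c where "c = CARD('r) + CARD('t) - 2 * j + 1"
  have jm: "j \<le> CARD('r)" "j \<le> CARD('t)" using j by (auto simp: min_antennas_def)
  have c: "real c = real CARD('r) + real CARD('t) - 2 * real j + 1" using jm by (simp add: c_def of_nat_diff)
  define e where "e = (real CARD('r) - real j) * (real CARD('t) - real j) + real j * real c"
  have "0 < real j * real c" using j by (simp add: c_def)
  then have e: "0 < e" using jm by (simp add: e_def add_nonneg_pos)
  \<comment> \<open>The moment bound holds only strictly below e; the maximum with 0 keeps the
    exponent nonnegative.\<close>
  define \<tau> where "\<tau> = max 0 (e - \<epsilon>)"
  have \<tau>: "0 \<le> \<tau>" "\<tau> < e" "e - \<epsilon> \<le> \<tau>" using e \<epsilon> by (auto simp: \<tau>_def)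
  obtain D where D: "D \<ge> 0" "\<And>\<rho> y. \<rho> > 0 \<Longrightarrow> y > 0 \<Longrightarrow>
      emeasure (gauss_matrix_measure TYPE('t \<times> 'r)) {H. gram_det \<rho> H \<le> y} \<le> ennreal (D * y ^ c * \<rho> powr (- \<tau>))"
    using outage_probability_upper[where 'r = 'r and 't = 't, OF j(1) _ c \<tau>(1)] \<tau>(2) jm unfolding e_def by auto
  define M where "M = real (min_antennas T)"
  have M: "M > 0" using j by (simp add: M_def)
  have "\<forall>\<^sub>F \<rho> in at_top. out_prob T (\<rho> powr s) \<rho> \<le> ennreal (D * M powr \<tau> * \<rho> powr (- ((real CARD('r) - real j) * (real CARD('t) - real j) + (real j - s) * (real CARD('r) + real CARD('t) - 2 * real j + 1)) + \<epsilon>))"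
    using eventually_ge_at_top[of 1]
  proof eventually_elim
    case (elim \<rho>)
    have "out_prob T (\<rho> powr s) \<rho> \<le> ennreal (D * (\<rho> powr s) ^ c * (\<rho> / M) powr (- \<tau>))"
      unfolding out_prob_def M_def[symmetric] using elim M by (intro D[folded T_def]) auto
    also have "\<dots> \<le> ennreal (D * M powr \<tau> * \<rho> powr (s * real c - e + \<epsilon>))"
    proof (rule ennreal_leI)
      have "(\<rho> powr s) ^ c = (\<rho> powr s) powr real c" using elim by (intro powr_realpow[symmetric]) simp
      then have 1: "(\<rho> powr s) ^ c = \<rho> powr (s * real c)" by (simp add: powr_powr)
      have 2: "(\<rho> / M) powr (- \<tau>) = \<rho> powr (- \<tau>) * M powr \<tau>" using elim M by (simp add: powr_divide powr_minus field_simps)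
      have "\<rho> powr (s * real c + - \<tau>) \<le> \<rho> powr (s * real c - e + \<epsilon>)" using elim \<tau> by (intro powr_mono) auto
      then have "D * M powr \<tau> * (\<rho> powr (s * real c) * \<rho> powr (- \<tau>)) \<le> D * M powr \<tau> * \<rho> powr (s * real c - e + \<epsilon>)"
        unfolding powr_add[symmetric] using D(1) by (intro mult_left_mono) auto
      then show "D * (\<rho> powr s) ^ c * (\<rho> / M) powr (- \<tau>) \<le> D * M powr \<tau> * \<rho> powr (s * real c - e + \<epsilon>)"
        unfolding 1 2 by (simp only: mult_ac)
    qed
    also have "s * real c - e + \<epsilon> = - ((real CARD('r) - real j) * (real CARD('t) - real j) + (real j - s) * (real CARD('r) + real CARD('t) - 2 * real j + 1)) + \<epsilon>"
      unfolding e_def c by (simp add: algebra_simps)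
    finally show ?case .
  qed
  then show "\<exists>C. \<forall>\<^sub>F \<rho> in at_top. out_prob T (\<rho> powr s) \<rho> \<le> ennreal (C * \<rho> powr (- ((real CARD('r) - real j) * (real CARD('t) - real j) + (real j - s) * (real CARD('r) + real CARD('t) - 2 * real j + 1)) + \<epsilon>))"
    by blast
qed

lemma out_prob_mono:
  defines "T \<equiv> TYPE('t::finite \<times> 'r::finite)"
  assumes "y \<le> y'"
  shows "out_prob T y \<rho> \<le> out_prob T y' \<rho>"
proof -
  have "{H :: complex^'t^'r. gram_det (\<rho> / real (min_antennas T)) H \<le> y'} \<in> sets borel"
    using gram_det_measurable[of "\<rho> / real (min_antennas T)"] by measurable
  then show ?thesis unfolding out_prob_def using assms by (intro emeasure_mono) auto
qed

text \<open>The bound on the probability has a constant in its threshold and the caller adds the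
  constant \<eta>. Evaluating the exponent at s0 < s absorbs both into
  \<open>\<rho> powr (s - s0)\<close>.\<close>

lemma out_prob_ge_exp:
  defines "T \<equiv> TYPE('t::finite \<times> 'r::finite)"
  assumes j: "1 \<le> j" "j \<le> min_antennas T" and s0: "real j - 1 \<le> s0" "s0 < real j" and s: "s0 < s" and \<eta>: "0 < \<eta>"
  shows "ge_exp (\<lambda>\<rho>. out_prob T (\<eta> * \<rho> powr s) \<rho>)
    ((real CARD('r) - real j) * (real CARD('t) - real j) + (real j - s0) * (real CARD('r) + real CARD('t) - 2 * real j + 1))"
proof (rule ge_exp_cmult)
  fix \<epsilon> :: real assume \<epsilon>: "0 < \<epsilon>"
  define p where "p = j - 1"
  define \<theta> where "\<theta> = s0 - real p"
  have p: "p < CARD('r)" "p < CARD('t)" "real p = real j - 1" using j by (auto simp: min_antennas_def p_def of_nat_diff)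
  have \<theta>: "0 \<le> \<theta>" "\<theta> < 1" "real p + \<theta> = s0" using s0 p by (auto simp: \<theta>_def)
  define e where "e = (real CARD('r) - real j) * (real CARD('t) - real j) + (real j - s0) * (real CARD('r) + real CARD('t) - 2 * real j + 1)"
  have e: "(1 - \<theta>) * (real CARD('r) + real CARD('t) - 2 * real p - 1) + (real CARD('r) - real p - 1) * (real CARD('t) - real p - 1) = e"
    unfolding e_def \<theta>_def p by (simp add: algebra_simps)
  have M: "0 < 1 / real (min_antennas T)" using j by simp
  from outage_probability_lower[where 'r = 'r and 't = 't, OF p(1,2) \<theta>(1,2) M] obtain \<kappa> where \<kappa>: "\<kappa> > 0"
    "\<And>\<rho>. 1 \<le> \<rho> \<Longrightarrow> ennreal (\<kappa> * \<rho> powr (- e)) \<le> out_prob T (\<rho> powr s0 / \<kappa>) \<rho>"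
    unfolding e \<theta>(3) out_prob_def T_def by auto
  have "\<forall>\<^sub>F \<rho> in at_top. ennreal (\<kappa> * \<rho> powr (- e - \<epsilon>)) \<le> out_prob T (\<eta> * \<rho> powr s) \<rho>"
    using eventually_ge_at_top[of 1] eventually_const_le_powr[of "s - s0" "1 / (\<kappa> * \<eta>)", unfolded diff_gt_0_iff_gt, OF s]
  proof eventually_elim
    case (elim \<rho>)
    have "\<rho> powr s0 / \<kappa> = \<eta> * (1 / (\<kappa> * \<eta>)) * \<rho> powr s0" using \<eta> by simp
    also have "\<dots> \<le> \<eta> * (\<rho> powr (s - s0)) * \<rho> powr s0"
      using \<eta> elim by (intro mult_right_mono mult_left_mono) auto
    also have "\<dots> = \<eta> * \<rho> powr s" by (simp add: mult.assoc powr_add[symmetric])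
    finally have "out_prob T (\<rho> powr s0 / \<kappa>) \<rho> \<le> out_prob T (\<eta> * \<rho> powr s) \<rho>" by (rule out_prob_mono[where 't = 't and 'r = 'r, folded T_def])
    moreover have "\<kappa> * \<rho> powr (- e - \<epsilon>) \<le> \<kappa> * \<rho> powr (- e)"
      using \<kappa> elim \<epsilon> by (intro mult_left_mono powr_mono) auto
    ultimately show ?case using \<kappa>(2)[OF elim(1)] by (meson ennreal_leI order_trans)
  qed
  then show "\<exists>C>0. \<forall>\<^sub>F \<rho> in at_top. ennreal (C * \<rho> powr (- ((real CARD('r) - real j) * (real CARD('t) - real j) + (real j - s0) * (real CARD('r) + real CARD('t) - 2 * real j + 1)) - \<epsilon>)) \<le> out_prob T (\<eta> * \<rho> powr s) \<rho>"
    unfolding e_def[symmetric] using \<kappa>(1) by blast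
qed

section \<open>Integrals over the side-information gain\<close>

definition side_integral :: "real \<Rightarrow> real \<Rightarrow> ennreal" where
  "side_integral s A = (\<integral>\<^sup>+\<gamma>. indicator {0..} \<gamma> * ennreal (exp (- \<gamma>) * (1 / (s * \<gamma> + A))) \<partial>lborel)"

text \<open>On \<open>\<gamma> \<le> A / s\<close> the side information does not dominate the decoded layers, so that there an outage
  depends on H alone.\<close>

definition weak_side_integral :: "real \<Rightarrow> real \<Rightarrow> ennreal" where
  "weak_side_integral s A = (\<integral>\<^sup>+\<gamma>. indicator {0..} \<gamma> * ennreal (indicator {..A / s} \<gamma> * exp (- \<gamma>) * (1 / (s * \<gamma> + A))) \<partial>lborel)"

text \<open>On \<open>[0, min 1 (A / s)]\<close> the density is at least \<open>exp (-1)\<close> and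
  the denominator at most 2 A; the length of this interval turns \<open>1 / A\<close> into
  \<open>1 / max A s\<close>.\<close>

lemma weak_side_integral_ge:
  assumes "0 < s" "0 < A"
  shows "ennreal (exp (-1) / 2 / max A s) \<le> weak_side_integral s A"
proof -
  define d where "d = min 1 (A / s)"
  have d: "0 < d" "d \<le> 1" "d \<le> A / s" using assms by (auto simp: d_def)
  have "exp (-1) / 2 / max A s = exp (-1) / (2 * A) * d"
    using assms by (auto simp: d_def max_def min_def field_simps)
  then have "ennreal (exp (-1) / 2 / max A s) = ennreal (exp (-1) / (2 * A)) * emeasure lborel {0..d}"
    using assms d by (simp add: ennreal_mult''[symmetric])
  also have "\<dots> = (\<integral>\<^sup>+\<gamma>. ennreal (exp (-1) / (2 * A)) * indicator {0..d} \<gamma> \<partial>lborel)"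
    by (rule nn_integral_cmult_indicator[symmetric]) simp
  also have "\<dots> \<le> weak_side_integral s A"
    unfolding weak_side_integral_def
  proof (rule nn_integral_mono)
    fix \<gamma> :: real
    show "ennreal (exp (-1) / (2 * A)) * indicator {0..d} \<gamma> \<le> indicator {0..} \<gamma> * ennreal (indicator {..A / s} \<gamma> * exp (- \<gamma>) * (1 / (s * \<gamma> + A)))"
    proof (cases "\<gamma> \<in> {0..d}")
      case True
      then have \<gamma>: "0 \<le> \<gamma>" "\<gamma> \<le> 1" "\<gamma> \<le> A / s" using d by auto
      then have "s * \<gamma> \<le> A" using assms by (simp add: field_simps)
      then have "exp (-1) * (1 / (2 * A)) \<le> exp (- \<gamma>) * (1 / (s * \<gamma> + A))"
        using \<gamma> assms by (intro mult_mono divide_left_mono) (auto intro!: add_nonneg_pos mult_pos_pos)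
      then show ?thesis using True \<gamma> by (auto simp: indicator_def intro!: ennreal_leI)
    qed simp
  qed
  finally show ?thesis .
qed

lemma side_integral_ge_weak:
  assumes "0 < s" "0 < A"
  shows "weak_side_integral s A \<le> side_integral s A"
  unfolding weak_side_integral_def side_integral_def using assms
  by (intro nn_integral_mono) (auto simp: indicator_def)

lemma nn_integral_exp_neg: "(\<integral>\<^sup>+\<gamma>. indicator {0..} \<gamma> * ennreal (exp (- \<gamma>)) \<partial>lborel) = 1"
proof -
  have "(\<integral>\<^sup>+\<gamma>. ennreal (exp (- \<gamma>)) * indicator {0..} \<gamma> \<partial>lborel) = ennreal (0 - (- exp (- 0)))"
  proof (rule nn_integral_FTC_atLeast)
    have "((\<lambda>x::real. - exp (- x)) \<longlongrightarrow> - 0) at_top"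
      by (intro tendsto_minus filterlim_compose[OF exp_at_bot filterlim_uminus_at_bot_at_top])
    then show "((\<lambda>x::real. - exp (- x)) \<longlongrightarrow> 0) at_top" by simp
  qed (auto intro!: derivative_eq_intros)
  then show ?thesis by (simp add: mult.commute)
qed

lemma side_integral_le_inverse:
  assumes "0 < s" "0 < A"
  shows "side_integral s A \<le> ennreal (1 / A)"
proof -
  have "side_integral s A \<le> (\<integral>\<^sup>+\<gamma>. ennreal (1 / A) * (indicator {0..} \<gamma> * ennreal (exp (- \<gamma>))) \<partial>lborel)"
    unfolding side_integral_def
  proof (rule nn_integral_mono)
    fix \<gamma> :: real
    have "exp (- \<gamma>) * (1 / (s * \<gamma> + A)) \<le> (1 / A) * exp (- \<gamma>)" if "0 \<le> \<gamma>"
      using that assms by (subst mult.commute) (intro mult_right_mono divide_left_mono, auto intro!: mult_pos_pos add_nonneg_pos)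
    then show "indicator {0..} \<gamma> * ennreal (exp (- \<gamma>) * (1 / (s * \<gamma> + A))) \<le> ennreal (1 / A) * (indicator {0..} \<gamma> * ennreal (exp (- \<gamma>)))"
      using assms by (auto simp: indicator_def ennreal_mult''[symmetric] intro!: ennreal_leI)
  qed
  also have "\<dots> = ennreal (1 / A)" by (subst nn_integral_cmult) (auto simp: nn_integral_exp_neg)
  finally show ?thesis .
qed

lemma nn_integral_exp_neg_powr:
  assumes "0 < \<epsilon>"
  shows "(\<integral>\<^sup>+\<gamma>. indicator {0..} \<gamma> * ennreal (exp (- \<gamma>) * \<gamma> powr (\<epsilon> - 1)) \<partial>lborel) = ennreal (Gamma \<epsilon>)"
proof -
  have "(\<integral>\<^sup>+t. ennreal (t powr (\<epsilon> - 1) / exp t * indicator {0..} t) \<partial>lborel) = ennreal (Gamma \<epsilon>)"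
    using nn_integral_has_integral_lebesgue[OF _ Gamma_integral_real[OF assms]]
    by (simp add: nn_integral_completion mult.commute)
  moreover have "indicator {0..} \<gamma> * ennreal (exp (- \<gamma>) * \<gamma> powr (\<epsilon> - 1)) = ennreal (\<gamma> powr (\<epsilon> - 1) / exp \<gamma> * indicator {0..} \<gamma>)" for \<gamma>
    by (auto simp: indicator_def exp_minus field_simps)
  ultimately show ?thesis by simp
qed

text \<open>For bounded A and large s the integral is of order \<open>ln s / s\<close>. Giving up
  \<epsilon> in the power of s replaces the logarithm by the constant
  \<open>Gamma \<epsilon>\<close>.\<close>

lemma side_integral_le_powr:
  assumes s: "0 < s" and A: "1 \<le> A" and \<epsilon>: "0 < \<epsilon>" "\<epsilon> \<le> 1"
  shows "side_integral s A \<le> ennreal (Gamma \<epsilon> * s powr (\<epsilon> - 1))"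
proof -
  have "side_integral s A \<le> (\<integral>\<^sup>+\<gamma>. ennreal (s powr (\<epsilon> - 1)) * (indicator {0..} \<gamma> * ennreal (exp (- \<gamma>) * \<gamma> powr (\<epsilon> - 1))) \<partial>lborel)"
    unfolding side_integral_def
  proof (rule nn_integral_mono_AE)
    show "AE \<gamma> in lborel. indicator {0..} \<gamma> * ennreal (exp (- \<gamma>) * (1 / (s * \<gamma> + A))) \<le> ennreal (s powr (\<epsilon> - 1)) * (indicator {0..} \<gamma> * ennreal (exp (- \<gamma>) * \<gamma> powr (\<epsilon> - 1)))"
      using AE_lborel_singleton[of 0]
    proof eventually_elim
      case (elim \<gamma>)
      show ?case
      proof (cases "0 < \<gamma>")
        case True
        define y where "y = s * \<gamma>"
        have y: "y > 0" using s True by (simp add: y_def)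
        have "1 / (y + A) \<le> y powr (\<epsilon> - 1)"
        proof (cases "y \<le> 1")
          case True
          have "1 / (y + A) \<le> 1" using y A by simp
          also have "1 = y powr 0" using y by simp
          also have "y powr 0 \<le> y powr (\<epsilon> - 1)" using y True \<epsilon> by (intro powr_mono') auto
          finally show ?thesis .
        next
          case False
          have "1 / (y + A) \<le> 1 / y" using y A by (intro divide_left_mono) auto
          also have "\<dots> = y powr (-1)" using y by (simp add: powr_minus divide_inverse)
          also have "\<dots> \<le> y powr (\<epsilon> - 1)" using False \<epsilon> by (intro powr_mono) auto
          finally show ?thesis .
        qed
        also have "\<dots> = s powr (\<epsilon> - 1) * \<gamma> powr (\<epsilon> - 1)" using s True by (simp add: y_def powr_mult)
        finally have "exp (- \<gamma>) * (1 / (s * \<gamma> + A)) \<le> exp (- \<gamma>) * (s powr (\<epsilon> - 1) * \<gamma> powr (\<epsilon> - 1))"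
          unfolding y_def by (intro mult_left_mono) auto
        then show ?thesis using True by (simp add: ennreal_mult''[symmetric] mult_ac ennreal_leI)
      next
        case False
        then show ?thesis using elim by (simp add: indicator_def)
      qed
    qed
  qed
  also have "\<dots> = ennreal (s powr (\<epsilon> - 1)) * ennreal (Gamma \<epsilon>)"
    using \<epsilon> by (subst nn_integral_cmult) (auto simp: nn_integral_exp_neg_powr)
  also have "\<dots> = ennreal (Gamma \<epsilon> * s powr (\<epsilon> - 1))"
    using \<epsilon> by (subst ennreal_mult''[symmetric]) (auto simp: mult.commute Gamma_real_pos less_imp_le)
  finally show ?thesis .
qed

context
  fixes \<nu> :: real and \<rho>s :: "real \<Rightarrow> real"
  assumes \<nu>: "0 \<le> \<nu>" and \<rho>s_pos: "\<And>\<rho>. 0 < \<rho> \<Longrightarrow> 0 < \<rho>s \<rho>"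
    and \<rho>s_lim: "((\<lambda>\<rho>. ln (\<rho>s \<rho>) / ln \<rho>) \<longlongrightarrow> \<nu>) at_top"
begin

lemma rho_s_bounds:
  assumes "0 < \<epsilon>"
  shows "\<forall>\<^sub>F \<rho> in at_top. \<rho> powr (\<nu> - \<epsilon>) \<le> \<rho>s \<rho> \<and> \<rho>s \<rho> \<le> \<rho> powr (\<nu> + \<epsilon>)"
proof -
  have "\<forall>\<^sub>F \<rho> in at_top. dist (ln (\<rho>s \<rho>) / ln \<rho>) \<nu> < \<epsilon>" using \<rho>s_lim assms by (rule tendstoD)
  then show ?thesis
    using eventually_gt_at_top[of 1]
  proof eventually_elim
    case (elim \<rho>)
    have l: "ln \<rho> > 0" using elim by simp
    have "\<nu> - \<epsilon> \<le> ln (\<rho>s \<rho>) / ln \<rho>" "ln (\<rho>s \<rho>) / ln \<rho> \<le> \<nu> + \<epsilon>" using elim(1) by (auto simp: dist_real_def abs_less_iff)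
    then have "(\<nu> - \<epsilon>) * ln \<rho> \<le> ln (\<rho>s \<rho>)" "ln (\<rho>s \<rho>) \<le> (\<nu> + \<epsilon>) * ln \<rho>"
      using l by (auto simp: pos_le_divide_eq pos_divide_le_eq)
    moreover have "0 < \<rho>s \<rho>" using \<rho>s_pos elim by simp
    ultimately show ?case using elim by (auto simp: powr_def ln_ge_iff) (metis exp_le_cancel_iff exp_ln)
  qed
qed

lemma side_integral_le_exp:
  assumes x: "0 \<le> x"
  shows "le_exp (\<lambda>\<rho>. side_integral (\<rho>s \<rho>) (\<rho> powr x)) (max \<nu> x)"
proof (cases "\<nu> \<le> x")
  case True
  show ?thesis
  proof (rule le_exp_cmult)
    fix \<epsilon> :: real assume \<epsilon>: "0 < \<epsilon>"
    have "\<forall>\<^sub>F \<rho> in at_top. side_integral (\<rho>s \<rho>) (\<rho> powr x) \<le> ennreal (1 * \<rho> powr (- max \<nu> x + \<epsilon>))"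
      using eventually_ge_at_top[of 1]
    proof eventually_elim
      case (elim \<rho>)
      have "side_integral (\<rho>s \<rho>) (\<rho> powr x) \<le> ennreal (1 / \<rho> powr x)"
        using elim by (intro side_integral_le_inverse \<rho>s_pos) auto
      also have "1 / \<rho> powr x = \<rho> powr (- x)" by (simp add: powr_minus divide_inverse)
      also have "ennreal (\<rho> powr (- x)) \<le> ennreal (1 * \<rho> powr (- max \<nu> x + \<epsilon>))"
        using elim \<epsilon> True by (auto intro!: ennreal_leI powr_mono)
      finally show ?case .
    qed
    then show "\<exists>C. \<forall>\<^sub>F \<rho> in at_top. side_integral (\<rho>s \<rho>) (\<rho> powr x) \<le> ennreal (C * \<rho> powr (- max \<nu> x + \<epsilon>))" by blast
  qed
next
  case False
  show ?thesis
  proof (rule le_exp_cmult)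
    fix \<epsilon> :: real assume \<epsilon>: "0 < \<epsilon>"
    \<comment> \<open>The weakened power of \<open>\<rho>s\<close> loses \<delta> \<nu>, and the
      approximation of \<open>\<rho>s\<close> by a power of \<rho> loses at most \<epsilon>/2; the
      choice keeps the sum within \<epsilon>.\<close>
    define \<delta> where "\<delta> = min 1 (\<epsilon> / (2 * (\<nu> + 1)))"
    have \<delta>: "0 < \<delta>" "\<delta> \<le> 1" "\<delta> * \<nu> \<le> \<epsilon> / 2"
    proof -
      show "0 < \<delta>" "\<delta> \<le> 1" using \<epsilon> \<nu> by (auto simp: \<delta>_def)
      have "\<delta> * \<nu> \<le> \<epsilon> / (2 * (\<nu> + 1)) * (\<nu> + 1)" using \<epsilon> \<nu> by (intro mult_mono) (auto simp: \<delta>_def)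
      also have "\<dots> = \<epsilon> / 2" using \<nu> by (simp add: field_simps)
      finally show "\<delta> * \<nu> \<le> \<epsilon> / 2" .
    qed
    have "\<forall>\<^sub>F \<rho> in at_top. side_integral (\<rho>s \<rho>) (\<rho> powr x) \<le> ennreal (Gamma \<delta> * \<rho> powr (- max \<nu> x + \<epsilon>))"
      using eventually_ge_at_top[of 1] rho_s_bounds[OF half_gt_zero[OF \<epsilon>]]
    proof eventually_elim
      case (elim \<rho>)
      have "side_integral (\<rho>s \<rho>) (\<rho> powr x) \<le> ennreal (Gamma \<delta> * \<rho>s \<rho> powr (\<delta> - 1))"
        using elim \<delta> x by (intro side_integral_le_powr \<rho>s_pos) (auto intro: ge_one_powr_ge_zero)
      also have "\<dots> \<le> ennreal (Gamma \<delta> * \<rho> powr (- max \<nu> x + \<epsilon>))"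
      proof (intro ennreal_leI mult_left_mono)
        have "\<rho>s \<rho> powr (\<delta> - 1) \<le> (\<rho> powr (\<nu> - \<epsilon>/2)) powr (\<delta> - 1)"
          using elim \<delta> by (intro powr_mono2') auto
        also have "\<dots> = \<rho> powr ((\<nu> - \<epsilon>/2) * (\<delta> - 1))" by (simp add: powr_powr)
        also have "\<dots> \<le> \<rho> powr (- max \<nu> x + \<epsilon>)"
        proof (rule powr_mono)
          have "(\<nu> - \<epsilon>/2) * (\<delta> - 1) = \<delta> * \<nu> - \<nu> + \<epsilon>/2 - \<epsilon> * \<delta> / 2" by (simp add: field_simps)
          also have "\<dots> \<le> - \<nu> + \<epsilon>" using \<delta> \<epsilon> by (smt (verit) mult_nonneg_nonneg divide_nonneg_pos field_sum_of_halves)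
          finally show "(\<nu> - \<epsilon>/2) * (\<delta> - 1) \<le> - max \<nu> x + \<epsilon>" using False by simp
        qed (use elim in auto)
        finally show "\<rho>s \<rho> powr (\<delta> - 1) \<le> \<rho> powr (- max \<nu> x + \<epsilon>)" .
      qed (use \<delta> Gamma_real_pos[of \<delta>] in auto)
      finally show ?case .
    qed
    then show "\<exists>C. \<forall>\<^sub>F \<rho> in at_top. side_integral (\<rho>s \<rho>) (\<rho> powr x) \<le> ennreal (C * \<rho> powr (- max \<nu> x + \<epsilon>))" by blast
  qed
qed

lemma weak_side_integral_ge_exp:
  "ge_exp (\<lambda>\<rho>. weak_side_integral (\<rho>s \<rho>) (\<rho> powr x)) (max \<nu> x)"
proof (rule ge_exp_cmult)
  fix \<epsilon> :: real assume \<epsilon>: "0 < \<epsilon>"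
  have "\<forall>\<^sub>F \<rho> in at_top. ennreal (exp (-1) / 2 * \<rho> powr (- max \<nu> x - \<epsilon>)) \<le> weak_side_integral (\<rho>s \<rho>) (\<rho> powr x)"
    using eventually_ge_at_top[of 1] rho_s_bounds[OF \<epsilon>]
  proof eventually_elim
    case (elim \<rho>)
    have s: "\<rho>s \<rho> > 0" using \<rho>s_pos elim by simp
    have "\<rho>s \<rho> \<le> \<rho> powr (max \<nu> x + \<epsilon>)" "\<rho> powr x \<le> \<rho> powr (max \<nu> x + \<epsilon>)"
      using elim \<epsilon> order_trans[OF _ powr_mono[of "\<nu> + \<epsilon>" "max \<nu> x + \<epsilon>" \<rho>]] by (auto intro!: powr_mono)
    then have "max (\<rho> powr x) (\<rho>s \<rho>) \<le> \<rho> powr (max \<nu> x + \<epsilon>)" by simp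
    then have "exp (-1) / 2 / \<rho> powr (max \<nu> x + \<epsilon>) \<le> exp (-1) / 2 / max (\<rho> powr x) (\<rho>s \<rho>)"
      using s elim by (intro divide_left_mono mult_pos_pos) auto
    moreover have "exp (-1) / 2 / \<rho> powr (max \<nu> x + \<epsilon>) = exp (-1) / 2 * \<rho> powr (- max \<nu> x - \<epsilon>)"
      using powr_minus_divide[of \<rho> "max \<nu> x + \<epsilon>"] by simp
    ultimately have "ennreal (exp (-1) / 2 * \<rho> powr (- max \<nu> x - \<epsilon>)) \<le> ennreal (exp (-1) / 2 / max (\<rho> powr x) (\<rho>s \<rho>))"
      by (intro ennreal_leI) simp
    also have "\<dots> \<le> weak_side_integral (\<rho>s \<rho>) (\<rho> powr x)"
      using elim s by (intro weak_side_integral_ge) auto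
    finally show ?case .
  qed
  then show "\<exists>C>0. \<forall>\<^sub>F \<rho> in at_top. ennreal (C * \<rho> powr (- max \<nu> x - \<epsilon>)) \<le> weak_side_integral (\<rho>s \<rho>) (\<rho> powr x)"
    by (intro exI[of _ "exp (-1) / 2"]) auto
qed

end

section \<open>Expected distortion\<close>

definition cum_exponent :: "real \<Rightarrow> nat \<Rightarrow> (nat \<Rightarrow> real) \<Rightarrow> nat \<Rightarrow> real" where
  "cum_exponent b L r l = b / real L * (\<Sum>i\<in>{1..l}. r i)"

definition expected_distortion :: "('t::finite \<times> 'r::finite) itself \<Rightarrow> real \<Rightarrow> (real \<Rightarrow> real) \<Rightarrow> nat \<Rightarrow> (nat \<Rightarrow> real) \<Rightarrow> real \<Rightarrow> ennreal" where
  "expected_distortion T b \<rho>s L r \<rho> = (\<integral>\<^sup>+ H. (\<integral>\<^sup>+ \<gamma>. indicator {0..} \<gamma> *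
        ennreal (exp (- \<gamma>) * ls_distortion b L \<rho> (\<rho>s \<rho>) r (H :: complex^'t^'r) \<gamma>) \<partial>lborel)
      \<partial>gauss_matrix_measure T)"

lemma two_powr_Rbar:
  assumes "0 < \<rho>"
  shows "2 powr (b / real L * Rbar r \<rho> l) = \<rho> powr cum_exponent b L r l"
proof -
  have "b / real L * Rbar r \<rho> l = log 2 \<rho> * cum_exponent b L r l"
    by (simp add: Rbar_def cum_exponent_def sum_distrib_right[symmetric])
  then have "2 powr (b / real L * Rbar r \<rho> l) = (2 powr log 2 \<rho>) powr cum_exponent b L r l"
    by (simp only: powr_powr)
  then show ?thesis using assms by simp
qed

lemma mimo_logdet_eq:
  "mimo_logdet \<rho> (H :: complex^'t::finite^'r::finite) = log 2 (gram_det (\<rho> / real (min_antennas TYPE('t \<times> 'r))) H)"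
  by (simp add: mimo_logdet_def gram_det_def min_antennas_def)

context
  fixes b :: real and L :: nat and r :: "nat \<Rightarrow> real" and \<rho> s :: real
  assumes b: "0 < b" and L: "0 < L" and r: "\<And>l. l \<in> {1..L} \<Longrightarrow> 0 \<le> r l" and \<rho>: "1 \<le> \<rho>" and s: "0 < s"
begin

lemma cum_exponent_step: "1 \<le> l \<Longrightarrow> cum_exponent b L r l = cum_exponent b L r (l - 1) + b / real L * r l"
proof -
  assume "1 \<le> l"
  then obtain k where "l = Suc k" by (cases l) auto
  then show ?thesis by (simp add: cum_exponent_def distrib_left)
qed

lemma cum_exponent_mono: "k \<le> l \<Longrightarrow> l \<le> L \<Longrightarrow> cum_exponent b L r k \<le> cum_exponent b L r l"
  unfolding cum_exponent_def using b r by (intro mult_left_mono sum_mono2) auto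

lemma gram_pos: "0 < gram_det (\<rho> / real (min_antennas TYPE('t::finite \<times> 'r::finite))) (H :: complex^'t^'r)"
  using Phi_eq_inverse_gram_det(1)[of "\<rho> / real (min_antennas TYPE('t \<times> 'r))" H] \<rho> by simp

text \<open>Adding \<gamma> s to numerator and denominator brings a ratio that is at least 1 closer
  to 1: side information only lowers the rate a layer has to carry. The resulting event involves H
  alone.\<close>

lemma outage_imp_gram_det:
  fixes H :: "complex^'t::finite^'r::finite"
  assumes l: "1 \<le> l" "l \<le> L" and \<gamma>: "0 \<le> \<gamma>" and o: "layer_outage b L \<rho> s r H \<gamma> l"
  shows "gram_det (\<rho> / real (min_antennas TYPE('t \<times> 'r))) H \<le> \<rho> powr r l"
proof -
  define A A' where "A = \<rho> powr cum_exponent b L r (l - 1)" and "A' = \<rho> powr cum_exponent b L r l"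
  have A: "0 < A" "A \<le> A'" using \<rho> cum_exponent_mono[of "l - 1" l] l by (auto simp: A_def A'_def intro!: powr_mono)
  have c: "0 \<le> \<gamma> * s" using \<gamma> s by simp
  define X where "X = gram_det (\<rho> / real (min_antennas TYPE('t \<times> 'r))) H"
  have X: "0 < X" unfolding X_def by (rule gram_pos)
  have "(A' + \<gamma> * s) / (A + \<gamma> * s) \<le> A' / A"
  proof -
    have "A * (\<gamma> * s) \<le> A' * (\<gamma> * s)" using A c by (intro mult_right_mono) auto
    then have "(A' + \<gamma> * s) * A \<le> A' * (A + \<gamma> * s)" by (simp add: algebra_simps)
    then show ?thesis using A c by (simp add: divide_le_eq pos_le_divide_eq add_pos_nonneg mult.commute field_simps)
  qed
  moreover have "0 < (A' + \<gamma> * s) / (A + \<gamma> * s)" using A c by (intro divide_pos_pos add_pos_nonneg) auto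
  ultimately have "log 2 ((A' + \<gamma> * s) / (A + \<gamma> * s)) \<le> log 2 (A' / A)" by (simp add: log_le_cancel_iff)
  also have "A' / A = \<rho> powr (b / real L * r l)"
    using cum_exponent_step[OF l(1)] by (simp add: A_def A'_def powr_diff[symmetric])
  also have "log 2 \<dots> = b / real L * (r l * log 2 \<rho>)" using \<rho> by (simp add: log_powr)
  finally have "b / real L * log 2 X \<le> b / real L * (r l * log 2 \<rho>)"
    using o \<rho> unfolding layer_outage_def mimo_logdet_eq two_powr_Rbar[OF less_le_trans[OF zero_less_one \<rho>]] X_def A_def A'_def by linarith
  then have "log 2 X \<le> r l * log 2 \<rho>" using b L by (subst (asm) mult_le_cancel_left_pos) auto
  also have "\<dots> = log 2 (\<rho> powr r l)" using \<rho> by (simp add: log_powr)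
  finally show ?thesis using X \<rho> unfolding X_def[symmetric] by simp
qed

text \<open>For \<gamma> s at most the denominator A the side information at most doubles the
  denominator, which costs one bit; divided by b/L, this bit becomes the factor
  \<open>2 powr (- L / b)\<close>.\<close>

lemma gram_det_imp_outage:
  fixes H :: "complex^'t::finite^'r::finite"
  assumes l: "1 \<le> l" "l \<le> L" and \<gamma>: "0 \<le> \<gamma>" "\<gamma> \<le> \<rho> powr cum_exponent b L r (l - 1) / s"
    and g: "gram_det (\<rho> / real (min_antennas TYPE('t \<times> 'r))) H \<le> 2 powr (- real L / b) * \<rho> powr r l"
  shows "layer_outage b L \<rho> s r H \<gamma> l"
proof -
  define A A' where "A = \<rho> powr cum_exponent b L r (l - 1)" and "A' = \<rho> powr cum_exponent b L r l"
  have A: "0 < A" "0 < A'" using \<rho> by (auto simp: A_def A'_def)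
  have c: "0 \<le> \<gamma> * s" "\<gamma> * s \<le> A" using \<gamma> s by (auto simp: A_def pos_le_divide_eq)
  define X where "X = gram_det (\<rho> / real (min_antennas TYPE('t \<times> 'r))) H"
  have X: "0 < X" unfolding X_def by (rule gram_pos)
  have "log 2 X \<le> log 2 (2 powr (- real L / b) * \<rho> powr r l)" using g X \<rho> by (simp add: X_def)
  also have "\<dots> = - real L / b + r l * log 2 \<rho>" using \<rho> by (simp add: log_mult log_powr)
  finally have "b / real L * log 2 X \<le> b / real L * (- real L / b + r l * log 2 \<rho>)" using b by (intro mult_left_mono) auto
  also have "\<dots> = b / real L * r l * log 2 \<rho> - 1" using b L by (simp add: field_simps)
  also have "\<dots> = log 2 (A' / (2 * A))"
  proof -
    have "A' = A * \<rho> powr (b / real L * r l)" using cum_exponent_step[OF l(1)] by (simp add: A_def A'_def powr_add)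
    then have "A' / (2 * A) = \<rho> powr (b / real L * r l) / 2" using A by simp
    then have "log 2 (A' / (2 * A)) = log 2 (\<rho> powr (b / real L * r l) / 2)" by (simp only:)
    also have "\<dots> = log 2 (\<rho> powr (b / real L * r l)) - log 2 2" using \<rho> by (simp add: log_divide)
    also have "\<dots> = b / real L * r l * log 2 \<rho> - 1" using \<rho> by (simp add: log_powr)
    finally show ?thesis by simp
  qed
  also have "\<dots> \<le> log 2 ((A' + \<gamma> * s) / (A + \<gamma> * s))"
  proof -
    have "A' / (2 * A) \<le> A' / (A + \<gamma> * s)" using A c by (intro divide_left_mono mult_pos_pos add_pos_nonneg) auto
    also have "\<dots> \<le> (A' + \<gamma> * s) / (A + \<gamma> * s)" using A c by (intro divide_right_mono) auto
    finally show ?thesis using A c by (subst log_le_cancel_iff) (auto intro!: divide_pos_pos add_pos_nonneg)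
  qed
  finally show ?thesis
    unfolding layer_outage_def mimo_logdet_eq two_powr_Rbar[OF less_le_trans[OF zero_less_one \<rho>]] X_def A_def A'_def .
qed

text \<open>The value 0 always qualifies and L bounds the candidates, so the greatest one
  exists.\<close>

lemma decoded_layers_props:
  fixes H :: "complex^'t::finite^'r::finite" and \<gamma> :: real
  defines "N \<equiv> decoded_layers b L \<rho> s r H \<gamma>"
  shows "N \<le> L" "\<And>j. j \<in> {1..N} \<Longrightarrow> \<not> layer_outage b L \<rho> s r H \<gamma> j" "N < L \<Longrightarrow> layer_outage b L \<rho> s r H \<gamma> (Suc N)"
proof -
  let ?P = "\<lambda>l. l \<le> L \<and> (\<forall>j\<in>{1..l}. \<not> layer_outage b L \<rho> s r H \<gamma> j)"
  have P: "?P N" unfolding N_def decoded_layers_def by (rule GreatestI_nat[of ?P 0 L]) auto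
  then show "N \<le> L" "\<And>j. j \<in> {1..N} \<Longrightarrow> \<not> layer_outage b L \<rho> s r H \<gamma> j" by auto
  assume "N < L"
  show "layer_outage b L \<rho> s r H \<gamma> (Suc N)"
  proof (rule ccontr)
    assume "\<not> layer_outage b L \<rho> s r H \<gamma> (Suc N)"
    then have "?P (Suc N)" using P \<open>N < L\<close> by (auto simp: le_Suc_eq)
    then have "Suc N \<le> (GREATEST l. ?P l)" by (rule Greatest_le_nat[of ?P "Suc N" L]) blast
    then have "Suc N \<le> N" by (simp only: N_def decoded_layers_def)
    then show False by simp
  qed
qed

lemma ls_distortion_eq:
  "ls_distortion b L \<rho> s r H \<gamma> = 1 / (s * \<gamma> + \<rho> powr cum_exponent b L r (decoded_layers b L \<rho> s r H \<gamma>))"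
  unfolding ls_distortion_def using two_powr_Rbar[of \<rho>] \<rho> by simp

lemma side_antimono:
  assumes "0 \<le> \<gamma>" "k \<le> l" "l \<le> L"
  shows "1 / (s * \<gamma> + \<rho> powr cum_exponent b L r l) \<le> 1 / (s * \<gamma> + \<rho> powr cum_exponent b L r k)"
  using assms s \<rho> cum_exponent_mono[OF assms(2,3)]
  by (intro divide_left_mono mult_pos_pos add_nonneg_pos add_left_mono powr_mono) auto

lemma side_nonneg: "0 \<le> \<gamma> \<Longrightarrow> 0 \<le> 1 / (s * \<gamma> + \<rho> powr x)"
  using s by simp

text \<open>The first layer in outage fixes the distortion, so the summand of that layer, or the
  last term if there is none, already accounts for it. After integration this is the union
  bound.\<close>

lemma ls_distortion_upper:
  fixes H :: "complex^'t::finite^'r::finite"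
  assumes \<gamma>: "0 \<le> \<gamma>"
  shows "ls_distortion b L \<rho> s r H \<gamma> \<le>
    (\<Sum>l\<in>{1..L}. indicator {H. gram_det (\<rho> / real (min_antennas TYPE('t \<times> 'r))) H \<le> \<rho> powr r l} H * (1 / (s * \<gamma> + \<rho> powr cum_exponent b L r (l - 1))))
      + 1 / (s * \<gamma> + \<rho> powr cum_exponent b L r L)" (is "_ \<le> (\<Sum>l\<in>_. ?f l) + _")
proof -
  define N where "N = decoded_layers b L \<rho> s r H \<gamma>"
  note P = decoded_layers_props[where H = H and \<gamma> = \<gamma>, folded N_def]
  have f: "0 \<le> ?f l" for l using side_nonneg[OF \<gamma>] by simp
  show ?thesis
  proof (cases "N < L")
    case True
    then have "gram_det (\<rho> / real (min_antennas TYPE('t \<times> 'r))) H \<le> \<rho> powr r (Suc N)"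
      using P \<gamma> by (intro outage_imp_gram_det) auto
    then have "ls_distortion b L \<rho> s r H \<gamma> = ?f (Suc N)"
      by (simp add: ls_distortion_eq N_def)
    also have "\<dots> \<le> (\<Sum>l\<in>{1..L}. ?f l)" using True f by (intro member_le_sum) auto
    finally show ?thesis using side_nonneg[OF \<gamma>, of "cum_exponent b L r L"] by linarith
  next
    case False
    then have "N = L" using P by simp
    then show ?thesis using sum_nonneg[of "{1..L}" ?f] f by (simp add: ls_distortion_eq N_def[symmetric])
  qed
qed

lemma ls_distortion_ge_all:
  "0 \<le> \<gamma> \<Longrightarrow> 1 / (s * \<gamma> + \<rho> powr cum_exponent b L r L) \<le> ls_distortion b L \<rho> s r H \<gamma>"
  unfolding ls_distortion_eq by (intro side_antimono decoded_layers_props(1)) auto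

text \<open>Keeps the expectation finite, since \<open>enn2real\<close> maps an infinite value to
  the default 0.\<close>

lemma ls_distortion_le_1:
  "0 \<le> \<gamma> \<Longrightarrow> ls_distortion b L \<rho> s r H \<gamma> \<le> 1"
proof -
  assume \<gamma>: "0 \<le> \<gamma>"
  have "ls_distortion b L \<rho> s r H \<gamma> \<le> 1 / (s * \<gamma> + \<rho> powr cum_exponent b L r 0)"
    unfolding ls_distortion_eq using \<gamma> by (intro side_antimono decoded_layers_props(1)) auto
  also have "\<dots> \<le> 1 / 1"
    using \<gamma> s \<rho> by (intro divide_left_mono) (auto simp: cum_exponent_def intro!: add_nonneg_pos)
  also have "1 / 1 = (1::real)" by simp
  finally show ?thesis .
qed

lemma ls_distortion_ge_outage:
  assumes \<gamma>: "0 \<le> \<gamma>" and l: "1 \<le> l" "l \<le> L" and o: "layer_outage b L \<rho> s r H \<gamma> l"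
  shows "1 / (s * \<gamma> + \<rho> powr cum_exponent b L r (l - 1)) \<le> ls_distortion b L \<rho> s r H \<gamma>"
proof -
  have "decoded_layers b L \<rho> s r H \<gamma> < l"
    using decoded_layers_props(2)[where H = H and \<gamma> = \<gamma> and j = l] o l by (meson atLeastAtMost_iff not_less)
  then show ?thesis unfolding ls_distortion_eq using \<gamma> l by (intro side_antimono) auto
qed

end

lemma gram_det_set_measurable:
  "{H :: complex^'t::finite^'r::finite. gram_det \<rho> H \<le> y} \<in> sets (gauss_matrix_measure TYPE('t \<times> 'r))"
proof -
  have "{H :: complex^'t^'r. gram_det \<rho> H \<le> y} \<in> sets borel"
    using gram_det_measurable[of \<rho>] by measurable
  then show ?thesis by simp
qed

lemma nn_integral_gram_det_indicator:
  "(\<integral>\<^sup>+H. indicator {H :: complex^'t::finite^'r::finite. gram_det \<rho> H \<le> y} H * c \<partial>gauss_matrix_measure TYPE('t \<times> 'r))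
     = emeasure (gauss_matrix_measure TYPE('t \<times> 'r)) {H. gram_det \<rho> H \<le> y} * c"
  by (subst nn_integral_multc[OF borel_measurable_indicator[OF gram_det_set_measurable]])
    (subst nn_integral_indicator[OF gram_det_set_measurable], rule refl)

lemma side_integrand_measurable:
  "(\<lambda>\<gamma>::real. indicator {0..} \<gamma> * ennreal (exp (- \<gamma>) * (1 / (s * \<gamma> + A)))) \<in> borel_measurable lborel"
  by measurable

lemma gauss_matrix_total: "emeasure (gauss_matrix_measure TYPE('t::finite \<times> 'r::finite)) (space (gauss_matrix_measure TYPE('t \<times> 'r))) = 1"
  using emeasure_gauss_matrix_space[where 't = 't and 'r = 'r] by (simp add: gauss_matrix_measure_def)

text \<open>The distortion is replaced under both integrals by an explicit majorant, by monotonicity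
  alone, which asks for no measurability. In the majorant H and \<gamma> separate.\<close>

lemma expected_distortion_upper:
  assumes b: "0 < b" and L: "0 < L" and r: "\<And>l. l \<in> {1..L} \<Longrightarrow> 0 \<le> r l" and \<rho>: "1 \<le> \<rho>" and s: "0 < \<rho>s \<rho>"
  shows "expected_distortion TYPE('t::finite \<times> 'r::finite) b \<rho>s L r \<rho> \<le>
    (\<Sum>l\<in>{1..L}. out_prob TYPE('t \<times> 'r) (\<rho> powr r l) \<rho> * side_integral (\<rho>s \<rho>) (\<rho> powr cum_exponent b L r (l - 1)))
      + side_integral (\<rho>s \<rho>) (\<rho> powr cum_exponent b L r L)"
proof -
  let ?M = "gauss_matrix_measure TYPE('t \<times> 'r)"
  define G where "G l = {H :: complex^'t^'r. gram_det (\<rho> / real (min_antennas TYPE('t \<times> 'r))) H \<le> \<rho> powr r l}" for l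
  define J where "J l = side_integral (\<rho>s \<rho>) (\<rho> powr cum_exponent b L r l)" for l
  define h where "h l \<gamma> = indicator {0..} \<gamma> * ennreal (exp (- \<gamma>) * (1 / (\<rho>s \<rho> * \<gamma> + \<rho> powr cum_exponent b L r l)))" for l and \<gamma> :: real
  have hm: "h l \<in> borel_measurable lborel" for l unfolding h_def by (rule side_integrand_measurable)
  have hJ: "(\<integral>\<^sup>+\<gamma>. h l \<gamma> \<partial>lborel) = J l" for l by (simp add: h_def J_def side_integral_def)
  have P: "(\<integral>\<^sup>+H. indicator (G l) H * J (l - 1) \<partial>?M) = out_prob TYPE('t \<times> 'r) (\<rho> powr r l) \<rho> * J (l - 1)" for l
    unfolding G_def out_prob_def by (rule nn_integral_gram_det_indicator)
  have "(\<integral>\<^sup>+ \<gamma>. indicator {0..} \<gamma> * ennreal (exp (- \<gamma>) * ls_distortion b L \<rho> (\<rho>s \<rho>) r H \<gamma>) \<partial>lborel)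
      \<le> (\<Sum>l\<in>{1..L}. indicator (G l) H * J (l - 1)) + J L" for H :: "complex^'t^'r"
  proof -
    have "(\<integral>\<^sup>+ \<gamma>. indicator {0..} \<gamma> * ennreal (exp (- \<gamma>) * ls_distortion b L \<rho> (\<rho>s \<rho>) r H \<gamma>) \<partial>lborel)
      \<le> (\<integral>\<^sup>+ \<gamma>. (\<Sum>l\<in>{1..L}. indicator (G l) H * h (l - 1) \<gamma>) + h L \<gamma> \<partial>lborel)"
    proof (rule nn_integral_mono)
      fix \<gamma> :: real
      show "indicator {0..} \<gamma> * ennreal (exp (- \<gamma>) * ls_distortion b L \<rho> (\<rho>s \<rho>) r H \<gamma>) \<le> (\<Sum>l\<in>{1..L}. indicator (G l) H * h (l - 1) \<gamma>) + h L \<gamma>"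
      proof (cases "0 \<le> \<gamma>")
        case True
        let ?d = "\<lambda>l. 1 / (\<rho>s \<rho> * \<gamma> + \<rho> powr cum_exponent b L r l)"
        have d: "0 \<le> ?d l" for l using True s by simp
        have "exp (- \<gamma>) * ls_distortion b L \<rho> (\<rho>s \<rho>) r H \<gamma> \<le> exp (- \<gamma>) * ((\<Sum>l\<in>{1..L}. indicator (G l) H * ?d (l - 1)) + ?d L)"
          unfolding G_def using ls_distortion_upper[where H = H, OF b L r \<rho> s True] by (intro mult_left_mono) auto
        also have "\<dots> = (\<Sum>l\<in>{1..L}. indicator (G l) H * (exp (- \<gamma>) * ?d (l - 1))) + exp (- \<gamma>) * ?d L"
          unfolding distrib_left sum_distrib_left by (intro arg_cong2[where f="(+)"] sum.cong refl) (simp only: mult_ac)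
        finally have "ennreal (exp (- \<gamma>) * ls_distortion b L \<rho> (\<rho>s \<rho>) r H \<gamma>) \<le> ennreal (\<dots>)" by (rule ennreal_leI)
        also have "\<dots> = (\<Sum>l\<in>{1..L}. ennreal (indicator (G l) H * (exp (- \<gamma>) * ?d (l - 1)))) + ennreal (exp (- \<gamma>) * ?d L)"
          using d by (subst ennreal_plus) (auto intro!: sum_nonneg simp: sum_ennreal)
        also have "\<dots> = (\<Sum>l\<in>{1..L}. indicator (G l) H * h (l - 1) \<gamma>) + h L \<gamma>"
          using True by (intro arg_cong2[where f="(+)"] sum.cong refl) (auto simp: h_def indicator_def)
        finally show ?thesis using True by simp
      qed simp
    qed
    also have "\<dots> = (\<Sum>l\<in>{1..L}. \<integral>\<^sup>+ \<gamma>. indicator (G l) H * h (l - 1) \<gamma> \<partial>lborel) + J L"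
    proof -
      have m: "(\<lambda>\<gamma>. indicator (G l) H * h (l - 1) \<gamma>) \<in> borel_measurable lborel" for l
        by (intro borel_measurable_times_ennreal borel_measurable_const hm)
      have ms: "(\<lambda>\<gamma>. \<Sum>l\<in>{1..L}. indicator (G l) H * h (l - 1) \<gamma>) \<in> borel_measurable lborel"
        by (intro borel_measurable_sum m)
      show ?thesis by (simp only: nn_integral_add[OF ms hm] nn_integral_sum[OF m] hJ)
    qed
    also have "\<dots> = (\<Sum>l\<in>{1..L}. indicator (G l) H * J (l - 1)) + J L"
      by (simp only: nn_integral_cmult[OF hm] hJ)
    finally show ?thesis .
  qed
  then have "expected_distortion TYPE('t \<times> 'r) b \<rho>s L r \<rho> \<le> (\<integral>\<^sup>+H. (\<Sum>l\<in>{1..L}. indicator (G l) H * J (l - 1)) + J L \<partial>?M)"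
    unfolding expected_distortion_def by (intro nn_integral_mono)
  also have "\<dots> = (\<Sum>l\<in>{1..L}. (\<integral>\<^sup>+H. indicator (G l) H * J (l - 1) \<partial>?M)) + (\<integral>\<^sup>+H. J L \<partial>?M)"
  proof -
    have m: "(\<lambda>H. indicator (G l) H * J (l - 1)) \<in> borel_measurable ?M" for l
      unfolding G_def by (intro borel_measurable_times_ennreal borel_measurable_indicator gram_det_set_measurable) simp
    have ms: "(\<lambda>H. \<Sum>l\<in>{1..L}. indicator (G l) H * J (l - 1)) \<in> borel_measurable ?M"
      by (intro borel_measurable_sum m)
    show ?thesis by (simp only: nn_integral_add[OF ms borel_measurable_const] nn_integral_sum[OF m])
  qed
  also have "(\<integral>\<^sup>+H. J L \<partial>?M) = J L" by (simp add: gauss_matrix_total)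
  finally have "expected_distortion TYPE('t \<times> 'r) b \<rho>s L r \<rho> \<le> (\<Sum>l\<in>{1..L}. out_prob TYPE('t \<times> 'r) (\<rho> powr r l) \<rho> * J (l - 1)) + J L"
    by (simp only: P)
  then show ?thesis by (simp only: J_def)
qed

lemma expected_distortion_ge_all:
  assumes b: "0 < b" and L: "0 < L" and r: "\<And>l. l \<in> {1..L} \<Longrightarrow> 0 \<le> r l" and \<rho>: "1 \<le> \<rho>" and s: "0 < \<rho>s \<rho>"
  shows "side_integral (\<rho>s \<rho>) (\<rho> powr cum_exponent b L r L) \<le> expected_distortion TYPE('t::finite \<times> 'r::finite) b \<rho>s L r \<rho>"
proof -
  let ?M = "gauss_matrix_measure TYPE('t \<times> 'r)"
  have "side_integral (\<rho>s \<rho>) (\<rho> powr cum_exponent b L r L) = (\<integral>\<^sup>+H. side_integral (\<rho>s \<rho>) (\<rho> powr cum_exponent b L r L) \<partial>?M)"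
    by (simp add: gauss_matrix_total)
  also have "\<dots> \<le> expected_distortion TYPE('t \<times> 'r) b \<rho>s L r \<rho>"
    unfolding expected_distortion_def side_integral_def
  proof (intro nn_integral_mono)
    fix H :: "complex^'t^'r" and \<gamma> :: real
    show "indicator {0..} \<gamma> * ennreal (exp (- \<gamma>) * (1 / (\<rho>s \<rho> * \<gamma> + \<rho> powr cum_exponent b L r L)))
      \<le> indicator {0..} \<gamma> * ennreal (exp (- \<gamma>) * ls_distortion b L \<rho> (\<rho>s \<rho>) r H \<gamma>)"
    proof (cases "0 \<le> \<gamma>")
      case True
      then show ?thesis using ls_distortion_ge_all[where H = H, OF b L r \<rho> s True]
        by (intro mult_left_mono ennreal_leI) auto
    qed simp
  qed
  finally show ?thesis .
qed

lemma expected_distortion_le_1: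
  assumes b: "0 < b" and L: "0 < L" and r: "\<And>l. l \<in> {1..L} \<Longrightarrow> 0 \<le> r l" and \<rho>: "1 \<le> \<rho>" and s: "0 < \<rho>s \<rho>"
  shows "expected_distortion TYPE('t::finite \<times> 'r::finite) b \<rho>s L r \<rho> \<le> 1"
proof -
  let ?M = "gauss_matrix_measure TYPE('t \<times> 'r)"
  have "expected_distortion TYPE('t \<times> 'r) b \<rho>s L r \<rho> \<le> (\<integral>\<^sup>+H. (\<integral>\<^sup>+\<gamma>. indicator {0..} \<gamma> * ennreal (exp (- \<gamma>)) \<partial>lborel) \<partial>?M)"
    unfolding expected_distortion_def
  proof (intro nn_integral_mono)
    fix H :: "complex^'t^'r" and \<gamma> :: real
    show "indicator {0..} \<gamma> * ennreal (exp (- \<gamma>) * ls_distortion b L \<rho> (\<rho>s \<rho>) r H \<gamma>) \<le> indicator {0..} \<gamma> * ennreal (exp (- \<gamma>))"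
    proof (cases "0 \<le> \<gamma>")
      case True
      then show ?thesis using ls_distortion_le_1[where H = H, OF b L r \<rho> s True]
        by (intro mult_left_mono ennreal_leI) (auto simp: mult_le_cancel_left1)
    qed simp
  qed
  also have "\<dots> = 1" by (simp add: nn_integral_exp_neg gauss_matrix_total)
  finally show ?thesis .
qed

text \<open>If H satisfies the determinant bound and \<gamma> is at most
  \<open>A / \<rho>s \<rho>\<close>, layer l is in outage. One condition restricts H only and the
  other \<gamma> only, so the double integral factors.\<close>

lemma expected_distortion_ge_outage:
  assumes b: "0 < b" and L: "0 < L" and r: "\<And>l. l \<in> {1..L} \<Longrightarrow> 0 \<le> r l" and \<rho>: "1 \<le> \<rho>" and s: "0 < \<rho>s \<rho>"
    and l: "1 \<le> l" "l \<le> L"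
  shows "out_prob TYPE('t::finite \<times> 'r::finite) (2 powr (- real L / b) * \<rho> powr r l) \<rho> * weak_side_integral (\<rho>s \<rho>) (\<rho> powr cum_exponent b L r (l - 1))
     \<le> expected_distortion TYPE('t \<times> 'r) b \<rho>s L r \<rho>"
proof -
  let ?M = "gauss_matrix_measure TYPE('t \<times> 'r)"
  define G where "G = {H :: complex^'t^'r. gram_det (\<rho> / real (min_antennas TYPE('t \<times> 'r))) H \<le> 2 powr (- real L / b) * \<rho> powr r l}"
  define A where "A = \<rho> powr cum_exponent b L r (l - 1)"
  have "out_prob TYPE('t \<times> 'r) (2 powr (- real L / b) * \<rho> powr r l) \<rho> * weak_side_integral (\<rho>s \<rho>) A = (\<integral>\<^sup>+H. indicator G H * weak_side_integral (\<rho>s \<rho>) A \<partial>?M)"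
    by (simp only: G_def out_prob_def nn_integral_gram_det_indicator)
  also have "\<dots> \<le> expected_distortion TYPE('t \<times> 'r) b \<rho>s L r \<rho>"
    unfolding expected_distortion_def
  proof (rule nn_integral_mono)
    fix H :: "complex^'t^'r"
    show "indicator G H * weak_side_integral (\<rho>s \<rho>) A \<le> (\<integral>\<^sup>+ \<gamma>. indicator {0..} \<gamma> * ennreal (exp (- \<gamma>) * ls_distortion b L \<rho> (\<rho>s \<rho>) r H \<gamma>) \<partial>lborel)"
    proof (cases "H \<in> G")
      case True
      have "weak_side_integral (\<rho>s \<rho>) A \<le> (\<integral>\<^sup>+ \<gamma>. indicator {0..} \<gamma> * ennreal (exp (- \<gamma>) * ls_distortion b L \<rho> (\<rho>s \<rho>) r H \<gamma>) \<partial>lborel)"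
        unfolding weak_side_integral_def
      proof (rule nn_integral_mono)
        fix \<gamma> :: real
        show "indicator {0..} \<gamma> * ennreal (indicator {..A / \<rho>s \<rho>} \<gamma> * exp (- \<gamma>) * (1 / (\<rho>s \<rho> * \<gamma> + A)))
           \<le> indicator {0..} \<gamma> * ennreal (exp (- \<gamma>) * ls_distortion b L \<rho> (\<rho>s \<rho>) r H \<gamma>)"
        proof (cases "0 \<le> \<gamma> \<and> \<gamma> \<le> A / \<rho>s \<rho>")
          case \<gamma>: True
          have "layer_outage b L \<rho> (\<rho>s \<rho>) r H \<gamma> l"
          proof (rule gram_det_imp_outage[OF b L r \<rho> s l])
            show "0 \<le> \<gamma>" "\<gamma> \<le> \<rho> powr cum_exponent b L r (l - 1) / \<rho>s \<rho>" using \<gamma> by (simp_all add: A_def)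
            show "gram_det (\<rho> / real (min_antennas TYPE('t \<times> 'r))) H \<le> 2 powr (- real L / b) * \<rho> powr r l"
              using True by (simp add: G_def)
          qed
          then have "1 / (\<rho>s \<rho> * \<gamma> + A) \<le> ls_distortion b L \<rho> (\<rho>s \<rho>) r H \<gamma>"
            unfolding A_def using \<gamma> by (intro ls_distortion_ge_outage[OF b L r \<rho> s _ l]) auto
          then have "exp (- \<gamma>) * (1 / (\<rho>s \<rho> * \<gamma> + A)) \<le> exp (- \<gamma>) * ls_distortion b L \<rho> (\<rho>s \<rho>) r H \<gamma>"
            by (intro mult_left_mono) auto
          then show ?thesis using \<gamma> by (auto simp: indicator_def intro!: ennreal_leI)
        next
          case False
          then have "indicator {0..} \<gamma> = (0::ennreal) \<or> indicator {..A / \<rho>s \<rho>} \<gamma> = (0::real)" by (auto simp: indicator_def)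
          then show ?thesis by auto
        qed
      qed
      then show ?thesis using True by simp
    qed simp
  qed
  finally show ?thesis unfolding A_def .
qed

section \<open>From exponential order to the distortion exponent\<close>

lemma has_exponentI:
  assumes le: "le_exp (expected_distortion T b \<rho>s L r) e" and ge: "ge_exp (expected_distortion T b \<rho>s L r) e"
  shows "ls_has_exponent T b \<rho>s L r e"
  unfolding ls_has_exponent_def
proof (rule tendstoI)
  fix \<epsilon> :: real assume \<epsilon>: "0 < \<epsilon>"
  have "\<forall>\<^sub>F \<rho> in at_top. expected_distortion T b \<rho>s L r \<rho> \<le> ennreal (\<rho> powr (- e + \<epsilon>/2))"
    "\<forall>\<^sub>F \<rho> in at_top. ennreal (\<rho> powr (- e - \<epsilon>/2)) \<le> expected_distortion T b \<rho>s L r \<rho>"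
    by (rule le[unfolded le_exp_def, rule_format, OF half_gt_zero[OF \<epsilon>]], rule ge[unfolded ge_exp_def, rule_format, OF half_gt_zero[OF \<epsilon>]])
  then show "\<forall>\<^sub>F \<rho> in at_top. dist (- log 2 (ls_expected_distortion T b \<rho>s L r \<rho>) / log 2 \<rho>) e < \<epsilon>"
    using eventually_gt_at_top[of 1]
  proof eventually_elim
    case (elim \<rho>)
    define x where "x = ls_expected_distortion T b \<rho>s L r \<rho>"
    have x: "x = enn2real (expected_distortion T b \<rho>s L r \<rho>)" by (simp add: x_def ls_expected_distortion_def expected_distortion_def)
    have "expected_distortion T b \<rho>s L r \<rho> < top" using elim(1) by (auto intro: le_less_trans)
    then have "expected_distortion T b \<rho>s L r \<rho> = ennreal x" "0 \<le> x" by (auto simp: x)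
    then have "x \<le> \<rho> powr (- e + \<epsilon>/2)" "\<rho> powr (- e - \<epsilon>/2) \<le> x" using elim by auto
    moreover have "0 < \<rho> powr (- e - \<epsilon>/2)" using elim by simp
    moreover from calculation have "0 < x" by linarith
    ultimately have "log 2 (\<rho> powr (- e - \<epsilon>/2)) \<le> log 2 x" "log 2 x \<le> log 2 (\<rho> powr (- e + \<epsilon>/2))"
      using elim(3) by simp_all
    then have "(- e - \<epsilon>/2) * log 2 \<rho> \<le> log 2 x" "log 2 x \<le> (- e + \<epsilon>/2) * log 2 \<rho>"
      using elim by (auto simp: log_powr)
    moreover have l: "0 < log 2 \<rho>" using elim by simp
    ultimately have "- e - \<epsilon>/2 \<le> log 2 x / log 2 \<rho>" "log 2 x / log 2 \<rho> \<le> - e + \<epsilon>/2"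
      by (auto simp: pos_le_divide_eq pos_divide_le_eq)
    then show ?case using \<epsilon> unfolding x_def[symmetric] dist_real_def by (auto simp: abs_less_iff)
  qed
qed

text \<open>Finiteness matters here: for an infinite expectation \<open>enn2real\<close> is 0, and a
  lower bound on the expectation would say nothing about the logarithm.\<close>

lemma exponent_le:
  assumes ex: "ls_has_exponent T b \<rho>s L r \<Delta>" and ge: "ge_exp (expected_distortion T b \<rho>s L r) e"
    and fin: "\<forall>\<^sub>F \<rho> in at_top. expected_distortion T b \<rho>s L r \<rho> \<le> 1"
  shows "\<Delta> \<le> e"
proof (rule field_le_epsilon)
  fix \<epsilon> :: real assume \<epsilon>: "0 < \<epsilon>"
  have "\<forall>\<^sub>F \<rho> in at_top. ennreal (\<rho> powr (- e - \<epsilon>)) \<le> expected_distortion T b \<rho>s L r \<rho>"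
    by (rule ge[unfolded ge_exp_def, rule_format, OF \<epsilon>])
  then have "\<forall>\<^sub>F \<rho> in at_top. - log 2 (ls_expected_distortion T b \<rho>s L r \<rho>) / log 2 \<rho> \<le> e + \<epsilon>"
    using eventually_gt_at_top[of 1] fin
  proof eventually_elim
    case (elim \<rho>)
    define x where "x = ls_expected_distortion T b \<rho>s L r \<rho>"
    have x: "x = enn2real (expected_distortion T b \<rho>s L r \<rho>)" by (simp add: x_def ls_expected_distortion_def expected_distortion_def)
    have "expected_distortion T b \<rho>s L r \<rho> < top" using elim(3) by (auto intro: le_less_trans)
    then have "expected_distortion T b \<rho>s L r \<rho> = ennreal x" "0 \<le> x" by (auto simp: x)
    then have 1: "\<rho> powr (- e - \<epsilon>) \<le> x" using elim by auto
    moreover have 2: "0 < \<rho> powr (- e - \<epsilon>)" using elim by simp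
    ultimately have "log 2 (\<rho> powr (- e - \<epsilon>)) \<le> log 2 x"
      using less_le_trans[OF 2 1] by (subst log_le_cancel_iff) auto
    then have "(- e - \<epsilon>) * log 2 \<rho> \<le> log 2 x"
      using elim by (auto simp: log_powr)
    moreover have l: "0 < log 2 \<rho>" using elim by simp
    ultimately have "- e - \<epsilon> \<le> log 2 x / log 2 \<rho>"
      by (auto simp: pos_le_divide_eq pos_divide_le_eq)
    then show ?case unfolding x_def[symmetric] by simp
  qed
  then show "\<Delta> \<le> e + \<epsilon>"
    using ex unfolding ls_has_exponent_def by (intro tendsto_upperbound) auto
qed

section \<open>The layered rate allocation problem\<close>

text \<open>The value of d at its breakpoint \<open>Mk Ms k\<close>, counted downwards from s =
  Ms.\<close>

definition phi_sum :: "nat \<Rightarrow> nat \<Rightarrow> nat \<Rightarrow> real" where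
  "phi_sum Ms Mb k = (\<Sum>i\<in>{1..k-1}. phi Ms Mb i)"

text \<open>\<open>outage_line Ms Mb k\<close> is the k-th affine piece of d. Since d is convex, it is the maximum of these pieces,
  and \<open>inv_outage\<close> is its inverse, again as a maximum of affine functions.\<close>

definition outage_line :: "nat \<Rightarrow> nat \<Rightarrow> nat \<Rightarrow> real \<Rightarrow> real" where
  "outage_line Ms Mb k s = phi_sum Ms Mb k + phi Ms Mb k * (Mk Ms k - s)"

definition inv_outage :: "nat \<Rightarrow> nat \<Rightarrow> real \<Rightarrow> real" where
  "inv_outage Ms Mb u = Max ((\<lambda>k. Mk Ms k - (u - phi_sum Ms Mb k) / phi Ms Mb k) ` {1..Ms})"

text \<open>The time of the continuous motion beyond \<nu>. Its values at the breakpoints of d are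
  the constants \<open>cc\<close>.\<close>

definition inv_outage_integral :: "nat \<Rightarrow> nat \<Rightarrow> real \<Rightarrow> real" where
  "inv_outage_integral Ms Mb \<delta> = integral {0..\<delta>} (\<lambda>u. 1 / inv_outage Ms Mb u)"

lemma phi_sum_eq: "1 \<le> k \<Longrightarrow> phi_sum Ms Mb k = (real k - 1) * (real Mb - real Ms + real k - 1)"
proof (induction k rule: nat_induct_at_least)
  case (Suc n)
  then have "{1..Suc n - 1} = insert n {1..n-1}" by auto
  then have "phi_sum Ms Mb (Suc n) = phi Ms Mb n + phi_sum Ms Mb n" using Suc by (simp add: phi_sum_def)
  then show ?case using Suc by (simp add: phi_def algebra_simps)
qed (simp add: phi_sum_def)

lemma phi_sum_Suc: "1 \<le> k \<Longrightarrow> phi_sum Ms Mb (Suc k) = phi_sum Ms Mb k + phi Ms Mb k"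
  by (simp add: phi_sum_eq phi_def algebra_simps)

context
  fixes Ms Mb :: nat
  assumes Ms: "1 \<le> Ms" and Mb: "Ms \<le> Mb"
begin

lemma phi_ge_1: "1 \<le> k \<Longrightarrow> 1 \<le> phi Ms Mb k"
  using Mb by (simp add: phi_def)

text \<open>The adjunction between d, as a maximum of lines, and its inverse; it reduces statements
  about the inverse to the choice of one line.\<close>

lemma le_inv_outage_iff: "s \<le> inv_outage Ms Mb u \<longleftrightarrow> (\<exists>k\<in>{1..Ms}. u \<le> outage_line Ms Mb k s)"
proof -
  have "s \<le> Mk Ms k - (u - phi_sum Ms Mb k) / phi Ms Mb k \<longleftrightarrow> u \<le> outage_line Ms Mb k s" if "k \<in> {1..Ms}" for k
    using phi_ge_1[of k] that by (simp add: outage_line_def field_simps)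
  then show ?thesis unfolding inv_outage_def using Ms by (subst Max_ge_iff) auto
qed

lemma outage_line_antimono: "k \<in> {1..Ms} \<Longrightarrow> s \<le> s' \<Longrightarrow> outage_line Ms Mb k s' \<le> outage_line Ms Mb k s"
  using phi_ge_1[of k] unfolding outage_line_def by (intro add_left_mono mult_left_mono) auto

lemma outage_line_eq: "1 \<le> k \<Longrightarrow> outage_line Ms Mb k s = (real k - 1) * (real Mb - real Ms + real k - 1) + (real Mb - real Ms + 2 * real k - 1) * (real Ms - real k + 1 - s)"
  by (simp add: outage_line_def phi_sum_eq phi_def Mk_def)

text \<open>The difference factors as \<open>(k - i) (2 (Ms - s) + 1 - k - i)\<close>. On the k-th
  segment Ms - s lies between k - 1 and k, so the two factors never have opposite signs.\<close>

lemma outage_line_le_segment: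
  assumes k: "1 \<le> k" and i: "1 \<le> i" and s: "Mk Ms k - 1 \<le> s" "s \<le> Mk Ms k"
  shows "outage_line Ms Mb i s \<le> outage_line Ms Mb k s"
proof -
  have "outage_line Ms Mb k s - outage_line Ms Mb i s = (real k - real i) * (2 * (real Ms - s) + 1 - real k - real i)"
    using k i by (simp add: outage_line_eq algebra_simps)
  also have "\<dots> \<ge> 0"
  proof (cases "i \<ge> k")
    case True
    consider "i = k" | "i \<ge> k + 1" using True by linarith
    then show ?thesis
    proof cases
      case 2
      then have "real i \<ge> real k + 1" by linarith
      then show ?thesis using s by (intro mult_nonpos_nonpos) (auto simp: Mk_def)
    qed simp
  next
    case False
    then have "real k \<ge> real i + 1" by linarith
    then show ?thesis using s by (intro mult_nonneg_nonneg) (auto simp: Mk_def)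
  qed
  finally show ?thesis by simp
qed

lemma inv_outage_segment:
  assumes k: "k \<in> {1..Ms}" and s: "Mk Ms k - 1 \<le> s" "s \<le> Mk Ms k"
  shows "inv_outage Ms Mb (outage_line Ms Mb k s) = s"
proof (rule antisym)
  show "s \<le> inv_outage Ms Mb (outage_line Ms Mb k s)" using k by (auto simp: le_inv_outage_iff)
  obtain i where i: "i \<in> {1..Ms}" "outage_line Ms Mb k s \<le> outage_line Ms Mb i (inv_outage Ms Mb (outage_line Ms Mb k s))"
    using le_inv_outage_iff[of "inv_outage Ms Mb (outage_line Ms Mb k s)" "outage_line Ms Mb k s"] by auto
  have "outage_line Ms Mb i s \<le> outage_line Ms Mb i (inv_outage Ms Mb (outage_line Ms Mb k s))"
    using outage_line_le_segment[of k i s] i k s by auto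
  then have "phi Ms Mb i * inv_outage Ms Mb (outage_line Ms Mb k s) \<le> phi Ms Mb i * s" by (simp add: outage_line_def algebra_simps)
  then show "inv_outage Ms Mb (outage_line Ms Mb k s) \<le> s" using phi_ge_1[of i] i by (simp add: mult_le_cancel_left_pos)
qed

lemma inv_outage_antimono: "u \<le> v \<Longrightarrow> inv_outage Ms Mb v \<le> inv_outage Ms Mb u"
  using le_inv_outage_iff[of "inv_outage Ms Mb v" v] le_inv_outage_iff[of "inv_outage Ms Mb v" u] by force

text \<open>All slopes of d are at least 1 in modulus, so its inverse has Lipschitz constant
  1.\<close>

lemma inv_outage_lipschitz: "u \<le> v \<Longrightarrow> inv_outage Ms Mb u \<le> inv_outage Ms Mb v + (v - u)"
proof -
  assume uv: "u \<le> v"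
  obtain k where k: "k \<in> {1..Ms}" "u \<le> outage_line Ms Mb k (inv_outage Ms Mb u)" using le_inv_outage_iff[of "inv_outage Ms Mb u" u] by auto
  have "v - u \<le> phi Ms Mb k * (v - u)" using phi_ge_1[of k] k uv mult_right_mono[of 1 "phi Ms Mb k" "v - u"] by simp
  then have "v \<le> outage_line Ms Mb k (inv_outage Ms Mb u - (v - u))" using k(2) by (simp add: outage_line_def algebra_simps)
  then have "inv_outage Ms Mb u - (v - u) \<le> inv_outage Ms Mb v" using k(1) by (auto simp: le_inv_outage_iff)
  then show ?thesis by simp
qed

lemma inv_outage_continuous: "continuous_on A (inv_outage Ms Mb)"
proof (rule continuous_onI)
  fix x e :: real assume "0 < e"
  have "dist (inv_outage Ms Mb y) (inv_outage Ms Mb x) \<le> dist y x" for y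
    using inv_outage_lipschitz[of x y] inv_outage_lipschitz[of y x] inv_outage_antimono[of x y] inv_outage_antimono[of y x]
    by (cases "x \<le> y") (auto simp: dist_real_def abs_if)
  then show "\<exists>d>0. \<forall>x'\<in>A. dist x' x < d \<longrightarrow> dist (inv_outage Ms Mb x') (inv_outage Ms Mb x) \<le> e"
    using \<open>0 < e\<close> by (intro exI[of _ e]) (auto intro: order_trans less_imp_le)
qed

text \<open>The last line takes the value Ms Mb at 0, so any smaller level is met by it at a
  positive s.\<close>

lemma inv_outage_pos: "u < real Ms * real Mb \<Longrightarrow> 0 < inv_outage Ms Mb u"
proof -
  assume u: "u < real Ms * real Mb"
  have e: "outage_line Ms Mb Ms s = real Ms * real Mb - phi Ms Mb Ms * s" for s
    using Ms by (simp add: outage_line_eq phi_def algebra_simps)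
  define s where "s = (real Ms * real Mb - u) / phi Ms Mb Ms"
  have "0 < s" using u phi_ge_1[OF Ms] by (simp add: s_def)
  moreover have "u \<le> outage_line Ms Mb Ms s" unfolding e s_def using phi_ge_1[OF Ms] by simp
  then have "s \<le> inv_outage Ms Mb u" using Ms by (auto simp: le_inv_outage_iff)
  ultimately show ?thesis by simp
qed

lemma inv_outage_lt_Ms: "0 < u \<Longrightarrow> inv_outage Ms Mb u < real Ms"
proof (rule ccontr)
  assume u: "0 < u" and "\<not> inv_outage Ms Mb u < real Ms"
  obtain k where k: "k \<in> {1..Ms}" "u \<le> outage_line Ms Mb k (inv_outage Ms Mb u)" using le_inv_outage_iff[of "inv_outage Ms Mb u" u] by auto
  have "outage_line Ms Mb k (inv_outage Ms Mb u) \<le> outage_line Ms Mb k (real Ms)"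
    using \<open>\<not> inv_outage Ms Mb u < real Ms\<close> by (intro outage_line_antimono k) simp
  also have "outage_line Ms Mb k (real Ms) = - ((real k - 1) * real k)" using k by (simp add: outage_line_eq algebra_simps)
  also have "\<dots> \<le> 0" using k by simp
  finally show False using k u by linarith
qed

lemma inv_outage_0: "inv_outage Ms Mb 0 = real Ms"
proof -
  have "inv_outage Ms Mb (outage_line Ms Mb 1 (real Ms)) = real Ms" using Ms by (intro inv_outage_segment) (auto simp: Mk_def)
  moreover have "outage_line Ms Mb 1 (real Ms) = 0" by (simp add: outage_line_eq)
  ultimately show ?thesis by simp
qed

lemma outage_line_lt_mult: "k \<in> {1..Ms} \<Longrightarrow> 0 < s \<Longrightarrow> outage_line Ms Mb k s < real Ms * real Mb"
proof -
  assume k: "k \<in> {1..Ms}" and s: "0 < s"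
  have "outage_line Ms Mb k s < outage_line Ms Mb k 0"
    unfolding outage_line_def using phi_ge_1[of k] k s by (intro add_strict_left_mono mult_strict_left_mono) auto
  also have "outage_line Ms Mb k 0 = real Ms * real Mb - (real Ms - real k) * (real Ms - real k + 1)"
    using k by (simp add: outage_line_eq algebra_simps)
  also have "\<dots> \<le> real Ms * real Mb" using k by simp
  finally show ?thesis .
qed

lemma inverse_inv_outage_integrable:
  assumes "v < real Ms * real Mb"
  shows "(\<lambda>u. 1 / inv_outage Ms Mb u) integrable_on {a..v}"
proof -
  have "inv_outage Ms Mb u \<noteq> 0" if "u \<in> {a..v}" for u using inv_outage_pos[of u] that assms by auto
  then show ?thesis by (intro integrable_continuous_real continuous_intros inv_outage_continuous) auto
qed

text \<open>The integrand is increasing. These rectangle bounds are what later compares a step of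
  finite length with the continuous motion.\<close>

lemma inv_outage_integral_diff:
  assumes a: "0 \<le> a" "a \<le> c" "c < real Ms * real Mb"
  shows "(c - a) / inv_outage Ms Mb a \<le> inv_outage_integral Ms Mb c - inv_outage_integral Ms Mb a" "inv_outage_integral Ms Mb c - inv_outage_integral Ms Mb a \<le> (c - a) / inv_outage Ms Mb c"
proof -
  have i: "inv_outage_integral Ms Mb c - inv_outage_integral Ms Mb a = integral {a..c} (\<lambda>u. 1 / inv_outage Ms Mb u)"
    unfolding inv_outage_integral_def using Henstock_Kurzweil_Integration.integral_combine[OF a(1,2) inverse_inv_outage_integrable[OF a(3)]] by simp
  have "integral {a..c} (\<lambda>u. 1 / inv_outage Ms Mb a) \<le> integral {a..c} (\<lambda>u. 1 / inv_outage Ms Mb u)"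
    using a inv_outage_pos inv_outage_antimono
    by (intro integral_le integrable_const_ivl inverse_inv_outage_integrable divide_left_mono mult_pos_pos) auto
  then show "(c - a) / inv_outage Ms Mb a \<le> inv_outage_integral Ms Mb c - inv_outage_integral Ms Mb a" using a by (simp add: i)
  have "integral {a..c} (\<lambda>u. 1 / inv_outage Ms Mb u) \<le> integral {a..c} (\<lambda>u. 1 / inv_outage Ms Mb c)"
    using a inv_outage_pos inv_outage_antimono
    by (intro integral_le integrable_const_ivl inverse_inv_outage_integrable divide_left_mono mult_pos_pos) auto
  then show "inv_outage_integral Ms Mb c - inv_outage_integral Ms Mb a \<le> (c - a) / inv_outage Ms Mb c" using a by (simp add: i)
qed

lemma inv_outage_integral_0 [simp]: "inv_outage_integral Ms Mb 0 = 0" by (simp add: inv_outage_integral_def)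

text \<open>On the k-th segment the inverse of d is affine, so the integrand has a logarithm as
  antiderivative.\<close>

lemma inv_outage_integral_segment:
  assumes k: "k \<in> {1..Ms}" and s: "0 < s" "Mk Ms k - 1 \<le> s" "s \<le> Mk Ms k"
  shows "inv_outage_integral Ms Mb (outage_line Ms Mb k s) = inv_outage_integral Ms Mb (phi_sum Ms Mb k) + phi Ms Mb k * ln (Mk Ms k / s)"
proof -
  define F where "F u = - phi Ms Mb k * ln (Mk Ms k - (u - phi_sum Ms Mb k) / phi Ms Mb k)" for u
  have phi1: "phi Ms Mb k \<ge> 1" using phi_ge_1 k by simp
  have v: "outage_line Ms Mb k s = phi_sum Ms Mb k + phi Ms Mb k * (Mk Ms k - s)" by (simp add: outage_line_def)
  have S0: "0 \<le> phi_sum Ms Mb k" using k Mb by (simp add: phi_sum_eq)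
  have le: "phi_sum Ms Mb k \<le> outage_line Ms Mb k s" using phi1 s by (simp add: v)
  have lt: "outage_line Ms Mb k s < real Ms * real Mb" using outage_line_lt_mult[OF k s(1)] .
  have M: "Mk Ms k > 0" using k by (simp add: Mk_def)
  have eq: "inv_outage Ms Mb u = Mk Ms k - (u - phi_sum Ms Mb k) / phi Ms Mb k \<and> s \<le> inv_outage Ms Mb u" if u: "u \<in> {phi_sum Ms Mb k..outage_line Ms Mb k s}" for u
  proof -
    define t where "t = Mk Ms k - (u - phi_sum Ms Mb k) / phi Ms Mb k"
    have ut: "u = outage_line Ms Mb k t" using phi1 by (simp add: t_def outage_line_def)
    have "t \<le> Mk Ms k" using u phi1 by (simp add: t_def)
    moreover have "s \<le> t"
    proof -
      have "phi Ms Mb k * (Mk Ms k - t) \<le> phi Ms Mb k * (Mk Ms k - s)" using u unfolding ut outage_line_def by simp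
      then show ?thesis using phi1 by (simp add: mult_le_cancel_left_pos)
    qed
    ultimately have "inv_outage Ms Mb u = t" unfolding ut using s by (intro inv_outage_segment k) auto
    then show ?thesis using \<open>s \<le> t\<close> by (simp add: t_def)
  qed
  have "((\<lambda>u. 1 / inv_outage Ms Mb u) has_integral (F (outage_line Ms Mb k s) - F (phi_sum Ms Mb k))) {phi_sum Ms Mb k..outage_line Ms Mb k s}"
  proof (rule fundamental_theorem_of_calculus[OF le])
    fix u assume u: "u \<in> {phi_sum Ms Mb k..outage_line Ms Mb k s}"
    have pos: "0 < Mk Ms k - (u - phi_sum Ms Mb k) / phi Ms Mb k" using eq[OF u] s by linarith
    have "(F has_real_derivative 1 / (Mk Ms k - (u - phi_sum Ms Mb k) / phi Ms Mb k)) (at u)"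
      unfolding F_def using pos phi1 by (auto intro!: derivative_eq_intros)
    then show "(F has_vector_derivative 1 / inv_outage Ms Mb u) (at u within {phi_sum Ms Mb k..outage_line Ms Mb k s})"
      using eq[OF u] by (simp add: has_real_derivative_iff_has_vector_derivative[symmetric] has_field_derivative_at_within)
  qed
  then have "integral {phi_sum Ms Mb k..outage_line Ms Mb k s} (\<lambda>u. 1 / inv_outage Ms Mb u) = F (outage_line Ms Mb k s) - F (phi_sum Ms Mb k)" by (rule integral_unique)
  also have "F (outage_line Ms Mb k s) = - phi Ms Mb k * ln s" unfolding F_def v using phi1 by simp
  also have "F (phi_sum Ms Mb k) = - phi Ms Mb k * ln (Mk Ms k)" by (simp add: F_def)
  also have "- phi Ms Mb k * ln s - - phi Ms Mb k * ln (Mk Ms k) = phi Ms Mb k * ln (Mk Ms k / s)"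
    using M s by (simp add: ln_div algebra_simps)
  finally show ?thesis
    unfolding inv_outage_integral_def using Henstock_Kurzweil_Integration.integral_combine[OF S0 le inverse_inv_outage_integrable[OF lt]] by simp
qed

lemma inv_outage_integral_phi_sum: "1 \<le> k \<Longrightarrow> k \<le> Ms \<Longrightarrow> inv_outage_integral Ms Mb (phi_sum Ms Mb k) = cc Ms Mb (k - 1)"
proof (induction k rule: nat_induct_at_least)
  case base
  then show ?case by (simp add: phi_sum_def inv_outage_integral_def)
next
  case (Suc k)
  have k: "k \<in> {1..Ms}" using Suc by simp
  have "phi_sum Ms Mb (Suc k) = outage_line Ms Mb k (Mk Ms k - 1)" using Suc by (simp add: phi_sum_Suc outage_line_def)
  then have "inv_outage_integral Ms Mb (phi_sum Ms Mb (Suc k)) = inv_outage_integral Ms Mb (phi_sum Ms Mb k) + phi Ms Mb k * ln (Mk Ms k / (Mk Ms k - 1))"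
    using Suc k by (simp add: inv_outage_integral_segment Mk_def)
  also have "\<dots> = cc Ms Mb k" using Suc by (cases k) auto
  finally show ?case by simp
qed

section \<open>The required time and the Lambert W formula\<close>

definition layer_time :: "real \<Rightarrow> real \<Rightarrow> real" where
  "layer_time \<nu> \<delta> = \<nu> / inv_outage Ms Mb \<delta> + inv_outage_integral Ms Mb \<delta>"

lemma layer_time_strict_mono:
  assumes "0 \<le> \<nu>" "0 \<le> \<delta>" "\<delta> < \<delta>'" "\<delta>' < real Ms * real Mb"
  shows "layer_time \<nu> \<delta> < layer_time \<nu> \<delta>'"
proof -
  have "\<nu> / inv_outage Ms Mb \<delta> \<le> \<nu> / inv_outage Ms Mb \<delta>'" using assms inv_outage_pos inv_outage_antimono by (intro divide_left_mono mult_pos_pos) auto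
  moreover have "0 < (\<delta>' - \<delta>) / inv_outage Ms Mb \<delta>" using assms inv_outage_pos by simp
  ultimately show ?thesis using inv_outage_integral_diff(1)[of \<delta> \<delta>'] assms by (simp add: layer_time_def)
qed

lemma layer_time_0: "layer_time \<nu> 0 = \<nu> / real Ms"
  by (simp add: layer_time_def inv_outage_0)

text \<open>For nonnegative z a solution cannot be negative, and on the nonnegative axis
  \<open>w * exp w\<close> is strictly increasing; the description in \<open>lambertW\<close> is
  therefore unique.\<close>

lemma lambertW_eq:
  assumes "0 \<le> z"
  shows "0 \<le> lambertW z" "lambertW z * exp (lambertW z) = z"
proof -
  have "\<exists>w. 0 \<le> w \<and> w \<le> z \<and> w * exp w = z"
  proof (rule IVT2'[of "\<lambda>w. - (w * exp w)" z "- z" 0, simplified])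
    show "z \<le> z * exp z" using assms by (simp add: mult_le_cancel_left1)
  qed (use assms in \<open>auto intro!: continuous_intros\<close>)
  then obtain w where w: "0 \<le> w" "w * exp w = z" by blast
  have "lambertW z = w"
    unfolding lambertW_def
  proof (rule the_equality)
    show "- 1 \<le> w \<and> w * exp w = z" using w by simp
    fix v assume v: "- 1 \<le> v \<and> v * exp v = z"
    have v0: "0 \<le> v" using v assms by (metis exp_gt_zero mult_less_0_iff not_less)
    show "v = w"
    proof (rule ccontr)
      assume "v \<noteq> w"
      then consider "v < w" | "w < v" by linarith
      then show False
      proof cases
        case 1
        then have "v * exp v < w * exp w" using v0 by (intro mult_strict_mono) auto
        then show ?thesis using v w by simp
      next
        case 2
        then have "w * exp w < v * exp v" using w by (intro mult_strict_mono) auto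
        then show ?thesis using v w by simp
      qed
    qed
  qed
  then show "0 \<le> lambertW z" "lambertW z * exp (lambertW z) = z" using w by auto
qed

text \<open>With s for \<open>inv_outage \<delta>\<close> on the k-th segment, the equation
  \<open>layer_time = b\<close> reads \<open>\<nu> / s + c + f ln (M / s) = b\<close>, and
  \<open>w = \<nu> / (f s)\<close> turns it into \<open>w exp w = z\<close>. Thus
  \<open>b * ls_kappa\<close>, which is f w, is the time spent in reaching \<nu>. The inequalities
  of the region place s between M - 1 and M.\<close>

lemma formula_solves:
  assumes b: "0 < b" and \<nu>: "0 \<le> \<nu>" and k: "k \<in> {1..Ms}" and reg: "ls_region Ms Mb b \<nu> k"
  shows "\<exists>\<delta>. 0 \<le> \<delta> \<and> \<delta> < real Ms * real Mb \<and> layer_time \<nu> \<delta> = b \<and> ls_exponent_formula Ms Mb b \<nu> k = \<nu> + \<delta>"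
proof -
  define c where "c = cc Ms Mb (k - 1)"
  define M where "M = Mk Ms k"
  define f where "f = phi Ms Mb k"
  have f: "f \<ge> 1" using phi_ge_1 k by (simp add: f_def)
  have M: "M \<ge> 1" using k by (simp add: M_def Mk_def)
  define z where "z = exp ((b - c) / f) * \<nu> / (M * f)"
  define w where "w = lambertW z"
  have z: "z \<ge> 0" using \<nu> M f by (simp add: z_def)
  have w: "0 \<le> w" "w * exp w = z" using lambertW_eq[OF z] by (auto simp: w_def)
  have \<kappa>: "b * (1 - ls_kappa Ms Mb b \<nu> k) = b - f * w"
    using b by (simp add: ls_kappa_def w_def z_def f_def c_def M_def algebra_simps)
  \<comment> \<open>The candidate for \<open>inv_outage \<delta>\<close>, read off from the
    exponential in the formula.\<close>
  define s where "s = M * exp (- (b - f * w - c) / f)"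
  have s0: "s > 0" using M by (simp add: s_def)
  have sw: "\<nu> / s = f * w"
  proof -
    have "s = M * exp (w - (b - c) / f)" using f by (simp add: s_def diff_divide_distrib add_divide_distrib)
    then have "s * w = M * (exp (- ((b - c) / f)) * (w * exp w))" by (simp add: exp_diff exp_minus field_simps)
    also have "\<dots> = M * (exp (- ((b - c) / f)) * exp ((b - c) / f)) * \<nu> / (M * f)" by (simp add: w z_def)
    also have "exp (- ((b - c) / f)) * exp ((b - c) / f) = 1" by (simp add: exp_add[symmetric])
    finally have "s * w = \<nu> / f" using M by simp
    then show ?thesis using s0 f by (simp add: field_simps)
  qed
  have ln_s: "f * ln (M / s) = b - c - f * w"
  proof -
    have "ln (M / s) = (b - f * w - c) / f" using M f by (simp add: s_def ln_div ln_mult minus_divide_left)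
    then show ?thesis using f by simp
  qed
  have h: "\<nu> / s + (c + f * ln (M / s)) = b" using sw ln_s by simp
  have sM: "s < M"
  proof (rule ccontr)
    assume "\<not> s < M"
    then have "\<nu> / s \<le> \<nu> / M" "ln (M / s) \<le> 0" using M s0 \<nu> by (auto intro!: divide_left_mono)
    then have "b \<le> \<nu> / M + c" using h f by (smt (verit) mult_nonneg_nonpos)
    then show False using reg by (simp add: ls_region_def c_def M_def)
  qed
  have sM1: "M - 1 \<le> s"
  proof (cases "k < Ms")
    case True
    show ?thesis
    proof (rule ccontr)
      assume n: "\<not> M - 1 \<le> s"
      have M1: "M - 1 > 0" using True by (simp add: M_def Mk_def)
      have "\<nu> / (M - 1) \<le> \<nu> / s" using n s0 \<nu> M1 by (intro divide_left_mono) auto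
      moreover have "ln (M / (M - 1)) < ln (M / s)" using n s0 M1 M by (simp add: divide_strict_left_mono)
      then have "f * ln (M / (M - 1)) < f * ln (M / s)" using f by simp
      ultimately have "c + f * ln (M / (M - 1)) + \<nu> / (M - 1) < b" using h by linarith
      moreover have "cc Ms Mb k = c + f * ln (M / (M - 1))" using k by (cases k) (auto simp: c_def f_def M_def)
      ultimately show False using reg True by (simp add: ls_region_def M_def)
    qed
  next
    case False
    \<comment> \<open>The last region has no upper limit for b, in accordance with an infinite last
      constant; here M - 1 = 0, and positivity of s is enough.\<close>
    then have "M = 1" using k by (simp add: M_def Mk_def)
    then show ?thesis using s0 by simp
  qed
  define \<delta> where "\<delta> = outage_line Ms Mb k s"
  have ginv: "inv_outage Ms Mb \<delta> = s" unfolding \<delta>_def using sM sM1 by (intro inv_outage_segment k) (auto simp: M_def)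
  have I: "inv_outage_integral Ms Mb \<delta> = c + f * ln (M / s)"
    unfolding \<delta>_def using inv_outage_integral_segment[OF k s0] sM sM1 inv_outage_integral_phi_sum[of k] k by (simp add: M_def f_def c_def)
  have "0 \<le> phi_sum Ms Mb k" using k Mb by (simp add: phi_sum_eq)
  moreover have \<delta>: "\<delta> = phi_sum Ms Mb k + f * (M - s)" by (simp add: \<delta>_def outage_line_def f_def M_def)
  ultimately have "0 \<le> \<delta>" using f sM by simp
  moreover have "\<delta> < real Ms * real Mb" unfolding \<delta>_def by (rule outage_line_lt_mult[OF k s0])
  moreover have "layer_time \<nu> \<delta> = b" using h by (simp add: layer_time_def ginv I)
  moreover have "ls_exponent_formula Ms Mb b \<nu> k = \<nu> + \<delta>"
    unfolding ls_exponent_formula_def \<kappa> \<delta> phi_sum_def f_def[symmetric] M_def[symmetric] c_def[symmetric] s_def by (simp add: algebra_simps)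
  ultimately show ?thesis by blast
qed

text \<open>The time at which the continuous motion towards \<open>\<nu> + \<delta>\<close> passes x.\<close>

definition progress :: "real \<Rightarrow> real \<Rightarrow> real \<Rightarrow> real" where
  "progress \<nu> \<delta> x = min x \<nu> / inv_outage Ms Mb \<delta> + (inv_outage_integral Ms Mb \<delta> - inv_outage_integral Ms Mb (\<nu> + \<delta> - max \<nu> x))"

text \<open>The speed never decreases in x, so the time needed from x to y lies between the
  quotients formed with the final and the initial speed. Up to \<nu> the speed is constant.\<close>

lemma progress_step:
  assumes \<nu>: "0 \<le> \<nu>" and \<delta>: "0 < \<delta>" "\<delta> < real Ms * real Mb" and x: "0 \<le> x" "x \<le> y" "y \<le> \<nu> + \<delta>"
  shows "(y - x) / inv_outage Ms Mb (\<nu> + \<delta> - max \<nu> y) \<le> progress \<nu> \<delta> y - progress \<nu> \<delta> x"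
    "progress \<nu> \<delta> y - progress \<nu> \<delta> x \<le> (y - x) / inv_outage Ms Mb (\<nu> + \<delta> - max \<nu> x)"
proof -
  define a c where "a = \<nu> + \<delta> - max \<nu> y" and "c = \<nu> + \<delta> - max \<nu> x"
  have ac: "0 \<le> a" "a \<le> c" "c < real Ms * real Mb" "a \<le> \<delta>" "c \<le> \<delta>" using x \<delta> by (auto simp: a_def c_def)
  have gp: "0 < inv_outage Ms Mb a" "0 < inv_outage Ms Mb c" "0 < inv_outage Ms Mb \<delta>" using ac \<delta> by (auto intro!: inv_outage_pos)
  have W: "progress \<nu> \<delta> y - progress \<nu> \<delta> x = (min y \<nu> - min x \<nu>) / inv_outage Ms Mb \<delta> + (inv_outage_integral Ms Mb c - inv_outage_integral Ms Mb a)"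
    by (simp add: progress_def a_def c_def diff_divide_distrib)
  have yx: "y - x = (min y \<nu> - min x \<nu>) + (c - a)" by (simp add: a_def c_def min_def max_def)
  have m: "0 \<le> min y \<nu> - min x \<nu>" using x by (simp add: min_def)
  have "(min y \<nu> - min x \<nu>) / inv_outage Ms Mb a \<le> (min y \<nu> - min x \<nu>) / inv_outage Ms Mb \<delta>"
    using inv_outage_antimono[OF ac(4)] gp m by (intro divide_left_mono) auto
  then show "(y - x) / inv_outage Ms Mb (\<nu> + \<delta> - max \<nu> y) \<le> progress \<nu> \<delta> y - progress \<nu> \<delta> x"
    unfolding W a_def[symmetric] yx add_divide_distrib using inv_outage_integral_diff(1)[OF ac(1-3)] by linarith
  have "(min y \<nu> - min x \<nu>) / inv_outage Ms Mb \<delta> = (min y \<nu> - min x \<nu>) / inv_outage Ms Mb c"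
  proof (cases "x \<le> \<nu>")
    case True
    then have "c = \<delta>" by (simp add: c_def)
    then show ?thesis by simp
  qed (use x in simp)
  then show "progress \<nu> \<delta> y - progress \<nu> \<delta> x \<le> (y - x) / inv_outage Ms Mb (\<nu> + \<delta> - max \<nu> x)"
    unfolding W c_def[symmetric] yx add_divide_distrib using inv_outage_integral_diff(2)[OF ac(1-3)] by linarith
qed

lemma progress_0: "0 \<le> \<nu> \<Longrightarrow> progress \<nu> \<delta> 0 = 0"
  by (simp add: progress_def)

lemma progress_end: "0 \<le> \<delta> \<Longrightarrow> progress \<nu> \<delta> (\<nu> + \<delta>) = layer_time \<nu> \<delta>"
  by (simp add: progress_def layer_time_def)

text \<open>A step is limited by the speed at its start, which is the least speed on it, so the
  continuous motion covers it in time at most h. A step may pass the end point, hence the truncation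
  at D.\<close>

lemma greedy_upper:
  assumes \<nu>: "0 \<le> \<nu>" and \<delta>: "0 < \<delta>" "\<delta> < real Ms * real Mb" and h: "0 \<le> h"
    and x0: "x 0 = 0" and xm: "\<And>l. l < L \<Longrightarrow> x l \<le> x (Suc l)"
    and step: "\<And>l. l < L \<Longrightarrow> x l < \<nu> + \<delta> \<Longrightarrow> x (Suc l) - x l \<le> h * inv_outage Ms Mb (\<nu> + \<delta> - max \<nu> (x l))"
    and xL: "\<nu> + \<delta> \<le> x L"
  shows "layer_time \<nu> \<delta> \<le> real L * h"
proof -
  define D where "D = \<nu> + \<delta>"
  have nn: "0 \<le> x l" if "l \<le> L" for l using that
  proof (induction l)
    case (Suc l)
    then show ?case using xm[of l] by simp
  qed (simp add: x0)
  have "progress \<nu> \<delta> (min (x l) D) \<le> real l * h" if "l \<le> L" for l using that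
  proof (induction l)
    case 0
    then show ?case using \<nu> \<delta> by (simp add: x0 D_def progress_0)
  next
    case (Suc l)
    then have IH: "progress \<nu> \<delta> (min (x l) D) \<le> real l * h" and l: "l < L" by auto
    show ?case
    proof (cases "x l < D")
      case True
      define y where "y = min (x (Suc l)) D"
      have y: "x l \<le> y" "y \<le> D" "y \<le> x (Suc l)" using True xm[OF l] by (auto simp: y_def)
      define gx where "gx = inv_outage Ms Mb (\<nu> + \<delta> - max \<nu> (x l))"
      have gx: "0 < gx" unfolding gx_def using \<delta> by (intro inv_outage_pos) auto
      have "progress \<nu> \<delta> y - progress \<nu> \<delta> (x l) \<le> (y - x l) / gx"
        unfolding gx_def using nn[of l] l y by (intro progress_step \<nu> \<delta>) (auto simp: D_def)
      also have "\<dots> \<le> h"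
        using step[OF l] True y gx by (simp add: D_def gx_def pos_divide_le_eq)
      finally have "progress \<nu> \<delta> y \<le> progress \<nu> \<delta> (x l) + h" by simp
      moreover have "min (x l) D = x l" using True by simp
      ultimately show ?thesis using IH unfolding y_def[symmetric] by (simp add: algebra_simps)
    next
      case False
      then have "min (x (Suc l)) D = min (x l) D" using xm[OF l] by simp
      then show ?thesis using IH h by (simp add: algebra_simps)
    qed
  qed
  from this[of L] show ?thesis using xL \<delta> by (simp add: D_def progress_end)
qed

text \<open>The cap at \<open>\<nu> + \<delta>\<close> makes the exponent of the last layer exact: without it only an upper bound on the
  distortion would be available, and the limit that defines the exponent might not be \<open>\<nu> + \<delta>\<close>.\<close>

primrec greedy :: "real \<Rightarrow> real \<Rightarrow> real \<Rightarrow> nat \<Rightarrow> real" where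
  "greedy \<nu> \<delta> h 0 = 0"
| "greedy \<nu> \<delta> h (Suc l) = min (\<nu> + \<delta>) (greedy \<nu> \<delta> h l + h * inv_outage Ms Mb (\<nu> + \<delta> - max \<nu> (greedy \<nu> \<delta> h l)))"

declare greedy.simps(2) [simp del]

lemma greedy_props:
  assumes \<nu>: "0 \<le> \<nu>" and \<delta>: "0 < \<delta>" "\<delta> < real Ms * real Mb" and h: "0 \<le> h"
  shows "0 \<le> greedy \<nu> \<delta> h l" "greedy \<nu> \<delta> h l \<le> \<nu> + \<delta>" "greedy \<nu> \<delta> h l \<le> greedy \<nu> \<delta> h (Suc l)"
proof -
  have gp: "0 < inv_outage Ms Mb (\<nu> + \<delta> - max \<nu> x)" for x using \<delta> by (intro inv_outage_pos) auto
  have b: "0 \<le> greedy \<nu> \<delta> h l \<and> greedy \<nu> \<delta> h l \<le> \<nu> + \<delta>" for l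
  proof (induction l)
    case (Suc l)
    have "0 \<le> h * inv_outage Ms Mb (\<nu> + \<delta> - max \<nu> (greedy \<nu> \<delta> h l))" using h gp by (intro mult_nonneg_nonneg) (auto intro: less_imp_le)
    then show ?case using Suc by (simp add: greedy.simps(2))
  qed (use \<nu> \<delta> in simp)
  then show "0 \<le> greedy \<nu> \<delta> h l" "greedy \<nu> \<delta> h l \<le> \<nu> + \<delta>" by auto
  have "0 \<le> h * inv_outage Ms Mb (\<nu> + \<delta> - max \<nu> (greedy \<nu> \<delta> h l))" using h gp by (intro mult_nonneg_nonneg) (auto intro: less_imp_le)
  then show "greedy \<nu> \<delta> h l \<le> greedy \<nu> \<delta> h (Suc l)" using b[of l] by (simp add: greedy.simps(2))
qed

text \<open>A step has length at most \<open>h Ms\<close>, and by the Lipschitz bound the speed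
  grows by no more than that on it. So a step starting at speed g gains at least
  \<open>h g / (g + h Ms)\<close> of progress, which is least for the initial speed
  \<open>inv_outage \<delta>\<close>. If the end were not reached, L such gains would exceed the
  total time.\<close>

lemma greedy_reaches:
  assumes \<nu>: "0 \<le> \<nu>" and \<delta>: "0 < \<delta>" "\<delta> < real Ms * real Mb" and h: "0 < h"
    and big: "layer_time \<nu> \<delta> < real L * (h * inv_outage Ms Mb \<delta> / (inv_outage Ms Mb \<delta> + h * real Ms))"
  shows "greedy \<nu> \<delta> h L = \<nu> + \<delta>"
proof (rule ccontr)
  assume n: "greedy \<nu> \<delta> h L \<noteq> \<nu> + \<delta>"
  let ?x = "greedy \<nu> \<delta> h"
  note P = greedy_props[OF \<nu> \<delta> less_imp_le[OF h]]
  define D where "D = \<nu> + \<delta>"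
  have lt: "?x l < D" if "l \<le> L" for l
  proof -
    have "?x l \<le> ?x L" by (rule lift_Suc_mono_le[of ?x, OF P(3) that])
    then show ?thesis using n P(2)[of L] by (simp add: D_def)
  qed
  define q where "q = h * inv_outage Ms Mb \<delta> / (inv_outage Ms Mb \<delta> + h * real Ms)"
  have g\<delta>: "0 < inv_outage Ms Mb \<delta>" using \<delta> by (intro inv_outage_pos)
  have "real l * q \<le> progress \<nu> \<delta> (?x l)" if "l \<le> L" for l using that
  proof (induction l)
    case 0
    then show ?case using \<nu> by (simp add: progress_0)
  next
    case (Suc l)
    define c a where "c = D - max \<nu> (?x l)" and "a = D - max \<nu> (?x (Suc l))"
    have xs: "?x (Suc l) = ?x l + h * inv_outage Ms Mb c" using lt[OF Suc.prems] by (auto simp: c_def D_def min_def greedy.simps(2) split: if_splits)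
    have c0: "0 < c" "c \<le> \<delta>" using lt[of l] Suc.prems \<delta> by (auto simp: c_def D_def)
    have "a \<le> c" "c - a \<le> ?x (Suc l) - ?x l" using P(3)[of l] by (auto simp: a_def c_def)
    moreover have "inv_outage Ms Mb c \<le> real Ms" using inv_outage_lt_Ms[OF c0(1)] by simp
    ultimately have "c - a \<le> h * real Ms" using xs h by (smt (verit) mult_left_mono)
    then have ga: "inv_outage Ms Mb a \<le> inv_outage Ms Mb c + h * real Ms" using inv_outage_lipschitz[OF \<open>a \<le> c\<close>] by linarith
    have gc: "inv_outage Ms Mb \<delta> \<le> inv_outage Ms Mb c" by (rule inv_outage_antimono[OF c0(2)])
    have ga0: "0 < inv_outage Ms Mb a" using \<delta> by (intro inv_outage_pos) (auto simp: a_def D_def)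
    have "q \<le> h * inv_outage Ms Mb c / (inv_outage Ms Mb c + h * real Ms)"
    proof -
      have "inv_outage Ms Mb \<delta> * (inv_outage Ms Mb c + h * real Ms) \<le> inv_outage Ms Mb c * (inv_outage Ms Mb \<delta> + h * real Ms)"
        using mult_right_mono[OF gc, of "h * real Ms"] h by (simp add: distrib_left mult.commute)
      then have "h * (inv_outage Ms Mb \<delta> * (inv_outage Ms Mb c + h * real Ms)) \<le> h * (inv_outage Ms Mb c * (inv_outage Ms Mb \<delta> + h * real Ms))" using h by (intro mult_left_mono) auto
      moreover have "0 < inv_outage Ms Mb \<delta> + h * real Ms" "0 < inv_outage Ms Mb c + h * real Ms" using g\<delta> gc h by (auto intro!: add_pos_nonneg)
      ultimately show ?thesis unfolding q_def by (simp add: pos_divide_le_eq pos_le_divide_eq mult_ac)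
    qed
    also have "\<dots> \<le> h * inv_outage Ms Mb c / inv_outage Ms Mb a"
      using ga ga0 h gc g\<delta> by (intro divide_left_mono mult_pos_pos mult_nonneg_nonneg) auto
    also have "\<dots> = (?x (Suc l) - ?x l) / inv_outage Ms Mb (\<nu> + \<delta> - max \<nu> (?x (Suc l)))"
      using xs by (simp add: a_def D_def)
    also have "\<dots> \<le> progress \<nu> \<delta> (?x (Suc l)) - progress \<nu> \<delta> (?x l)"
      by (intro progress_step \<nu> \<delta> P)
    finally have "q \<le> progress \<nu> \<delta> (?x (Suc l)) - progress \<nu> \<delta> (?x l)" .
    moreover have "real l * q \<le> progress \<nu> \<delta> (?x l)" using Suc by simp
    ultimately show ?case by (simp add: algebra_simps)
  qed
  then have 1: "real L * q \<le> progress \<nu> \<delta> (?x L)" by simp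
  have "0 \<le> (D - ?x L) / inv_outage Ms Mb (\<nu> + \<delta> - max \<nu> D)"
    using lt[of L] \<delta> inv_outage_0 Ms by (simp add: D_def)
  also have "\<dots> \<le> progress \<nu> \<delta> D - progress \<nu> \<delta> (?x L)"
    using lt[of L] by (intro progress_step \<nu> \<delta> P) (auto simp: D_def)
  finally have "progress \<nu> \<delta> (?x L) \<le> layer_time \<nu> \<delta>" using \<delta> by (simp add: D_def progress_end)
  then show False using 1 big by (simp add: q_def)
qed

end

section \<open>The distortion exponent\<close>

text \<open>The probability bounds number the pieces of d upwards in s, the theorem downwards, with
  j = Ms - k + 1. The expression is symmetric in R and T, so it does not matter which side has fewer
  antennas.\<close>

lemma outage_line_transmit:
  fixes R T :: nat
  defines "Ms \<equiv> min T R" and "Mb \<equiv> max T R"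
  assumes k: "k \<in> {1..Ms}" and j: "j = Ms - k + 1"
  shows "1 \<le> j" "j \<le> Ms" "real j = Mk Ms k"
    "(real R - real j) * (real T - real j) + (real j - s) * (real R + real T - 2 * real j + 1) = outage_line Ms Mb k s"
proof -
  show "1 \<le> j" "j \<le> Ms" using k j by auto
  show jr: "real j = Mk Ms k" using k j by (simp add: Mk_def of_nat_diff)
  have "(real R - real j) * (real T - real j) + (real j - s) * (real R + real T - 2 * real j + 1)
     = (real Ms - real j) * (real Mb - real j) + (real j - s) * (real Ms + real Mb - 2 * real j + 1)"
    by (cases "T \<le> R") (auto simp: Ms_def Mb_def min_def max_def algebra_simps)
  also have "\<dots> = outage_line Ms Mb k s"
  proof -
    have "1 \<le> Ms" "Ms \<le> Mb" "1 \<le> k" using k by (auto simp: Ms_def Mb_def)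
    then show ?thesis by (simp add: outage_line_eq jr Mk_def algebra_simps)
  qed
  finally show "(real R - real j) * (real T - real j) + (real j - s) * (real R + real T - 2 * real j + 1) = outage_line Ms Mb k s" .
qed

lemma out_prob_le_outage_line:
  assumes "k \<in> {1..min CARD('t::finite) CARD('r::finite)}" "0 \<le> s"
  shows "le_exp (\<lambda>\<rho>. out_prob TYPE('t \<times> 'r) (\<rho> powr s) \<rho>) (outage_line (min CARD('t) CARD('r)) (max CARD('t) CARD('r)) k s)"
  using out_prob_le_exp[where 't = 't and 'r = 'r, OF outage_line_transmit(1,2)[OF assms(1) refl, folded min_antennas_def[of "TYPE('t \<times> 'r)"]] assms(2)]
  unfolding min_antennas_def outage_line_transmit(4)[OF assms(1) refl] .

lemma out_prob_ge_outage_line: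
  assumes s0: "0 \<le> s0" "s0 < real (min CARD('t::finite) CARD('r::finite))" and s: "s0 < s" and \<eta>: "0 < \<eta>"
  shows "\<exists>k\<in>{1..min CARD('t) CARD('r)}. ge_exp (\<lambda>\<rho>. out_prob TYPE('t \<times> 'r) (\<eta> * \<rho> powr s) \<rho>)
     (outage_line (min CARD('t) CARD('r)) (max CARD('t) CARD('r)) k s0)"
proof -
  let ?Ms = "min CARD('t) CARD('r)"
  \<comment> \<open>s0 lies between p and p + 1, hence on the piece with j = p + 1.\<close>
  define p where "p = nat \<lfloor>s0\<rfloor>"
  have p: "real p \<le> s0" "s0 < real p + 1" using s0 by (auto simp: p_def)
  then have pM: "p < ?Ms" using s0 by linarith
  define k where "k = ?Ms - p"
  have k: "k \<in> {1..?Ms}" using pM by (auto simp: k_def)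
  have j: "?Ms - k + 1 = p + 1" using pM by (simp add: k_def)
  have "ge_exp (\<lambda>\<rho>. out_prob TYPE('t \<times> 'r) (\<eta> * \<rho> powr s) \<rho>)
    ((real CARD('r) - real (p + 1)) * (real CARD('t) - real (p + 1)) + (real (p + 1) - s0) * (real CARD('r) + real CARD('t) - 2 * real (p + 1) + 1))"
    using p pM by (intro out_prob_ge_exp s \<eta>) (auto simp: min_antennas_def)
  then show ?thesis unfolding outage_line_transmit(4)[OF k j[symmetric]] using k by blast
qed

section \<open>Converse and achievability for given rates\<close>

context
  fixes b \<nu> :: real and \<rho>s :: "real \<Rightarrow> real"
  assumes b: "0 < b" and \<nu>: "0 \<le> \<nu>" and \<rho>s_pos: "\<And>\<rho>. 0 < \<rho> \<Longrightarrow> 0 < \<rho>s \<rho>"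
    and \<rho>s_lim: "((\<lambda>\<rho>. ln (\<rho>s \<rho>) / ln \<rho>) \<longlongrightarrow> \<nu>) at_top"
begin

text \<open>One line per layer is enough, as d is the maximum of its lines; the choice may differ
  from layer to layer.\<close>

lemma expected_distortion_le_exp:
  assumes L: "0 < L" and r: "\<And>l. l \<in> {1..L} \<Longrightarrow> 0 \<le> r l"
    and k: "\<And>l. l \<in> {1..L} \<Longrightarrow> \<exists>k\<in>{1..min CARD('t::finite) CARD('r::finite)}.
       \<Delta> \<le> max \<nu> (cum_exponent b L r (l - 1)) + outage_line (min CARD('t) CARD('r)) (max CARD('t) CARD('r)) k (r l)"
    and e: "\<Delta> \<le> max \<nu> (cum_exponent b L r L)"
  shows "le_exp (expected_distortion TYPE('t \<times> 'r) b \<rho>s L r) \<Delta>"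
proof (rule le_exp_upper)
  show "\<forall>\<^sub>F \<rho> in at_top. expected_distortion TYPE('t \<times> 'r) b \<rho>s L r \<rho> \<le>
    (\<Sum>l\<in>{1..L}. out_prob TYPE('t \<times> 'r) (\<rho> powr r l) \<rho> * side_integral (\<rho>s \<rho>) (\<rho> powr cum_exponent b L r (l - 1)))
      + side_integral (\<rho>s \<rho>) (\<rho> powr cum_exponent b L r L)"
    using eventually_ge_at_top[of 1]
  proof eventually_elim
    case (elim \<rho>)
    then show ?case by (intro expected_distortion_upper b L r \<rho>s_pos) auto
  qed
  have x: "0 \<le> cum_exponent b L r l" if "l \<le> L" for l
    using that b r unfolding cum_exponent_def by (intro mult_nonneg_nonneg sum_nonneg) auto
  show "le_exp (\<lambda>\<rho>. (\<Sum>l\<in>{1..L}. out_prob TYPE('t \<times> 'r) (\<rho> powr r l) \<rho> * side_integral (\<rho>s \<rho>) (\<rho> powr cum_exponent b L r (l - 1)))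
      + side_integral (\<rho>s \<rho>) (\<rho> powr cum_exponent b L r L)) \<Delta>"
  proof (intro le_exp_add le_exp_sum)
    fix l assume l: "l \<in> {1..L}"
    obtain k where kk: "k \<in> {1..min CARD('t) CARD('r)}"
      "\<Delta> \<le> max \<nu> (cum_exponent b L r (l - 1)) + outage_line (min CARD('t) CARD('r)) (max CARD('t) CARD('r)) k (r l)" using k[OF l] by blast
    have "le_exp (\<lambda>\<rho>. out_prob TYPE('t \<times> 'r) (\<rho> powr r l) \<rho> * side_integral (\<rho>s \<rho>) (\<rho> powr cum_exponent b L r (l - 1)))
       (outage_line (min CARD('t) CARD('r)) (max CARD('t) CARD('r)) k (r l) + max \<nu> (cum_exponent b L r (l - 1)))"
      using x l r[OF l] by (intro le_exp_mult out_prob_le_outage_line kk(1) side_integral_le_exp[OF \<nu> \<rho>s_pos \<rho>s_lim]) auto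
    then show "le_exp (\<lambda>\<rho>. out_prob TYPE('t \<times> 'r) (\<rho> powr r l) \<rho> * side_integral (\<rho>s \<rho>) (\<rho> powr cum_exponent b L r (l - 1))) \<Delta>"
      by (rule le_exp_mono) (use kk(2) in simp)
  next
    show "le_exp (\<lambda>\<rho>. side_integral (\<rho>s \<rho>) (\<rho> powr cum_exponent b L r L)) \<Delta>"
      by (rule le_exp_mono[OF side_integral_le_exp[OF \<nu> \<rho>s_pos \<rho>s_lim x[OF order_refl]] e])
  qed simp
qed

lemma expected_distortion_ge_exp_all:
  assumes L: "0 < L" and r: "\<And>l. l \<in> {1..L} \<Longrightarrow> 0 \<le> r l"
  shows "ge_exp (expected_distortion TYPE('t::finite \<times> 'r::finite) b \<rho>s L r) (max \<nu> (cum_exponent b L r L))"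
proof (rule ge_exp_lower[OF _ weak_side_integral_ge_exp[OF \<nu> \<rho>s_pos \<rho>s_lim]])
  show "\<forall>\<^sub>F \<rho> in at_top. weak_side_integral (\<rho>s \<rho>) (\<rho> powr cum_exponent b L r L) \<le> expected_distortion TYPE('t \<times> 'r) b \<rho>s L r \<rho>"
    using eventually_ge_at_top[of 1]
  proof eventually_elim
    case (elim \<rho>)
    have "weak_side_integral (\<rho>s \<rho>) (\<rho> powr cum_exponent b L r L) \<le> side_integral (\<rho>s \<rho>) (\<rho> powr cum_exponent b L r L)"
      using elim by (intro side_integral_ge_weak \<rho>s_pos) auto
    also have "\<dots> \<le> expected_distortion TYPE('t \<times> 'r) b \<rho>s L r \<rho>"
      using elim by (intro expected_distortion_ge_all b L r \<rho>s_pos) auto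
    finally show ?case .
  qed
qed

text \<open>\<open>s0\<close> stays below the rate to absorb constants, and below Ms so that it
  falls on one of the pieces of d.\<close>

lemma expected_distortion_ge_exp_outage:
  assumes L: "0 < L" and r: "\<And>l. l \<in> {1..L} \<Longrightarrow> 0 \<le> r l" and l: "l \<in> {1..L}"
    and s0: "0 \<le> s0" "s0 < real (min CARD('t::finite) CARD('r::finite))" "s0 < r l"
  shows "\<exists>k\<in>{1..min CARD('t) CARD('r)}. ge_exp (expected_distortion TYPE('t \<times> 'r) b \<rho>s L r)
    (outage_line (min CARD('t) CARD('r)) (max CARD('t) CARD('r)) k s0 + max \<nu> (cum_exponent b L r (l - 1)))"
proof -
  have "0 < (2::real) powr (- real L / b)" by simp
  from out_prob_ge_outage_line[where 't = 't and 'r = 'r, OF s0 this] obtain k where k: "k \<in> {1..min CARD('t) CARD('r)}"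
    "ge_exp (\<lambda>\<rho>. out_prob TYPE('t \<times> 'r) (2 powr (- real L / b) * \<rho> powr r l) \<rho>) (outage_line (min CARD('t) CARD('r)) (max CARD('t) CARD('r)) k s0)"
    by blast
  have "ge_exp (expected_distortion TYPE('t \<times> 'r) b \<rho>s L r) (outage_line (min CARD('t) CARD('r)) (max CARD('t) CARD('r)) k s0 + max \<nu> (cum_exponent b L r (l - 1)))"
  proof (rule ge_exp_lower[OF _ ge_exp_mult[OF k(2) weak_side_integral_ge_exp[OF \<nu> \<rho>s_pos \<rho>s_lim]]])
    show "\<forall>\<^sub>F \<rho> in at_top. out_prob TYPE('t \<times> 'r) (2 powr (- real L / b) * \<rho> powr r l) \<rho> * weak_side_integral (\<rho>s \<rho>) (\<rho> powr cum_exponent b L r (l - 1))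
       \<le> expected_distortion TYPE('t \<times> 'r) b \<rho>s L r \<rho>"
      using eventually_ge_at_top[of 1]
    proof eventually_elim
      case (elim \<rho>)
      then show ?case using l by (intro expected_distortion_ge_outage b L r \<rho>s_pos) auto
    qed
  qed
  then show ?thesis using k(1) by blast
qed

lemma exponent_le':
  assumes L: "0 < L" and r: "\<And>l. l \<in> {1..L} \<Longrightarrow> 0 \<le> r l"
    and ex: "ls_has_exponent TYPE('t::finite \<times> 'r::finite) b \<rho>s L r \<Delta>" and ge: "ge_exp (expected_distortion TYPE('t \<times> 'r) b \<rho>s L r) e"
  shows "\<Delta> \<le> e"
proof (rule exponent_le[OF ex ge])
  show "\<forall>\<^sub>F \<rho> in at_top. expected_distortion TYPE('t \<times> 'r) b \<rho>s L r \<rho> \<le> 1"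
    using eventually_ge_at_top[of 1]
  proof eventually_elim
    case (elim \<rho>)
    then show ?case by (intro expected_distortion_le_1 b L r \<rho>s_pos) auto
  qed
qed

text \<open>Decoding all layers shows that \<Delta> is at most \<open>x L\<close>, and an outage in
  layer l + 1 limits the increment after \<open>x l\<close>. So x is a discrete motion of the kind
  treated by \<open>greedy_upper\<close> that reaches \<Delta>.\<close>

lemma exponent_converse:
  fixes \<Delta> :: real
  defines "Ms \<equiv> min CARD('t::finite) CARD('r::finite)" and "Mb \<equiv> max CARD('t) CARD('r)"
  assumes L: "0 < L" and r: "\<And>l. l \<in> {1..L} \<Longrightarrow> 0 \<le> r l"
    and ex: "ls_has_exponent TYPE('t \<times> 'r) b \<rho>s L r \<Delta>" and \<Delta>: "\<nu> < \<Delta>"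
  shows "\<Delta> - \<nu> < real Ms * real Mb" "layer_time Ms Mb \<nu> (\<Delta> - \<nu>) \<le> b"
proof -
  have M: "1 \<le> Ms" "Ms \<le> Mb" by (auto simp: Ms_def Mb_def Suc_le_eq)
  define x where "x = cum_exponent b L r"
  have x0: "x 0 = 0" by (simp add: x_def cum_exponent_def)
  have xS: "x (Suc l) = x l + b / real L * r (Suc l)" for l by (simp add: x_def cum_exponent_def distrib_left)
  have xL: "\<Delta> \<le> x L"
    using exponent_le'[OF L r ex expected_distortion_ge_exp_all[OF L r]] \<Delta> by (auto simp: x_def)
  have key: "\<exists>k\<in>{1..Ms}. \<Delta> - max \<nu> (x l) \<le> outage_line Ms Mb k s0"
    if l: "l < L" and s0: "0 \<le> s0" "s0 < real Ms" "s0 < r (Suc l)" for l s0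
  proof -
    have "Suc l \<in> {1..L}" using l by simp
    from expected_distortion_ge_exp_outage[where 't = 't and 'r = 'r and r = r and l = "Suc l", OF L r this s0(1) s0(2)[unfolded Ms_def] s0(3)]
    obtain k where k: "k \<in> {1..Ms}" "ge_exp (expected_distortion TYPE('t \<times> 'r) b \<rho>s L r) (outage_line Ms Mb k s0 + max \<nu> (x l))"
      unfolding Ms_def[symmetric] Mb_def[symmetric] x_def by auto
    then show ?thesis using exponent_le'[OF L r ex k(2)] by (intro bexI[OF _ k(1)]) linarith
  qed
  \<comment> \<open>Otherwise \<Delta> - \<nu> would be at least d(0), no positive rate would be
    allowed, and x would remain 0 although its last value is at least \<Delta>.\<close>
  show \<delta>: "\<Delta> - \<nu> < real Ms * real Mb"
  proof (rule ccontr)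
    assume n: "\<not> \<Delta> - \<nu> < real Ms * real Mb"
    have "x l = 0" if "l \<le> L" for l using that
    proof (induction l)
      case (Suc l)
      have "r (Suc l) = 0"
      proof (rule ccontr)
        assume "r (Suc l) \<noteq> 0"
        then have rp: "0 < r (Suc l)" using r[of "Suc l"] Suc.prems by simp
        define s0 where "s0 = min (r (Suc l)) 1 / 2"
        have s0: "0 < s0" "s0 < r (Suc l)" "s0 < real Ms" using rp M by (auto simp: s0_def)
        obtain k where "k \<in> {1..Ms}" "\<Delta> - max \<nu> (x l) \<le> outage_line Ms Mb k s0" using key[of l s0] s0 Suc.prems by auto
        moreover have "x l = 0" using Suc by simp
        ultimately show False using outage_line_lt_mult[OF M, of k s0] s0 n \<nu> by simp
      qed
      then show ?case using Suc by (simp add: xS)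
    qed (simp add: x0)
    then show False using xL \<Delta> \<nu> by fastforce
  qed
  have "layer_time Ms Mb \<nu> (\<Delta> - \<nu>) \<le> real L * (b / real L)"
  proof (rule greedy_upper[OF M \<nu>])
    show "x l \<le> x (Suc l)" if "l < L" for l using that r[of "Suc l"] b by (simp add: xS)
    fix l assume l: "l < L" and lt: "x l < \<nu> + (\<Delta> - \<nu>)"
    define u where "u = \<Delta> - max \<nu> (x l)"
    have u: "0 < u" using lt \<Delta> by (simp add: u_def)
    \<comment> \<open>A larger rate would leave room for some s0 strictly above
      \<open>inv_outage u\<close> and below both the rate and Ms. The outage bound at s0 then
      contradicts the adjunction.\<close>
    have "r (Suc l) \<le> inv_outage Ms Mb u"
    proof (rule ccontr)
      assume n: "\<not> r (Suc l) \<le> inv_outage Ms Mb u"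
      have gM: "inv_outage Ms Mb u < real Ms" by (rule inv_outage_lt_Ms[OF M u])
      have "u \<le> \<Delta> - \<nu>" by (simp add: u_def)
      then have g0: "0 < inv_outage Ms Mb u" using \<delta> by (intro inv_outage_pos[OF M]) simp
      obtain s0 where s0: "inv_outage Ms Mb u < s0" "s0 < min (r (Suc l)) (real Ms)"
        using dense[of "inv_outage Ms Mb u" "min (r (Suc l)) (real Ms)"] n gM by auto
      moreover have "0 \<le> s0" using s0 g0 by linarith
      ultimately have "\<exists>k\<in>{1..Ms}. u \<le> outage_line Ms Mb k s0" unfolding u_def by (intro key l) auto
      then have "s0 \<le> inv_outage Ms Mb u" using le_inv_outage_iff[OF M] by blast
      then show False using s0 by simp
    qed
    then show "x (Suc l) - x l \<le> b / real L * inv_outage Ms Mb (\<nu> + (\<Delta> - \<nu>) - max \<nu> (x l))"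
      using b by (simp add: xS u_def mult_left_mono divide_right_mono)
  qed (use \<Delta> \<delta> b x0 xL in auto)
  then show "layer_time Ms Mb \<nu> (\<Delta> - \<nu>) \<le> b" using L by simp
qed

lemma Delta_ls_ge:
  fixes L :: nat
  assumes r: "\<And>l. l \<in> {1..L} \<Longrightarrow> 0 \<le> r l" and ex: "ls_has_exponent TYPE('t::finite \<times> 'r::finite) b \<rho>s L r \<Delta>"
  shows "ereal \<Delta> \<le> Delta_ls TYPE('t \<times> 'r) b \<rho>s L"
  unfolding Delta_ls_def using assms by (intro Sup_upper) blast

text \<open>With all rates zero the distortion exponent is that of the side information. This covers
  \<delta> = 0, which the greedy construction excludes.\<close>

lemma Delta_ls_ge_nu:
  assumes L: "0 < L"
  shows "ereal \<nu> \<le> Delta_ls TYPE('t::finite \<times> 'r::finite) b \<rho>s L"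
proof (rule Delta_ls_ge[where r = "\<lambda>_. 0"])
  let ?Ms = "min CARD('t) CARD('r)" and ?Mb = "max CARD('t) CARD('r)"
  have x: "cum_exponent b L (\<lambda>_. 0) l = 0" for l by (simp add: cum_exponent_def)
  have "0 \<le> outage_line ?Ms ?Mb ?Ms 0"
  proof -
    have "1 \<le> ?Ms" "?Ms \<le> ?Mb" by (auto simp: Suc_le_eq)
    moreover have "1 \<le> real ?Ms" "1 \<le> real ?Mb" using calculation by linarith+
    ultimately show ?thesis
      unfolding outage_line_eq[OF \<open>1 \<le> ?Ms\<close> \<open>?Ms \<le> ?Mb\<close> \<open>1 \<le> ?Ms\<close>]
      by (intro add_nonneg_nonneg mult_nonneg_nonneg) auto
  qed
  then have "le_exp (expected_distortion TYPE('t \<times> 'r) b \<rho>s L (\<lambda>_. 0)) \<nu>"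
    using \<nu> by (intro expected_distortion_le_exp L) (auto simp: x Suc_le_eq intro!: bexI[of _ ?Ms])
  moreover have "ge_exp (expected_distortion TYPE('t \<times> 'r) b \<rho>s L (\<lambda>_. 0)) \<nu>"
    using expected_distortion_ge_exp_all[where 't = 't and 'r = 'r, OF L, of "\<lambda>_. 0"] \<nu> by (simp add: x)
  ultimately show "ls_has_exponent TYPE('t \<times> 'r) b \<rho>s L (\<lambda>_. 0) \<nu>" by (rule has_exponentI)
qed simp

text \<open>The progress guaranteed by L greedy steps of duration b / L tends to b, so for large L
  it exceeds any required time below b.\<close>

lemma Delta_ls_achievable:
  fixes \<delta> :: real
  defines "Ms \<equiv> min CARD('t::finite) CARD('r::finite)" and "Mb \<equiv> max CARD('t) CARD('r)"
  assumes \<delta>: "0 < \<delta>" "\<delta> < real Ms * real Mb" and T: "layer_time Ms Mb \<nu> \<delta> < b"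
  shows "\<forall>\<^sub>F L in sequentially. ereal (\<nu> + \<delta>) \<le> Delta_ls TYPE('t \<times> 'r) b \<rho>s L"
proof -
  have M: "1 \<le> Ms" "Ms \<le> Mb" by (auto simp: Ms_def Mb_def Suc_le_eq)
  define G where "G = inv_outage Ms Mb \<delta>"
  have G: "0 < G" unfolding G_def using \<delta> by (intro inv_outage_pos[OF M])
  have "((\<lambda>L. b * G / (G + b / real L * real Ms)) \<longlongrightarrow> b * G / (G + 0 * real Ms)) sequentially"
    using G by (intro tendsto_intros lim_const_over_n) auto
  then have lim: "((\<lambda>L. b * G / (G + b / real L * real Ms)) \<longlongrightarrow> b) sequentially" using G by simp
  have "\<forall>\<^sub>F L in sequentially. layer_time Ms Mb \<nu> \<delta> < b * G / (G + b / real L * real Ms)"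
    by (rule order_tendstoD(1)[OF lim T])
  then show ?thesis
    using eventually_gt_at_top[of 0]
  proof eventually_elim
    case (elim L)
    define h where "h = b / real L"
    have h: "0 < h" using b elim by (simp add: h_def)
    have "real L * (h * G / (G + h * real Ms)) = b * G / (G + b / real L * real Ms)"
      using elim by (simp add: h_def)
    then have big: "layer_time Ms Mb \<nu> \<delta> < real L * (h * inv_outage Ms Mb \<delta> / (inv_outage Ms Mb \<delta> + h * real Ms))" using elim by (simp add: G_def)
    define x where "x = greedy Ms Mb \<nu> \<delta> h"
    note P = greedy_props[OF M \<nu> \<delta> less_imp_le[OF h], folded x_def]
    have xL: "x L = \<nu> + \<delta>" unfolding x_def by (rule greedy_reaches[OF M \<nu> \<delta> h big])
    \<comment> \<open>Inverts \<open>cum_exponent\<close>, so that the greedy positions become the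
      cumulated exponents.\<close>
    define r where "r l = (x l - x (l - 1)) / h" for l
    have r0: "0 \<le> r l" if "l \<in> {1..L}" for l
      using P(3)[of "l - 1"] h that by (simp add: r_def)
    have cum_exponent: "cum_exponent b L r l = x l" for l
    proof (induction l)
      case 0
      then show ?case by (simp add: cum_exponent_def x_def greedy.simps(1)[OF M])
    next
      case (Suc l)
      have "cum_exponent b L r (Suc l) = cum_exponent b L r l + h * r (Suc l)" by (simp add: cum_exponent_def h_def distrib_left)
      also have "h * r (Suc l) = x (Suc l) - x l" using h by (simp add: r_def)
      also have "cum_exponent b L r l + (x (Suc l) - x l) = x (Suc l)" using Suc by simp
      finally show ?case .
    qed
    have k: "\<exists>k\<in>{1..min CARD('t) CARD('r)}. \<nu> + \<delta> \<le> max \<nu> (cum_exponent b L r (l - 1)) + outage_line (min CARD('t) CARD('r)) (max CARD('t) CARD('r)) k (r l)"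
      if l: "l \<in> {1..L}" for l
    proof -
      define u where "u = \<nu> + \<delta> - max \<nu> (x (l - 1))"
      have "x l = min (\<nu> + \<delta>) (x (l - 1) + h * inv_outage Ms Mb u)"
        using l greedy.simps(2)[OF M, of \<nu> \<delta> h "l - 1"] by (simp add: x_def u_def)
      then have "x l - x (l - 1) \<le> h * inv_outage Ms Mb u" by simp
      then have "r l \<le> inv_outage Ms Mb u" using h by (simp add: r_def pos_divide_le_eq mult.commute)
      then obtain k where "k \<in> {1..Ms}" "u \<le> outage_line Ms Mb k (r l)" using le_inv_outage_iff[OF M] by blast
      then show ?thesis unfolding Ms_def[symmetric] Mb_def[symmetric] cum_exponent u_def by (intro bexI[of _ k]) auto
    qed
    have e: "max \<nu> (cum_exponent b L r L) = \<nu> + \<delta>" using xL \<delta> by (simp add: cum_exponent)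
    have "le_exp (expected_distortion TYPE('t \<times> 'r) b \<rho>s L r) (\<nu> + \<delta>)"
      by (rule expected_distortion_le_exp[OF elim(2) r0 k]) (simp_all add: e)
    moreover have "ge_exp (expected_distortion TYPE('t \<times> 'r) b \<rho>s L r) (\<nu> + \<delta>)"
      unfolding e[symmetric] by (rule expected_distortion_ge_exp_all[OF elim(2) r0])
    ultimately show ?case by (intro Delta_ls_ge[OF r0] has_exponentI)
  qed
qed

text \<open>Both cases of the theorem at once: either \<delta> solves \<open>layer_time = b\<close>,
  or \<delta> = 0 and b does not exceed even the time needed to reach \<nu>. In each case the
  converse holds for every L, and strict monotonicity of the required time transfers it to
  \<delta>.\<close>

lemma Delta_ls_limit:
  fixes \<delta> :: real
  defines "Ms \<equiv> min CARD('t::finite) CARD('r::finite)" and "Mb \<equiv> max CARD('t) CARD('r)"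
  assumes \<delta>: "0 \<le> \<delta>" "\<delta> < real Ms * real Mb" and T: "b \<le> layer_time Ms Mb \<nu> \<delta>" "\<delta> = 0 \<or> layer_time Ms Mb \<nu> \<delta> \<le> b"
  shows "(\<lambda>L. Delta_ls TYPE('t \<times> 'r) b \<rho>s L) \<longlonglongrightarrow> ereal (\<nu> + \<delta>)"
proof (rule order_tendstoI)
  have M: "1 \<le> Ms" "Ms \<le> Mb" by (auto simp: Ms_def Mb_def Suc_le_eq)
  {
    fix a assume a: "a < ereal (\<nu> + \<delta>)"
    show "\<forall>\<^sub>F L in sequentially. a < Delta_ls TYPE('t \<times> 'r) b \<rho>s L"
    proof (cases "\<delta> = 0")
      case True
      show ?thesis using eventually_gt_at_top[of 0]
      proof eventually_elim
        case (elim L)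
        then show ?case using a True Delta_ls_ge_nu[where 't = 't and 'r = 'r, OF elim] by (simp add: less_le_trans)
      qed
    next
      case False
      obtain y where y: "a < ereal y" "ereal y < ereal (\<nu> + \<delta>)" using ereal_dense2[OF a] by blast
      \<comment> \<open>Achievability asks for strictly less time than b, so a smaller target is
        taken; the maximum with \<delta>/2 keeps it positive.\<close>
      define \<delta>' where "\<delta>' = max (y - \<nu>) (\<delta> / 2)"
      have d: "0 < \<delta>'" "\<delta>' < \<delta>" "y \<le> \<nu> + \<delta>'" using False \<delta> y by (auto simp: \<delta>'_def)
      have "layer_time Ms Mb \<nu> \<delta>' < layer_time Ms Mb \<nu> \<delta>" using d \<delta> by (intro layer_time_strict_mono[OF M \<nu>]) auto
      then have "layer_time Ms Mb \<nu> \<delta>' < b" using T False by auto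
      then have "\<forall>\<^sub>F L in sequentially. ereal (\<nu> + \<delta>') \<le> Delta_ls TYPE('t \<times> 'r) b \<rho>s L"
        using Delta_ls_achievable[where 't = 't and 'r = 'r, of \<delta>'] d \<delta> by (simp add: Ms_def Mb_def)
      then show ?thesis
      proof eventually_elim
        case (elim L)
        have "ereal y \<le> ereal (\<nu> + \<delta>')" using d by simp
        then show ?case using y(1) elim by (meson less_le_trans)
      qed
    qed
  }
  {
    fix a assume a: "ereal (\<nu> + \<delta>) < a"
    show "\<forall>\<^sub>F L in sequentially. Delta_ls TYPE('t \<times> 'r) b \<rho>s L < a"
      using eventually_gt_at_top[of 0]
    proof eventually_elim
      case (elim L)
      have "Delta_ls TYPE('t \<times> 'r) b \<rho>s L \<le> ereal (\<nu> + \<delta>)"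
        unfolding Delta_ls_def
      proof (rule Sup_least)
        fix z assume "z \<in> {ereal \<Delta> |\<Delta> r. (\<forall>l\<in>{1..L}. 0 \<le> r l) \<and> ls_has_exponent TYPE('t \<times> 'r) b \<rho>s L r \<Delta>}"
        then obtain \<Delta> r where z: "z = ereal \<Delta>" and r: "\<And>l. l \<in> {1..L} \<Longrightarrow> 0 \<le> r l"
          and ex: "ls_has_exponent TYPE('t \<times> 'r) b \<rho>s L r \<Delta>" by blast
        have "\<Delta> \<le> \<nu> + \<delta>"
        proof (rule ccontr)
          assume n: "\<not> \<Delta> \<le> \<nu> + \<delta>"
          then have "\<nu> < \<Delta>" using \<delta> by simp
          note C = exponent_converse[OF elim r ex this, folded Ms_def Mb_def]
          have "layer_time Ms Mb \<nu> \<delta> < layer_time Ms Mb \<nu> (\<Delta> - \<nu>)" using n \<delta> C(1) by (intro layer_time_strict_mono[OF M \<nu>]) auto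
          then show False using C(2) T(1) by simp
        qed
        then show "z \<le> ereal (\<nu> + \<delta>)" by (simp add: z)
      qed
      then show ?case using a by (rule le_less_trans)
    qed
  }
qed

end

theorem theorem4:
  fixes b \<nu> :: real and \<rho>s :: "real \<Rightarrow> real"
  assumes "0 < b" and "0 \<le> \<nu>"
    and "\<forall>\<rho>>0. 0 < \<rho>s \<rho>"
    and "((\<lambda>\<rho>. ln (\<rho>s \<rho>) / ln \<rho>) \<longlongrightarrow> \<nu>) at_top"
  shows "(b \<le> \<nu> / real (min CARD('t::finite) CARD('r::finite)) \<longrightarrow>
            (\<lambda>L. Delta_ls TYPE('t \<times> 'r) b \<rho>s L) \<longlonglongrightarrow> ereal \<nu>)
       \<and> (\<forall>k\<in>{1..min CARD('t) CARD('r)}.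
            ls_region (min CARD('t) CARD('r)) (max CARD('t) CARD('r)) b \<nu> k \<longrightarrow>
            (\<lambda>L. Delta_ls TYPE('t \<times> 'r) b \<rho>s L) \<longlonglongrightarrow>
              ereal (ls_exponent_formula (min CARD('t) CARD('r)) (max CARD('t) CARD('r)) b \<nu> k))"
proof (intro conjI impI ballI)
  have M: "1 \<le> min CARD('t) CARD('r)" "min CARD('t) CARD('r) \<le> max CARD('t) CARD('r)" by (auto simp: Suc_le_eq)
  have \<rho>s: "\<And>\<rho>. 0 < \<rho> \<Longrightarrow> 0 < \<rho>s \<rho>" using assms(3) by blast
  note lim = Delta_ls_limit[where 't = 't and 'r = 'r, OF assms(1,2) \<rho>s assms(4)]
  {
    assume "b \<le> \<nu> / real (min CARD('t) CARD('r))"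
    \<comment> \<open>This is \<delta> = 0, for which the required time is exactly \<nu> /
      Ms.\<close>
    then show "(\<lambda>L. Delta_ls TYPE('t \<times> 'r) b \<rho>s L) \<longlonglongrightarrow> ereal \<nu>"
      using lim[of 0] layer_time_0[OF M, of \<nu>] mult_pos_pos[of "real (min CARD('t) CARD('r))" "real (max CARD('t) CARD('r))"] M by simp
  }
  {
    fix k assume "k \<in> {1..min CARD('t) CARD('r)}" "ls_region (min CARD('t) CARD('r)) (max CARD('t) CARD('r)) b \<nu> k"
    from formula_solves[OF M assms(1,2) this] obtain \<delta> where
      "0 \<le> \<delta>" "\<delta> < real (min CARD('t) CARD('r)) * real (max CARD('t) CARD('r))"
      "layer_time (min CARD('t) CARD('r)) (max CARD('t) CARD('r)) \<nu> \<delta> = b"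
      "ls_exponent_formula (min CARD('t) CARD('r)) (max CARD('t) CARD('r)) b \<nu> k = \<nu> + \<delta>" by blast
    then show "(\<lambda>L. Delta_ls TYPE('t \<times> 'r) b \<rho>s L) \<longlonglongrightarrow>
              ereal (ls_exponent_formula (min CARD('t) CARD('r)) (max CARD('t) CARD('r)) b \<nu> k)"
      using lim[of \<delta>] by simp
  }
qed

end
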